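(* Fix $\kappa<1$ and consider parameters $\lambda>0$, $s\in[0,1]$ with $\lambda s^2=\kappa$. Then for $\lambda$ sufficiently large, $\limsup_{d\to\infty}V_d<+\infty$, so that no one-sided test for deciding $\mathbb P_{0,d}$ versus $\mathbb P_{1,d}$ exists.
   Context: Rooted trees are canonically labeled (root $\varnothing$; children of a node labeled $m$ with $c$ children are $\{m,1\},\dots,\{m,c\}$); $\mathcal X_n$ is the set of such trees of depth $\le n$, $p_n$ the pruning at depth $n$. $\mathrm{GW}_\mu$: law of a Galton–Watson tree with $\mathrm{Poisson}(\mu)$ offspring. Uniform random relabeling: independently at each node permute its children uniformly, then relabel canonically. A $(\lambda,s)$-augmentation of $\tau$ attaches to each node an independent $\mathrm{Poisson}(\lambda(1-s))$ number of new children, each receiving an independent $\mathrm{GW}_\lambda$ tree. Under $\mathbb P_0$, $(\mathbf t,\mathbf t')$ are independent $\mathrm{GW}_\lambda$ trees; under $\mathbb P_1$, $\boldsymbol\tau^*\sim\mathrm{GW}_{\lambda s}$, $\boldsymbol\tau,\boldsymbol\tau'$ are two independent $(\lambda,s)$-augmentations of $\boldsymbol\tau^*$ and $\mathbf t,\mathbf t'$ independent uniform relabelings of them. $\mathbb P_{i,n}$ is the law of $(p_n(\mathbf t),p_n(\mathbf t'))$ under $\mathbb P_i$. With $\boldsymbol\tau^*_d=p_d(\boldsymbol\tau^* )$ and $\mathbf t_d=p_d(\mathbf t)$ under $\mathbb P_1$, $V_d:=\mathbb E_1\left[\frac{\mathbb P_1(\boldsymbol\tau^*_d\mid\mathbf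 t_d)}{\mathbb P_1(\boldsymbol\tau^*_d)}\right]$. A one-sided test is a sequence $\mathcal T_n:\mathcal X_n^2\to\{0,1\}$ with $\mathbb P_{0,n}(\mathcal T_n=1)\to0$ and $\liminf_n\mathbb P_{1,n}(\mathcal T_n=1)>0$. *)

theory Defs
  imports "HOL-Probability.Probability" "HOL-Combinatorics.Permutations"
begin

text \<open>
  A canonically labelled, locally finite rooted tree is determined by the ordered list of the
  subtrees hanging from the children of its root: the label of a node is the sequence of
  positions leading to it (positions are counted from 0 here). Being a codatatype, the type
  contains the trees of infinite depth. Families of random variables attached to the nodes are
  indexed by such labels, of type \<^typ>\<open>nat list\<close>; if \<open>\<omega>\<close> is such a family, the one seen from
  the \<open>i\<close>-th child of the root is \<open>\<lambda>u. \<omega> (i # u)\<close>.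
\<close>

codatatype rtree = RNode (children: "rtree list")

primrec prune :: "nat \<Rightarrow> rtree \<Rightarrow> rtree" where
  "prune 0 t = RNode []"
| "prune (Suc n) t = RNode (map (prune n) (children t))"

primrec trees_upto :: "nat \<Rightarrow> rtree set" where
  "trees_upto 0 = {RNode []}"
| "trees_upto (Suc n) = {RNode ts | ts. set ts \<subseteq> trees_upto n}"

definition rtree_algebra :: "rtree measure" where
  "rtree_algebra = sigma UNIV {prune n -` A | n A. True}"

text \<open>\<open>N u\<close> is the number of children of the node labelled \<open>u\<close>.\<close>

primcorec tree_of_counts :: "(nat list \<Rightarrow> nat) \<Rightarrow> rtree" where
  "children (tree_of_counts N) = map (\<lambda>i. tree_of_counts (\<lambda>u. N (i # u))) [0..<N []]"

text \<open>The library's Poisson distribution is only specified for positive rates.\<close>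

definition poisson :: "real \<Rightarrow> nat pmf" where
  "poisson \<mu> = (if \<mu> = 0 then return_pmf 0 else poisson_pmf \<mu>)"

definition GW :: "real \<Rightarrow> rtree measure" where
  "GW \<mu> = distr (\<Pi>\<^sub>M u\<in>UNIV. measure_pmf (poisson \<mu>)) rtree_algebra tree_of_counts"

text \<open>
  If \<open>a u = (k, g)\<close>, the node labelled \<open>u\<close> receives \<open>k\<close> new children, placed after the existing
  ones, which carry the trees \<open>g 0, \<dots>, g (k - 1)\<close>.
\<close>

primcorec augment :: "(nat list \<Rightarrow> nat \<times> (nat \<Rightarrow> rtree)) \<Rightarrow> rtree \<Rightarrow> rtree" where
  "children (augment a t) =
     map (\<lambda>i. if i < length (children t)
              then augment (\<lambda>u. a (i # u)) (children t ! i)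
              else snd (a []) (i - length (children t)))
         [0..<length (children t) + fst (a [])]"

definition augment_noise :: "real \<Rightarrow> real \<Rightarrow> (nat list \<Rightarrow> nat \<times> (nat \<Rightarrow> rtree)) measure" where
  "augment_noise lam s =
     (\<Pi>\<^sub>M u\<in>UNIV. measure_pmf (poisson (lam * (1 - s))) \<Otimes>\<^sub>M (\<Pi>\<^sub>M j\<in>UNIV. GW lam))"

text \<open>
  \<open>\<sigma> u c\<close> is the permutation used at the node with original label \<open>u\<close> when this node has \<open>c\<close>
  children. A permutation is drawn for every \<open>c\<close>, so that the noise does not depend on the tree.
\<close>

primcorec relabel :: "(nat list \<Rightarrow> nat \<Rightarrow> nat \<Rightarrow> nat) \<Rightarrow> rtree \<Rightarrow> rtree" where
  "children (relabel \<sigma> t) =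
     map (\<lambda>i. relabel (\<lambda>u. \<sigma> (\<sigma> [] (length (children t)) i # u))
                      (children t ! \<sigma> [] (length (children t)) i))
         [0..<length (children t)]"

definition relabel_noise :: "(nat list \<Rightarrow> nat \<Rightarrow> nat \<Rightarrow> nat) measure" where
  "relabel_noise =
     (\<Pi>\<^sub>M u\<in>UNIV. \<Pi>\<^sub>M c\<in>UNIV. measure_pmf (pmf_of_set {\<pi>. \<pi> permutes {..<c}}))"

definition P0 :: "real \<Rightarrow> (rtree \<times> rtree) measure" where
  "P0 lam = GW lam \<Otimes>\<^sub>M GW lam"

text \<open>
  Outcomes of the correlated model: the common tree, the two augmentation noises and the two
  relabelling noises, all independent.
\<close>

type_synonym outcome =
  "rtree \<times> (nat list \<Rightarrow> nat \<times> (nat \<Rightarrow> rtree)) \<times> (nat list \<Rightarrow> nat \<times> (nat \<Rightarrow> rtree))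
     \<times> (nat list \<Rightarrow> nat \<Rightarrow> nat \<Rightarrow> nat) \<times> (nat list \<Rightarrow> nat \<Rightarrow> nat \<Rightarrow> nat)"

definition P1 :: "real \<Rightarrow> real \<Rightarrow> outcome measure" where
  "P1 lam s = GW (lam * s) \<Otimes>\<^sub>M augment_noise lam s \<Otimes>\<^sub>M augment_noise lam s
              \<Otimes>\<^sub>M relabel_noise \<Otimes>\<^sub>M relabel_noise"

definition common_tree :: "outcome \<Rightarrow> rtree" where
  "common_tree = (\<lambda>(\<tau>, a, a', \<sigma>, \<sigma>'). \<tau>)"

definition left_tree :: "outcome \<Rightarrow> rtree" where
  "left_tree = (\<lambda>(\<tau>, a, a', \<sigma>, \<sigma>'). relabel \<sigma> (augment a \<tau>))"

definition right_tree :: "outcome \<Rightarrow> rtree" where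
  "right_tree = (\<lambda>(\<tau>, a, a', \<sigma>, \<sigma>'). relabel \<sigma>' (augment a' \<tau>))"

definition P0_upto :: "real \<Rightarrow> nat \<Rightarrow> (rtree \<times> rtree) measure" where
  "P0_upto lam n = distr (P0 lam) (count_space (trees_upto n \<times> trees_upto n))
                   (\<lambda>(t, t'). (prune n t, prune n t'))"

definition P1_upto :: "real \<Rightarrow> real \<Rightarrow> nat \<Rightarrow> (rtree \<times> rtree) measure" where
  "P1_upto lam s n = distr (P1 lam s) (count_space (trees_upto n \<times> trees_upto n))
                     (\<lambda>\<omega>. (prune n (left_tree \<omega>), prune n (right_tree \<omega>)))"

definition Vd :: "real \<Rightarrow> real \<Rightarrow> nat \<Rightarrow> ennreal" where
  "Vd lam s d = (\<integral>\<^sup>+ \<omega>. ennreal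
      (cond_prob (P1 lam s) (\<lambda>\<omega>'. prune d (common_tree \<omega>') = prune d (common_tree \<omega>))
                          (\<lambda>\<omega>'. prune d (left_tree \<omega>') = prune d (left_tree \<omega>))
       / \<P>(\<omega>' in P1 lam s. prune d (common_tree \<omega>') = prune d (common_tree \<omega>))) \<partial>P1 lam s)"

definition one_sided_test :: "real \<Rightarrow> real \<Rightarrow> (nat \<Rightarrow> rtree \<times> rtree \<Rightarrow> nat) \<Rightarrow> bool" where
  "one_sided_test lam s T \<longleftrightarrow>
     (\<forall>n. T n \<in> trees_upto n \<times> trees_upto n \<rightarrow> {0, 1}) \<and>
     (\<lambda>n. \<P>(x in P0_upto lam n. T n x = 1)) \<longlonglongrightarrow> 0 \<and>
     liminf (\<lambda>n. ereal (\<P>(x in P1_upto lam s n. T n x = 1))) > 0"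

end

theory Submission
  imports Defs
begin

text \<open>
  Write \<open>p\<close>, \<open>q\<close> for the laws of the common tree and of one observed tree pruned at depth \<open>d\<close>, and
  \<open>K x y = P(y | x) / q y\<close> for their likelihood ratio, so that \<open>V\<^sub>d\<close> is the squared norm of \<open>K\<close> in
  \<open>L\<^sup>2(p \<times> q)\<close>. Put \<open>K = 1 + D\<close>, where \<open>D\<close> is centred in each variable and has squared norm
  \<open>w = V\<^sub>d - 1\<close>. At depth \<open>d + 1\<close>, for root degrees \<open>c \<le> n\<close>, the likelihood ratio is
  \<open>\<pi>\<^bsub>\<lambda>(1-s)\<^esub>(n - c) / \<pi>\<^bsub>\<lambda>\<^esub>(n)\<close> times the average over permutations \<open>\<sigma>\<close> of \<open>{..<n}\<close> of
  \<open>\<Prod>i<c. K (x\<^sub>i) (y\<^bsub>\<sigma> i\<^esub>)\<close>. Expanding \<open>K = 1 + D\<close>, the terms of two pairs \<open>(S, \<sigma>)\<close>, \<open>(S', \<sigma>')\<close> are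
  orthogonal unless \<open>S = S'\<close> and \<open>\<sigma> ` S = \<sigma>' ` S\<close>, and then have inner product at most \<open>w ^ card S\<close>.
  So the average has second moment at most \<open>\<Sum>j\<le>c. w ^ j * (c choose j) / (n choose j)\<close>, and summing over
  the Poisson degrees gives \<open>V\<^bsub>d+1\<^esub> \<le> 1 / ((1 - s) * (1 - s * (V\<^sub>d - 1)))\<close>. For \<open>s \<le> 1/4\<close> the interval
  up to \<open>2\<close> is invariant, and \<open>s \<le> 1/4\<close> holds as soon as \<open>\<lambda> \<ge> 16\<close>.

  For the tests, split on \<open>K \<le> M\<close>: since both trees are conditionally independent given the common
  tree and have marginal \<open>q\<close>, every event \<open>A\<close> satisfies \<open>P\<^sub>1(A) \<le> V\<^sub>d / M + M * P\<^sub>0(A)\<close>.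
\<close>

section \<open>Pruned trees as a countable type\<close>

text \<open>The obstacle is that outcomes live on infinite trees driven by infinite families of
  noise, while the estimate needs explicit laws at finite depth. All quantities at depth
  \<open>d\<close> are functions of truncations, which are moved to the countable type
  \<open>ftree\<close>; there the laws are the pmf \<open>gw\<close> and the kernel
  \<open>tree_kernel\<close>, both derived from the independence of the root noise and the families
  seen from the children. D is centred for two different reasons: in the observed tree because K x
  is the density of a probability law, in the common tree because augmenting and relabelling a
  Galton-Watson tree of rate \<lambda> s gives one of rate \<lambda>. The coefficient 1 / (n choose
  j) is the fraction of permutations that send a given set of size j to a prescribed image. The
  Poisson weights fit this count exactly: binomial thinning turns the sum over degrees into a
  product of geometric and negative binomial series, hence the closed form of the recursion. A
  priori \<open>Vd\<close> may be infinite, so it stays in \<open>ennreal\<close> and its finiteness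
  is part of the induction.\<close>

datatype ftree = FNode (fchildren: "ftree list")

instance ftree :: countable
  by countable_datatype

text \<open>Copy of \<open>prune\<close> with values in a countable type, so that measurability into
  \<open>count_space UNIV\<close> and expansion of integrals over atoms become available. Since
  \<open>rtree_of\<close> is injective, events about \<open>prune\<close> and about
  \<open>trunc\<close> coincide.\<close>

primrec trunc :: "nat \<Rightarrow> rtree \<Rightarrow> ftree" where
  "trunc 0 t = FNode []"
| "trunc (Suc n) t = FNode (map (trunc n) (children t))"

primrec rtree_of :: "ftree \<Rightarrow> rtree" where
  "rtree_of (FNode ts) = RNode (map rtree_of ts)"

lemma inj_rtree_of: "inj rtree_of"
proof (rule injI)
  fix x y show "rtree_of x = rtree_of y \<Longrightarrow> x = y"
  proof (induction x arbitrary: y)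
    case (FNode xs)
    show ?case
    proof (cases y)
      case y: (FNode ys)
      from FNode.prems y have eq: "map rtree_of xs = map rtree_of ys" by simp
      then have "xs = ys"
        using FNode.IH by (intro nth_equalityI) (auto dest: map_eq_imp_length_eq simp: list_eq_iff_nth_eq)
      with y show ?thesis by simp
    qed
  qed
qed

lemma prune_eq_rtree_of: "prune n t = rtree_of (trunc n t)"
  by (induction n arbitrary: t) auto

lemma prune_eq_iff: "prune n t = prune n t' \<longleftrightarrow> trunc n t = trunc n t'"
  by (simp add: prune_eq_rtree_of inj_eq[OF inj_rtree_of])

lemma prune_in_trees_upto: "prune n t \<in> trees_upto n"
  by (induction n arbitrary: t) auto

lemma space_rtree_algebra [simp]: "space rtree_algebra = UNIV"
  by (simp add: rtree_algebra_def space_measure_of_conv)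

section \<open>Measurability of the operations on trees\<close>

lemma measurable_trunc [measurable]: "trunc n \<in> rtree_algebra \<rightarrow>\<^sub>M count_space UNIV"
proof (rule measurableI)
  fix B :: "ftree set"
  have "trunc n -` B = prune n -` (rtree_of ` B)"
    by (auto simp: prune_eq_rtree_of dest: injD[OF inj_rtree_of])
  then show "trunc n -` B \<inter> space rtree_algebra \<in> sets rtree_algebra"
    by (auto simp: rtree_algebra_def)
qed auto

text \<open>The truncations generate \<open>rtree_algebra\<close>, so only countable-valued maps
  remain to be checked. This is what opens the measurability claims to induction on the
  depth.\<close>

lemma measurable_rtree_algebraI:
  assumes "\<And>n. (\<lambda>x. trunc n (f x)) \<in> M \<rightarrow>\<^sub>M count_space UNIV"
  shows "f \<in> M \<rightarrow>\<^sub>M rtree_algebra"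
  unfolding rtree_algebra_def
proof (rule measurable_measure_of)
  fix Y assume "Y \<in> {prune n -` A | n A. True}"
  then obtain n A where Y: "Y = prune n -` A" by auto
  have "f -` Y \<inter> space M = (\<lambda>x. trunc n (f x)) -` {y. rtree_of y \<in> A} \<inter> space M"
    by (auto simp: Y prune_eq_rtree_of)
  with measurable_sets[OF assms[of n], of "{y. rtree_of y \<in> A}"] show "f -` Y \<inter> space M \<in> sets M"
    by simp
qed auto

lemma measurable_num_children [measurable]:
  "(\<lambda>t. length (children t)) \<in> rtree_algebra \<rightarrow>\<^sub>M count_space UNIV"
proof -
  have "(\<lambda>t. length (fchildren (trunc 1 t))) \<in> rtree_algebra \<rightarrow>\<^sub>M count_space UNIV"
    by measurable
  then show ?thesis by simp
qed

text \<open>The default value past the end of a list depends only on the excess index. Selecting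
  child \<open>k\<close> is therefore measurable as a total function, also at trees that have no
  such child.\<close>

lemma nth_beyond: "length xs \<le> k \<Longrightarrow> xs ! k = [] ! (k - length xs)"
  using nth_append[of xs "[]" k] by simp

lemma measurable_nth_children [measurable]:
  "(\<lambda>t. children t ! k) \<in> rtree_algebra \<rightarrow>\<^sub>M rtree_algebra"
proof (rule measurable_rtree_algebraI)
  fix n
  have "trunc n (children t ! k) =
      (let ys = fchildren (trunc (Suc n) t) in
       if k < length ys then ys ! k else trunc n ([] ! (k - length ys)))" for t
    using nth_beyond[of "children t" k] by (simp add: Let_def)
  then show "(\<lambda>t. trunc n (children t ! k)) \<in> rtree_algebra \<rightarrow>\<^sub>M count_space UNIV"
    using measurable_compose[OF measurable_trunc[of "Suc n"], of "\<lambda>y. let ys = fchildren y in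
       if k < length ys then ys ! k else trunc n ([] ! (k - length ys))" "count_space UNIV"]
    by simp
qed

text \<open>For a fixed length, entries are appended one at a time; the random length takes
  countably many values and is conditioned on.\<close>

lemma measurable_map_upt:
  fixes h :: "nat \<Rightarrow> 'a \<Rightarrow> 'b::countable"
  assumes [measurable]: "\<And>i. h i \<in> M \<rightarrow>\<^sub>M count_space UNIV" "L \<in> M \<rightarrow>\<^sub>M count_space UNIV"
  shows "(\<lambda>\<omega>. map (\<lambda>i. h i \<omega>) [0..<L \<omega>]) \<in> M \<rightarrow>\<^sub>M count_space UNIV"
proof -
  have *: "(\<lambda>\<omega>. map (\<lambda>i. h i \<omega>) [0..<k]) \<in> M \<rightarrow>\<^sub>M count_space UNIV" for k
  proof (induction k)
    case (Suc k)
    have "(\<lambda>\<omega>. (\<lambda>(xs, x). xs @ [x]) (map (\<lambda>i. h i \<omega>) [0..<k], h k \<omega>)) \<in> M \<rightarrow>\<^sub>M count_space UNIV"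
      by (rule measurable_compose[OF measurable_Pair[OF Suc assms(1)]])
         (simp add: pair_measure_countable)
    then show ?case by simp
  qed simp
  show ?thesis
    by (rule measurable_compose_countable[OF * assms(2)])
qed

lemma measurable_subfamily:
  "(\<lambda>\<omega> u. \<omega> (i # u)) \<in> (\<Pi>\<^sub>M u\<in>(UNIV :: nat list set). M) \<rightarrow>\<^sub>M (\<Pi>\<^sub>M u\<in>(UNIV :: nat list set). M)"
  by (rule measurable_PiM_single') (auto simp: space_PiM)

lemma measurable_pmf_count_space:
  "f \<in> M \<rightarrow>\<^sub>M measure_pmf P \<Longrightarrow> f \<in> M \<rightarrow>\<^sub>M count_space UNIV"
  by simp

lemma measurable_tree_of_counts:
  "tree_of_counts \<in> (\<Pi>\<^sub>M u\<in>UNIV. measure_pmf P) \<rightarrow>\<^sub>M rtree_algebra"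
proof (rule measurable_rtree_algebraI)
  fix n
  show "(\<lambda>N. trunc n (tree_of_counts N)) \<in> (\<Pi>\<^sub>M u\<in>UNIV. measure_pmf P) \<rightarrow>\<^sub>M count_space UNIV"
  proof (induction n)
    case (Suc n)
    let ?M = "\<Pi>\<^sub>M u\<in>(UNIV::nat list set). measure_pmf P"
    have "(\<lambda>N. map (\<lambda>i. trunc n (tree_of_counts (\<lambda>u. N (i # u)))) [0..<N []])
        \<in> ?M \<rightarrow>\<^sub>M count_space UNIV"
    proof (rule measurable_map_upt)
      show "(\<lambda>N. trunc n (tree_of_counts (\<lambda>u. N (i # u)))) \<in> ?M \<rightarrow>\<^sub>M count_space UNIV" for i
        using measurable_compose[OF measurable_subfamily Suc] .
      show "(\<lambda>N. N []) \<in> ?M \<rightarrow>\<^sub>M count_space UNIV"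
        by measurable
    qed
    from measurable_compose[OF this, of FNode "count_space UNIV"] show ?case
      by (simp add: comp_def)
  qed simp
qed

lemma sets_GW [measurable_cong, simp]: "sets (GW \<mu>) = sets rtree_algebra"
  by (simp add: GW_def)

lemma space_GW [simp]: "space (GW \<mu>) = UNIV"
  by (simp add: GW_def)

lemma measurable_augment:
  "(\<lambda>(a, t). augment a t) \<in> augment_noise lam s \<Otimes>\<^sub>M rtree_algebra \<rightarrow>\<^sub>M rtree_algebra"
proof (rule measurable_rtree_algebraI)
  fix n
  have "(\<lambda>x. trunc n (augment (fst x) (snd x))) \<in> augment_noise lam s \<Otimes>\<^sub>M rtree_algebra \<rightarrow>\<^sub>M count_space UNIV"
  proof (induction n)
    case (Suc n)
    let ?M = "augment_noise lam s \<Otimes>\<^sub>M rtree_algebra"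
    have sub: "(\<lambda>x u. fst x (i # u)) \<in> ?M \<rightarrow>\<^sub>M augment_noise lam s" for i
      unfolding augment_noise_def by (rule measurable_compose[OF measurable_fst measurable_subfamily])
    have root: "(\<lambda>x. fst x []) \<in> ?M \<rightarrow>\<^sub>M
        measure_pmf (poisson (lam * (1 - s))) \<Otimes>\<^sub>M (\<Pi>\<^sub>M j\<in>UNIV. GW lam)"
      unfolding augment_noise_def by measurable
    have num: "(\<lambda>x. fst (fst x [])) \<in> ?M \<rightarrow>\<^sub>M count_space UNIV"
      by (rule measurable_pmf_count_space[OF measurable_compose[OF root measurable_fst]])
    have new: "(\<lambda>x. snd (fst x []) j) \<in> ?M \<rightarrow>\<^sub>M rtree_algebra" for j
    proof -
      have "(\<lambda>x. snd (fst x []) j) \<in> ?M \<rightarrow>\<^sub>M GW lam"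
        by (rule measurable_compose[OF measurable_compose[OF root measurable_snd]
              measurable_component_singleton]) simp
      from measurable_compose[OF this measurable_ident_sets[OF sets_GW]] show ?thesis .
    qed
    have len: "(\<lambda>x. length (children (snd x))) \<in> ?M \<rightarrow>\<^sub>M count_space UNIV"
      by measurable
    have "(\<lambda>x. map (\<lambda>i. trunc n (if i < length (children (snd x))
              then augment (\<lambda>u. fst x (i # u)) (children (snd x) ! i)
              else snd (fst x []) (i - length (children (snd x)))))
         [0..<length (children (snd x)) + fst (fst x [])]) \<in> ?M \<rightarrow>\<^sub>M count_space UNIV"
    proof (rule measurable_map_upt)
      fix i
      have 1: "(\<lambda>x. trunc n (augment (\<lambda>u. fst x (i # u)) (children (snd x) ! i))) \<in> ?M \<rightarrow>\<^sub>M count_space UNIV"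
      proof -
        have "(\<lambda>x. (\<lambda>u. fst x (i # u), children (snd x) ! i)) \<in> ?M \<rightarrow>\<^sub>M ?M"
          by (rule measurable_Pair[OF sub measurable_compose[OF measurable_snd measurable_nth_children]])
        from measurable_compose[OF this Suc] show ?thesis by simp
      qed
      have 2: "(\<lambda>x. trunc n (snd (fst x []) (i - length (children (snd x))))) \<in> ?M \<rightarrow>\<^sub>M count_space UNIV"
        by (rule measurable_compose_countable[where g = "\<lambda>x. length (children (snd x))", OF _ len])
           (rule measurable_compose[OF new measurable_trunc])
      show "(\<lambda>x. trunc n (if i < length (children (snd x))
              then augment (\<lambda>u. fst x (i # u)) (children (snd x) ! i)
              else snd (fst x []) (i - length (children (snd x))))) \<in> ?M \<rightarrow>\<^sub>M count_space UNIV"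
        unfolding if_distrib[of "trunc n"]
        by (rule measurable_If[OF 1 2]) (rule measurable_sets_Collect[OF len], simp)
    next
      show "(\<lambda>x. length (children (snd x)) + fst (fst x [])) \<in> ?M \<rightarrow>\<^sub>M count_space UNIV"
        by (rule measurable_compose_countable[OF measurable_compose[OF num] len]) simp
    qed
    from measurable_compose[OF this, of FNode "count_space UNIV"] show ?case
      by (simp add: comp_def)
  qed simp
  then show "(\<lambda>x. trunc n (case x of (a, t) \<Rightarrow> augment a t)) \<in> augment_noise lam s \<Otimes>\<^sub>M rtree_algebra \<rightarrow>\<^sub>M count_space UNIV"
    by (simp add: case_prod_beta)
qed

lemma measurable_relabel:
  "(\<lambda>(\<sigma>, t). relabel \<sigma> t) \<in> relabel_noise \<Otimes>\<^sub>M rtree_algebra \<rightarrow>\<^sub>M rtree_algebra"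
proof (rule measurable_rtree_algebraI)
  fix n
  have "(\<lambda>x. trunc n (relabel (fst x) (snd x))) \<in> relabel_noise \<Otimes>\<^sub>M rtree_algebra \<rightarrow>\<^sub>M count_space UNIV"
  proof (induction n)
    case (Suc n)
    let ?M = "relabel_noise \<Otimes>\<^sub>M rtree_algebra"
    have sub: "(\<lambda>x u. fst x (i # u)) \<in> ?M \<rightarrow>\<^sub>M relabel_noise" for i
      unfolding relabel_noise_def by (rule measurable_compose[OF measurable_fst measurable_subfamily])
    have len: "(\<lambda>x. length (children (snd x))) \<in> ?M \<rightarrow>\<^sub>M count_space UNIV"
      by measurable
    have root: "(\<lambda>x. fst x []) \<in> ?M \<rightarrow>\<^sub>M (\<Pi>\<^sub>M c\<in>UNIV. measure_pmf (pmf_of_set {\<pi>. \<pi> permutes {..<c}}))"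
      unfolding relabel_noise_def by measurable
    have perm: "(\<lambda>x. fst x [] (length (children (snd x))) i) \<in> ?M \<rightarrow>\<^sub>M count_space UNIV" for i
    proof (rule measurable_compose_countable[where g = "\<lambda>x. length (children (snd x))", OF _ len])
      fix c :: nat
      have "(\<lambda>x. fst x [] c) \<in> ?M \<rightarrow>\<^sub>M measure_pmf (pmf_of_set {\<pi>. \<pi> permutes {..<c}})"
        by (rule measurable_compose[OF root measurable_component_singleton[OF UNIV_I]])
      then show "(\<lambda>x. fst x [] c i) \<in> ?M \<rightarrow>\<^sub>M count_space UNIV"
        by (rule measurable_compose) simp
    qed
    have "(\<lambda>x. map (\<lambda>i. trunc n (relabel (\<lambda>u. fst x (fst x [] (length (children (snd x))) i # u))
                      (children (snd x) ! fst x [] (length (children (snd x))) i)))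
         [0..<length (children (snd x))]) \<in> ?M \<rightarrow>\<^sub>M count_space UNIV"
    proof (rule measurable_map_upt[OF _ len])
      fix i
      show "(\<lambda>x. trunc n (relabel (\<lambda>u. fst x (fst x [] (length (children (snd x))) i # u))
                      (children (snd x) ! fst x [] (length (children (snd x))) i))) \<in> ?M \<rightarrow>\<^sub>M count_space UNIV"
      proof (rule measurable_compose_countable[where g = "\<lambda>x. fst x [] (length (children (snd x))) i", OF _ perm])
        fix k
        have "(\<lambda>x. (\<lambda>u. fst x (k # u), children (snd x) ! k)) \<in> ?M \<rightarrow>\<^sub>M ?M"
          by (rule measurable_Pair[OF sub measurable_compose[OF measurable_snd measurable_nth_children]])
        from measurable_compose[OF this Suc]
        show "(\<lambda>x. trunc n (relabel (\<lambda>u. fst x (k # u)) (children (snd x) ! k))) \<in> ?M \<rightarrow>\<^sub>M count_space UNIV"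
          by simp
      qed
    qed
    from measurable_compose[OF this, of FNode "count_space UNIV"] show ?case
      by (simp add: comp_def)
  qed simp
  then show "(\<lambda>x. trunc n (case x of (\<sigma>, t) \<Rightarrow> relabel \<sigma> t)) \<in> relabel_noise \<Otimes>\<^sub>M rtree_algebra \<rightarrow>\<^sub>M count_space UNIV"
    by (simp add: case_prod_beta)
qed

section \<open>Families indexed by the nodes of a tree\<close>

text \<open>Inverse of the passage from a family on labels to its root value and the families seen
  from the children. \<open>W\<close> is defined at every natural number, so the decomposition does
  not depend on the tree.\<close>

definition node_family :: "'a \<Rightarrow> (nat \<Rightarrow> nat list \<Rightarrow> 'a) \<Rightarrow> nat list \<Rightarrow> 'a" where
  "node_family x W u = (case u of [] \<Rightarrow> x | i # v \<Rightarrow> W i v)"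

lemma node_family_simps [simp]:
  "node_family x W [] = x" "node_family x W (i # v) = W i v" "(\<lambda>u. node_family x W (i # u)) = W i"
  by (simp_all add: node_family_def)

lemma measurable_node_family:
  "(\<lambda>(x, W). node_family x W) \<in> M \<Otimes>\<^sub>M (\<Pi>\<^sub>M i\<in>UNIV. \<Pi>\<^sub>M u\<in>UNIV. M) \<rightarrow>\<^sub>M (\<Pi>\<^sub>M u\<in>UNIV. M)"
proof (rule measurable_PiM_single')
  fix u :: "nat list"
  show "(\<lambda>\<omega>. (case \<omega> of (x, W) \<Rightarrow> node_family x W) u) \<in> M \<Otimes>\<^sub>M (\<Pi>\<^sub>M i\<in>UNIV. \<Pi>\<^sub>M u\<in>UNIV. M) \<rightarrow>\<^sub>M M"
  proof (cases u)
    case Nil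
    then show ?thesis by (simp add: case_prod_beta)
  next
    case (Cons i v)
    have "(\<lambda>\<omega>. snd \<omega> i) \<in> M \<Otimes>\<^sub>M (\<Pi>\<^sub>M i\<in>UNIV. \<Pi>\<^sub>M u\<in>UNIV. M) \<rightarrow>\<^sub>M (\<Pi>\<^sub>M u\<in>UNIV. M)"
      by measurable
    from measurable_compose[OF this measurable_component_singleton[OF UNIV_I, of v]] Cons
    show ?thesis by (simp add: case_prod_beta)
  qed
qed (auto simp: space_pair_measure space_PiM PiE_iff node_family_def split: list.split)

text \<open>The branching property at the level of the noise: the root value and the families seen
  from distinct children are independent, the latter with the original law. Finite cylinders
  characterise a product measure, and a cylinder over \<open>J\<close> splits into a condition at
  the root and one cylinder over \<open>V i\<close> for each first letter \<open>i\<close>.\<close>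

lemma distr_node_family:
  assumes "prob_space M"
  shows "distr (M \<Otimes>\<^sub>M (\<Pi>\<^sub>M i\<in>UNIV. \<Pi>\<^sub>M u\<in>UNIV. M)) (\<Pi>\<^sub>M u\<in>UNIV. M) (\<lambda>(x, W). node_family x W)
         = (\<Pi>\<^sub>M u\<in>UNIV. M)"
    (is "distr (M \<Otimes>\<^sub>M ?Q) ?P ?f = ?P")
proof -
  interpret M: prob_space M by fact
  interpret P: product_prob_space "\<lambda>_::nat list. M" UNIV
    by unfold_locales
  interpret Q: product_prob_space "\<lambda>_::nat. ?P" UNIV
    by unfold_locales
  have Q: "sigma_finite_measure ?Q" by (rule Q.sigma_finite_measure_axioms)
  show ?thesis
  proof (rule P.PiM_eq)
    fix J :: "nat list set" and F :: "nat list \<Rightarrow> 'a set"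
    assume J: "finite J" "J \<subseteq> UNIV" and F: "\<And>j. j \<in> J \<Longrightarrow> F j \<in> sets M"
    define I where "I = {i. \<exists>v. i # v \<in> J}"
    define V where "V i = {v. i # v \<in> J}" for i
    \<comment> \<open>Without a condition at the root this is the whole space, of mass 1, so the
      final product over \<open>J\<close> has the same form in both cases.\<close>
    define F0 where "F0 = (if [] \<in> J then F [] else space M)"
    have I: "finite I"
    proof (rule finite_subset)
      show "I \<subseteq> hd ` J" by (force simp: I_def image_iff)
    qed (use J in simp)
    have V: "finite (V i)" for i
    proof (rule finite_subset)
      show "V i \<subseteq> tl ` J" by (force simp: V_def image_iff)
    qed (use J in simp)
    let ?C = "\<lambda>i. {\<omega>\<in>space ?P. \<forall>v\<in>V i. \<omega> v \<in> F (i # v)}"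
    have C_eq: "?C i = prod_emb UNIV (\<lambda>_. M) (V i) (\<Pi>\<^sub>E v\<in>V i. F (i # v))" for i
      by (auto simp: prod_emb_def space_PiM PiE_iff)
    have C_sets: "?C i \<in> sets ?P" for i
      unfolding C_eq by (rule sets_PiM_I) (use V F in \<open>auto simp: V_def\<close>)
    have C_meas: "emeasure ?P (?C i) = (\<Prod>v\<in>V i. emeasure M (F (i # v)))" for i
      by (rule P.emeasure_PiM_Collect) (use V F in \<open>auto simp: V_def\<close>)
    have F0: "F0 \<in> sets M" using F by (auto simp: F0_def)
    let ?E = "{W\<in>space ?Q. \<forall>i\<in>I. W i \<in> ?C i}"
    have E_eq: "?E = prod_emb UNIV (\<lambda>_. ?P) I (\<Pi>\<^sub>E i\<in>I. ?C i)"
      by (auto simp: prod_emb_def space_PiM PiE_iff)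
    have E_sets: "?E \<in> sets ?Q"
      unfolding E_eq by (rule sets_PiM_I) (use I C_sets in auto)
    have E_meas: "emeasure ?Q ?E = (\<Prod>i\<in>I. \<Prod>v\<in>V i. emeasure M (F (i # v)))"
      unfolding C_meas[symmetric] by (rule Q.emeasure_PiM_Collect) (use I C_sets in auto)
    have cyl: "prod_emb UNIV (\<lambda>_. M) J (\<Pi>\<^sub>E j\<in>J. F j) \<in> sets ?P"
      by (rule sets_PiM_I) (use J F in auto)
    have vimage: "?f -` prod_emb UNIV (\<lambda>_. M) J (\<Pi>\<^sub>E j\<in>J. F j) \<inter> space (M \<Otimes>\<^sub>M ?Q) = F0 \<times> ?E"
    proof (intro equalityI subsetI)
      fix z assume "z \<in> ?f -` prod_emb UNIV (\<lambda>_. M) J (\<Pi>\<^sub>E j\<in>J. F j) \<inter> space (M \<Otimes>\<^sub>M ?Q)"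
      then obtain x W where z: "z = (x, W)" "x \<in> space M" "W \<in> space ?Q"
        and m: "\<And>j. j \<in> J \<Longrightarrow> node_family x W j \<in> F j"
        by (auto simp: prod_emb_def space_pair_measure restrict_PiE_iff)
      have "x \<in> F0" using m[of "[]"] z by (auto simp: F0_def)
      moreover have "W \<in> ?E"
        using z m[of "_ # _"] by (auto simp: I_def V_def space_PiM)
      ultimately show "z \<in> F0 \<times> ?E" using z by auto
    next
      fix z assume "z \<in> F0 \<times> ?E"
      then obtain x W where z: "z = (x, W)" "x \<in> F0" "W \<in> ?E" by auto
      then have x: "x \<in> space M" using sets.sets_into_space[OF F0] by auto
      have "node_family x W j \<in> F j" if "j \<in> J" for j
        using z that by (cases j) (auto simp: F0_def I_def V_def)
      moreover have "node_family x W \<in> UNIV \<rightarrow>\<^sub>E space M"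
        using x z by (auto simp: space_PiM PiE_iff node_family_def split: list.split)
      ultimately show "z \<in> ?f -` prod_emb UNIV (\<lambda>_. M) J (\<Pi>\<^sub>E j\<in>J. F j) \<inter> space (M \<Otimes>\<^sub>M ?Q)"
        using z x by (auto simp: prod_emb_def space_pair_measure restrict_PiE_iff)
    qed
    have "emeasure (distr (M \<Otimes>\<^sub>M ?Q) ?P ?f) (prod_emb UNIV (\<lambda>_. M) J (\<Pi>\<^sub>E j\<in>J. F j)) = emeasure (M \<Otimes>\<^sub>M ?Q) (F0 \<times> ?E)"
      by (subst emeasure_distr[OF measurable_node_family cyl]) (simp only: vimage)
    also have "\<dots> = emeasure M F0 * (\<Prod>i\<in>I. \<Prod>v\<in>V i. emeasure M (F (i # v)))"
      using sigma_finite_measure.emeasure_pair_measure_Times[OF Q F0 E_sets]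
      by (simp only: E_meas)
    also have "(\<Prod>i\<in>I. \<Prod>v\<in>V i. emeasure M (F (i # v))) = (\<Prod>j\<in>J - {[]}. emeasure M (F j))"
    proof (subst prod.Sigma)
      show "(\<Prod>(i, v)\<in>Sigma I V. emeasure M (F (i # v))) = (\<Prod>j\<in>J - {[]}. emeasure M (F j))"
        by (rule prod.reindex_bij_witness[where i = "\<lambda>j. (hd j, tl j)" and j = "\<lambda>(i, v). i # v"])
           (auto simp: I_def V_def neq_Nil_conv)
    qed (use I V in auto)
    also have "emeasure M F0 * \<dots> = (\<Prod>j\<in>J. emeasure M (F j))"
      using J by (cases "[] \<in> J") (simp_all add: F0_def prod.remove M.emeasure_space_1)
    finally show "emeasure (distr (M \<Otimes>\<^sub>M ?Q) ?P ?f) (prod_emb UNIV (\<lambda>_. M) J (\<Pi>\<^sub>E j\<in>J. F j))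
        = (\<Prod>j\<in>J. emeasure M (F j))" .
  qed simp
qed

lemma nn_integral_node_family:
  assumes "prob_space M" and f: "f \<in> borel_measurable (\<Pi>\<^sub>M u\<in>UNIV. M)"
  shows "(\<integral>\<^sup>+\<omega>. f \<omega> \<partial>(\<Pi>\<^sub>M u\<in>UNIV. M)) =
    (\<integral>\<^sup>+x. \<integral>\<^sup>+W. f (node_family x W) \<partial>(\<Pi>\<^sub>M i\<in>UNIV. \<Pi>\<^sub>M u\<in>UNIV. M) \<partial>M)"
proof -
  interpret M: prob_space M by fact
  interpret Q: prob_space "\<Pi>\<^sub>M i\<in>(UNIV::nat set). \<Pi>\<^sub>M u\<in>(UNIV::nat list set). M"
    by (intro prob_space_PiM) (rule assms)
  have "(\<integral>\<^sup>+\<omega>. f \<omega> \<partial>(\<Pi>\<^sub>M u\<in>UNIV. M)) = (\<integral>\<^sup>+z. f (case z of (x, W) \<Rightarrow> node_family x W)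
      \<partial>(M \<Otimes>\<^sub>M (\<Pi>\<^sub>M i\<in>UNIV. \<Pi>\<^sub>M u\<in>UNIV. M)))"
    by (subst distr_node_family[OF assms(1), symmetric])
       (simp add: nn_integral_distr[OF measurable_node_family] f)
  also have "\<dots> = (\<integral>\<^sup>+x. \<integral>\<^sup>+W. f (node_family x W) \<partial>(\<Pi>\<^sub>M i\<in>UNIV. \<Pi>\<^sub>M u\<in>UNIV. M) \<partial>M)"
    by (subst Q.nn_integral_fst[symmetric])
       (use measurable_compose[OF measurable_node_family f] in simp_all)
  finally show ?thesis .
qed

lemma borel_measurable_PiM_prod:
  fixes g :: "'i \<Rightarrow> 'a \<Rightarrow> ennreal"
  assumes g: "\<And>i. i \<in> A \<Longrightarrow> g i \<in> borel_measurable N"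
  shows "(\<lambda>W. \<Prod>i\<in>A. g i (W i)) \<in> borel_measurable (\<Pi>\<^sub>M i\<in>UNIV. N)"
proof (rule borel_measurable_prod_ennreal)
  fix i assume "i \<in> A"
  have "(\<lambda>W. W i) \<in> (\<Pi>\<^sub>M i\<in>UNIV. N) \<rightarrow>\<^sub>M N" by simp
  from measurable_compose[OF this g[OF \<open>i \<in> A\<close>]]
  show "(\<lambda>W. g i (W i)) \<in> borel_measurable (\<Pi>\<^sub>M i\<in>UNIV. N)" .
qed

text \<open>The integrand sees only the coordinates in \<open>A\<close>, so the infinite product may
  be replaced by its finite marginal, where Fubini gives the factorisation.\<close>

lemma nn_integral_PiM_prod:
  assumes N: "prob_space N" and A: "finite A" and g: "\<And>i. i \<in> A \<Longrightarrow> g i \<in> borel_measurable N"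
  shows "(\<integral>\<^sup>+W. (\<Prod>i\<in>A. g i (W i)) \<partial>(\<Pi>\<^sub>M i\<in>UNIV. N)) = (\<Prod>i\<in>A. \<integral>\<^sup>+x. g i x \<partial>N)"
proof -
  interpret N: prob_space N by fact
  interpret P: product_prob_space "\<lambda>_. N" UNIV
    by unfold_locales
  have "(\<integral>\<^sup>+W. (\<Prod>i\<in>A. g i (W i)) \<partial>(\<Pi>\<^sub>M i\<in>A. N)) =
      (\<integral>\<^sup>+W. (\<Prod>i\<in>A. g i (restrict W A i)) \<partial>(\<Pi>\<^sub>M i\<in>UNIV. N))"
    using g by (subst P.distr_PiM_restrict_finite[OF A subset_UNIV, symmetric], subst nn_integral_distr)
               (auto intro!: borel_measurable_prod_ennreal measurable_restrict_subset)
  then show ?thesis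
    using P.product_nn_integral_prod[OF A g] by simp
qed

section \<open>Laws of pruned trees\<close>

text \<open>The law of \<open>trunc d\<close> under \<open>GW \<mu>\<close>, as
  \<open>GW_trunc_law\<close> confirms.\<close>

primrec gw :: "real \<Rightarrow> nat \<Rightarrow> ftree pmf" where
  "gw \<mu> 0 = return_pmf (FNode [])"
| "gw \<mu> (Suc d) = bind_pmf (poisson \<mu>) (\<lambda>n. map_pmf FNode (replicate_pmf n (gw \<mu> d)))"

lemma pmf_replicate_pmf:
  "pmf (replicate_pmf n p) ys = (if length ys = n then \<Prod>i<n. pmf p (ys ! i) else 0)"
proof (induction n arbitrary: ys)
  case (Suc n)
  have eq: "replicate_pmf (Suc n) p = map_pmf (\<lambda>(x, xs). x # xs) (pair_pmf p (replicate_pmf n p))"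
    by (simp add: pair_pmf_def map_bind_pmf bind_return_pmf map_pmf_def bind_assoc_pmf)
  show ?case
  proof (cases ys)
    case Nil
    then have "ys \<notin> set_pmf (replicate_pmf (Suc n) p)"
      by (simp add: set_replicate_pmf del: replicate_pmf.simps)
    with Nil show ?thesis by (simp add: set_pmf_iff del: replicate_pmf.simps)
  next
    case (Cons z zs)
    have "pmf (replicate_pmf (Suc n) p) ys = pmf (pair_pmf p (replicate_pmf n p)) (z, zs)"
      unfolding eq Cons
      using pmf_map_inj'[of "\<lambda>(x, xs). x # xs" "pair_pmf p (replicate_pmf n p)" "(z, zs)"]
      by (simp add: inj_on_def split_beta prod_eq_iff)
    then show ?thesis
      unfolding Cons by (simp only: pmf_pair Suc) (simp add: prod.lessThan_Suc_shift del: prod.lessThan_Suc)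
  qed
qed auto

lemma pmf_gw_Suc:
  "pmf (gw \<mu> (Suc d)) (FNode ys) =
     pmf (poisson \<mu>) (length ys) * (\<Prod>i<length ys. pmf (gw \<mu> d) (ys ! i))"
proof -
  have inj: "inj FNode" by (auto simp: inj_def)
  have "ennreal (pmf (gw \<mu> (Suc d)) (FNode ys)) =
      (\<integral>\<^sup>+n. ennreal (\<Prod>i<length ys. pmf (gw \<mu> d) (ys ! i)) * indicator {length ys} n \<partial>poisson \<mu>)"
    unfolding gw.simps ennreal_pmf_bind pmf_map_inj'[OF inj] pmf_replicate_pmf
    by (intro nn_integral_cong) (auto split: split_indicator)
  also have "\<dots> = ennreal (pmf (poisson \<mu>) (length ys) * (\<Prod>i<length ys. pmf (gw \<mu> d) (ys ! i)))"
    by (subst nn_integral_cmult_indicator)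
       (simp_all add: emeasure_pmf_single ennreal_mult prod_nonneg mult.commute)
  finally show ?thesis by (simp add: prod_nonneg)
qed

text \<open>Covers the point mass at rate 0 by the convention 0^0 = 1; this rate occurs for the
  common tree when s = 0 and for the augmentation when s = 1.\<close>

lemma pmf_poisson_eq: "0 \<le> \<mu> \<Longrightarrow> pmf (poisson \<mu>) k = \<mu> ^ k / fact k * exp (- \<mu>)"
  by (auto simp: poisson_def power_0_left)

lemma prob_space_GW: "prob_space (GW \<mu>)"
  unfolding GW_def
  by (intro prob_space.prob_space_distr prob_space_PiM measurable_tree_of_counts)
     (rule prob_space_measure_pmf)

lemma prob_space_pair: "prob_space M \<Longrightarrow> prob_space N \<Longrightarrow> prob_space (M \<Otimes>\<^sub>M N)"
proof -
  assume "prob_space M" "prob_space N"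
  then interpret M: prob_space M + N: prob_space N by auto
  interpret MN: pair_prob_space M N ..
  show ?thesis by (rule MN.prob_space_axioms)
qed

lemma prob_space_root_noise:
  "prob_space (measure_pmf (poisson \<mu>) \<Otimes>\<^sub>M (\<Pi>\<^sub>M j\<in>(UNIV::nat set). GW lam))"
  by (intro prob_space_pair prob_space_measure_pmf prob_space_PiM prob_space_GW)

lemma prob_space_augment_noise: "prob_space (augment_noise lam s)"
  unfolding augment_noise_def by (intro prob_space_PiM prob_space_root_noise)

lemma prob_space_root_relabel:
  "prob_space (\<Pi>\<^sub>M c\<in>UNIV. measure_pmf (pmf_of_set {\<pi>. \<pi> permutes {..<c::nat}}))"
  by (intro prob_space_PiM prob_space_measure_pmf)

lemma prob_space_relabel_noise: "prob_space relabel_noise"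
  unfolding relabel_noise_def by (intro prob_space_PiM prob_space_measure_pmf)

section \<open>The law of a uniformly relabelled tree\<close>

definition relabel_law :: "nat \<Rightarrow> ftree \<Rightarrow> rtree \<Rightarrow> ennreal" where
  "relabel_law d y t = (\<integral>\<^sup>+\<sigma>. indicator {y} (trunc d (relabel \<sigma> t)) \<partial>relabel_noise)"

lemma measurable_trunc_relabel:
  "(\<lambda>\<sigma>. trunc d (relabel \<sigma> t)) \<in> relabel_noise \<rightarrow>\<^sub>M count_space UNIV"
proof -
  have "(\<lambda>\<sigma>. (\<sigma>, t)) \<in> relabel_noise \<rightarrow>\<^sub>M relabel_noise \<Otimes>\<^sub>M rtree_algebra"
    by simp
  from measurable_compose[OF measurable_compose[OF this measurable_relabel] measurable_trunc]
  show ?thesis by simp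
qed

lemma borel_measurable_relabel_law [measurable]:
  "relabel_law d y \<in> borel_measurable rtree_algebra"
proof -
  interpret prob_space relabel_noise by (rule prob_space_relabel_noise)
  have "(\<lambda>(t, \<sigma>). (\<sigma>, t)) \<in> rtree_algebra \<Otimes>\<^sub>M relabel_noise \<rightarrow>\<^sub>M relabel_noise \<Otimes>\<^sub>M rtree_algebra"
    by measurable
  from measurable_compose[OF measurable_compose[OF measurable_compose[OF this measurable_relabel]
        measurable_trunc[of d]], of "indicator {y}" borel]
  have "(\<lambda>(t, \<sigma>). indicator {y} (trunc d (relabel \<sigma> t)) :: ennreal)
      \<in> borel_measurable (rtree_algebra \<Otimes>\<^sub>M relabel_noise)"
    by (simp add: case_prod_unfold)
  from borel_measurable_nn_integral[OF this] show ?thesis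
    unfolding relabel_law_def .
qed

lemma indicator_FNode_map:
  "length ys = n \<Longrightarrow> indicator {FNode ys} (FNode (map f [0..<n])) = (\<Prod>k<n. indicator {ys ! k} (f k) :: ennreal)"
proof -
  assume n: "length ys = n"
  have "FNode (map f [0..<n]) = FNode ys \<longleftrightarrow> (\<forall>k<n. f k = ys ! k)"
    using n by (auto simp: list_eq_iff_nth_eq)
  then show ?thesis
    by (auto simp: indicator_def intro!: prod.neutral[symmetric] prod_zero)
qed

text \<open>The root permutation is uniform and the subtrees are relabelled independently of it and
  of each other. The natural product runs over positions in the new tree; it is rewritten over old
  children, so that it can later be split into the old and the new children of an
  augmentation.\<close>

lemma relabel_law_Suc:
  assumes n: "length ys = n"
  shows "relabel_law (Suc d) (FNode ys) t = (if length (children t) = n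
     then (\<Sum>\<pi>|\<pi> permutes {..<n}. \<Prod>i<n. relabel_law d (ys ! \<pi> i) (children t ! i)) / fact n else 0)"
proof (cases "length (children t) = n")
  case False
  then have "indicator {FNode ys} (trunc (Suc d) (relabel \<sigma> t)) = (0 :: ennreal)" for \<sigma>
    using n by (auto simp: indicator_def)
  with False show ?thesis by (simp only: relabel_law_def) simp
next
  case True
  let ?R = "\<Pi>\<^sub>M c\<in>UNIV. measure_pmf (pmf_of_set {\<pi>. \<pi> permutes {..<c::nat}})"
  let ?Q = "\<Pi>\<^sub>M i\<in>(UNIV::nat set). relabel_noise"
  define h where "h \<pi> = (\<Prod>i<n. relabel_law d (ys ! inv \<pi> i) (children t ! i))" for \<pi>
  have set_perm: "set_pmf (pmf_of_set {\<pi>. \<pi> permutes {..<n}}) = {\<pi>. \<pi> permutes {..<n}}"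
    by (rule set_pmf_of_set) (auto simp: finite_permutations intro!: exI[of _ id] permutes_id)
  have ind: "indicator {FNode ys} (trunc (Suc d) (relabel \<sigma> t)) =
      (\<Prod>k<n. indicator {ys ! k} (trunc d (relabel (\<lambda>u. \<sigma> (\<sigma> [] n k # u)) (children t ! \<sigma> [] n k))) :: ennreal)" for \<sigma>
    unfolding indicator_FNode_map[OF n, symmetric] using True by (simp add: comp_def)
  have "relabel_law (Suc d) (FNode ys) t = (\<integral>\<^sup>+\<rho>. \<integral>\<^sup>+W.
      indicator {FNode ys} (trunc (Suc d) (relabel (node_family \<rho> W) t)) \<partial>?Q \<partial>?R)"
    unfolding relabel_law_def relabel_noise_def
  proof (rule nn_integral_node_family[OF prob_space_root_relabel])
    show "(\<lambda>\<sigma>. indicator {FNode ys} (trunc (Suc d) (relabel \<sigma> t))) \<in> borel_measurable (\<Pi>\<^sub>M u\<in>UNIV. ?R)"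
      using measurable_compose[OF measurable_trunc_relabel[of "Suc d" t], of "indicator {FNode ys}" borel]
      unfolding relabel_noise_def by simp
  qed
  also have "\<dots> = (\<integral>\<^sup>+\<rho>. \<integral>\<^sup>+W. (\<Prod>k<n. indicator {ys ! k} (trunc d (relabel (W (\<rho> n k)) (children t ! \<rho> n k)))) \<partial>?Q \<partial>?R)"
    unfolding ind by simp
  also have "\<dots> = (\<integral>\<^sup>+\<rho>. h (\<rho> n) \<partial>?R)"
  proof (rule nn_integral_cong_AE)
    \<comment> \<open>\<open>\<rho>\<close> is a whole family of permutations, one per degree. Only
      its entry at the actual degree \<open>n\<close> matters, and that entry permutes
      \<open>{..<n}\<close> almost surely.\<close>
    have "AE \<rho> in ?R. \<rho> n permutes {..<n}"
      by (rule AE_PiM_component[of UNIV "\<lambda>c. measure_pmf (pmf_of_set {\<pi>. \<pi> permutes {..<c}})" n "\<lambda>\<pi>. \<pi> permutes {..<n}"])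
         (auto simp: prob_space_measure_pmf AE_measure_pmf_iff set_perm)
    then show "AE \<rho> in ?R. (\<integral>\<^sup>+W. (\<Prod>k<n. indicator {ys ! k} (trunc d (relabel (W (\<rho> n k)) (children t ! \<rho> n k)))) \<partial>?Q) = h (\<rho> n)"
    proof (rule AE_mp, intro AE_I2 impI)
      fix \<rho> :: "nat \<Rightarrow> nat \<Rightarrow> nat" assume p: "\<rho> n permutes {..<n}"
      have "(\<Prod>k<n. indicator {ys ! k} (trunc d (relabel (W (\<rho> n k)) (children t ! \<rho> n k)))) =
          (\<Prod>i<n. indicator {ys ! inv (\<rho> n) i} (trunc d (relabel (W i) (children t ! i))) :: ennreal)" for W
        by (subst prod.permute[OF p]) (simp add: permutes_inverses[OF p] comp_def)
      then have "(\<integral>\<^sup>+W. (\<Prod>k<n. indicator {ys ! k} (trunc d (relabel (W (\<rho> n k)) (children t ! \<rho> n k)))) \<partial>?Q) =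
          (\<integral>\<^sup>+W. (\<Prod>i<n. indicator {ys ! inv (\<rho> n) i} (trunc d (relabel (W i) (children t ! i)))) \<partial>?Q)"
        by simp
      also have "\<dots> = h (\<rho> n)"
        unfolding h_def relabel_law_def
        by (rule nn_integral_PiM_prod[OF prob_space_relabel_noise])
           (auto intro!: measurable_compose[OF measurable_trunc_relabel])
      finally show "(\<integral>\<^sup>+W. (\<Prod>k<n. indicator {ys ! k} (trunc d (relabel (W (\<rho> n k)) (children t ! \<rho> n k)))) \<partial>?Q) = h (\<rho> n)" .
    qed
  qed
  also have "\<dots> = (\<integral>\<^sup>+\<pi>. h \<pi> \<partial>measure_pmf (pmf_of_set {\<pi>. \<pi> permutes {..<n}}))"
    by (subst distr_PiM_component[of UNIV "\<lambda>c. measure_pmf (pmf_of_set {\<pi>. \<pi> permutes {..<c}})" n, symmetric])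
       (simp_all add: prob_space_measure_pmf nn_integral_distr)
  also have "\<dots> = (\<Sum>\<pi>|\<pi> permutes {..<n}. h \<pi>) / fact n"
    by (subst nn_integral_pmf_of_set)
       (auto simp: finite_permutations card_permutations intro!: exI[of _ id] permutes_id)
  \<comment> \<open>Inversion is a bijection of the index set of the sum, which removes
    \<open>inv\<close>.\<close>
  also have "(\<Sum>\<pi>|\<pi> permutes {..<n}. h \<pi>) =
      (\<Sum>\<pi>|\<pi> permutes {..<n}. \<Prod>i<n. relabel_law d (ys ! \<pi> i) (children t ! i))"
    by (subst sum_permutations_inverse) (auto simp: h_def inv_inv_eq permutes_bij intro!: sum.cong prod.cong)
  finally show ?thesis using True by simp
qed

lemma GW_trunc_law:
  "(\<integral>\<^sup>+t. indicator {y} (trunc d t) \<partial>GW \<mu>) = ennreal (pmf (gw \<mu> d) y)"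
proof (induction d arbitrary: y)
  case 0
  interpret prob_space "GW \<mu>" by (rule prob_space_GW)
  show ?case using emeasure_space_1 by (simp add: indicator_def pmf_return)
next
  case (Suc d)
  obtain ys where y: "y = FNode ys" by (cases y)
  define n where "n = length ys"
  let ?P = "measure_pmf (poisson \<mu>)"
  let ?Q = "\<Pi>\<^sub>M i\<in>(UNIV::nat set). \<Pi>\<^sub>M u\<in>(UNIV::nat list set). ?P"
  have meas: "(\<lambda>N. indicator {y} (trunc d (tree_of_counts N)) :: ennreal) \<in> borel_measurable (\<Pi>\<^sub>M u\<in>UNIV. ?P)" for d y
    by (rule measurable_compose[OF measurable_compose[OF measurable_tree_of_counts measurable_trunc]]) simp
  have IH: "(\<integral>\<^sup>+N. indicator {y} (trunc d (tree_of_counts N)) \<partial>(\<Pi>\<^sub>M u\<in>UNIV. ?P)) = ennreal (pmf (gw \<mu> d) y)" for y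
    using Suc[of y] unfolding GW_def
    by (subst (asm) nn_integral_distr[OF measurable_tree_of_counts]) simp_all
  have prob: "prob_space (\<Pi>\<^sub>M u\<in>(UNIV::nat list set). ?P)"
    by (intro prob_space_PiM prob_space_measure_pmf)
  have eq: "indicator {y} (trunc (Suc d) (tree_of_counts N)) = (indicator {n} (N []) *
      (\<Prod>k<n. indicator {ys ! k} (trunc d (tree_of_counts (\<lambda>u. N (k # u))))) :: ennreal)" for N
  proof (cases "N [] = n")
    case True
    then show ?thesis
      unfolding y indicator_FNode_map[OF n_def[symmetric], symmetric] by (simp add: comp_def)
  next
    case False
    then show ?thesis by (auto simp: y n_def indicator_def)
  qed
  have "(\<integral>\<^sup>+t. indicator {y} (trunc (Suc d) t) \<partial>GW \<mu>) =
      (\<integral>\<^sup>+N. indicator {y} (trunc (Suc d) (tree_of_counts N)) \<partial>(\<Pi>\<^sub>M u\<in>UNIV. ?P))"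
    unfolding GW_def
    by (rule nn_integral_distr[OF measurable_tree_of_counts])
       (simp only: measurable_distr_eq1, rule measurable_compose[OF measurable_trunc], simp)
  also have "\<dots> = (\<integral>\<^sup>+x. \<integral>\<^sup>+W. indicator {y} (trunc (Suc d) (tree_of_counts (node_family x W))) \<partial>?Q \<partial>?P)"
    by (rule nn_integral_node_family[OF prob_space_measure_pmf meas])
  also have "\<dots> = (\<integral>\<^sup>+x. \<integral>\<^sup>+W. indicator {n} x * (\<Prod>k<n. indicator {ys ! k} (trunc d (tree_of_counts (W k)))) \<partial>?Q \<partial>?P)"
    unfolding eq by simp
  also have "\<dots> = (\<integral>\<^sup>+x. indicator {n} x * (\<Prod>k<n. ennreal (pmf (gw \<mu> d) (ys ! k))) \<partial>?P)"
  proof (rule nn_integral_cong)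
    fix x
    have "(\<integral>\<^sup>+W. indicator {n} x * (\<Prod>k<n. indicator {ys ! k} (trunc d (tree_of_counts (W k)))) \<partial>?Q) =
      indicator {n} x * (\<integral>\<^sup>+W. (\<Prod>k<n. indicator {ys ! k} (trunc d (tree_of_counts (W k)))) \<partial>?Q)"
      by (rule nn_integral_cmult)
         (rule borel_measurable_PiM_prod[OF meas])
    also have "(\<integral>\<^sup>+W. (\<Prod>k<n. indicator {ys ! k} (trunc d (tree_of_counts (W k)))) \<partial>?Q) =
        (\<Prod>k<n. ennreal (pmf (gw \<mu> d) (ys ! k)))"
      unfolding IH[symmetric] by (rule nn_integral_PiM_prod[OF prob]) (simp_all add: meas)
    finally show "(\<integral>\<^sup>+W. indicator {n} x * (\<Prod>k<n. indicator {ys ! k} (trunc d (tree_of_counts (W k)))) \<partial>?Q) =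
      indicator {n} x * (\<Prod>k<n. ennreal (pmf (gw \<mu> d) (ys ! k)))" .
  qed
  also have "\<dots> = ennreal (pmf (gw \<mu> (Suc d)) y)"
    unfolding y pmf_gw_Suc
    by (simp add: nn_integral_multc emeasure_pmf_single n_def prod_ennreal ennreal_mult prod_nonneg)
  finally show ?case .
qed

text \<open>Uniform relabelling preserves the Galton-Watson law: the subtrees are independent with a
  common law, so each of the \<open>n!\<close> permutations contributes the same product. This
  provides the weights of the newly attached subtrees.\<close>

lemma GW_relabel_law:
  "(\<integral>\<^sup>+t. relabel_law d y t \<partial>GW \<mu>) = ennreal (pmf (gw \<mu> d) y)"
proof (induction d arbitrary: y)
  case 0
  interpret prob_space "GW \<mu>" by (rule prob_space_GW)
  interpret R: prob_space relabel_noise by (rule prob_space_relabel_noise)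
  show ?case using emeasure_space_1 by (simp add: relabel_law_def R.emeasure_space_1 indicator_def pmf_return)
next
  case (Suc d)
  obtain ys where y: "y = FNode ys" by (cases y)
  define n where "n = length ys"
  let ?P = "measure_pmf (poisson \<mu>)"
  let ?Q = "\<Pi>\<^sub>M i\<in>(UNIV::nat set). \<Pi>\<^sub>M u\<in>(UNIV::nat list set). ?P"
  let ?S = "{\<pi>. \<pi> permutes {..<n}}"
  have meas: "(\<lambda>N. relabel_law d y (tree_of_counts N)) \<in> borel_measurable (\<Pi>\<^sub>M u\<in>UNIV. ?P)" for d y
    by (rule measurable_compose[OF measurable_tree_of_counts]) simp
  have IH: "(\<integral>\<^sup>+N. relabel_law d y (tree_of_counts N) \<partial>(\<Pi>\<^sub>M u\<in>UNIV. ?P)) = ennreal (pmf (gw \<mu> d) y)" for y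
    using Suc[of y] unfolding GW_def
    by (subst (asm) nn_integral_distr[OF measurable_tree_of_counts]) simp_all
  have prob: "prob_space (\<Pi>\<^sub>M u\<in>(UNIV::nat list set). ?P)"
    by (intro prob_space_PiM prob_space_measure_pmf)
  have eq: "relabel_law (Suc d) y (tree_of_counts N) = indicator {n} (N []) *
      ((\<Sum>\<pi>\<in>?S. \<Prod>i<n. relabel_law d (ys ! \<pi> i) (tree_of_counts (\<lambda>u. N (i # u)))) / fact n)" for N
    unfolding y relabel_law_Suc[OF n_def[symmetric]] by (simp add: indicator_def)
  have inner: "(\<integral>\<^sup>+W. (\<Prod>i<n. relabel_law d (ys ! \<pi> i) (tree_of_counts (W i))) \<partial>?Q) =
      (\<Prod>i<n. ennreal (pmf (gw \<mu> d) (ys ! i)))" if "\<pi> \<in> ?S" for \<pi>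
  proof -
    have "(\<integral>\<^sup>+W. (\<Prod>i<n. relabel_law d (ys ! \<pi> i) (tree_of_counts (W i))) \<partial>?Q) =
        (\<Prod>i<n. ennreal (pmf (gw \<mu> d) (ys ! \<pi> i)))"
      unfolding IH[symmetric] by (rule nn_integral_PiM_prod[OF prob]) (simp_all add: meas)
    also have "\<dots> = (\<Prod>i<n. ennreal (pmf (gw \<mu> d) (ys ! i)))"
      using prod.permute[of \<pi> "{..<n}" "\<lambda>i. ennreal (pmf (gw \<mu> d) (ys ! i))"] that by (simp add: comp_def)
    finally show ?thesis .
  qed
  have mprod: "(\<lambda>W. \<Prod>i<n. relabel_law d (ys ! \<pi> i) (tree_of_counts (W i))) \<in> borel_measurable ?Q" for \<pi>
    by (rule borel_measurable_PiM_prod[OF meas])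
  have "(\<integral>\<^sup>+t. relabel_law (Suc d) y t \<partial>GW \<mu>) =
      (\<integral>\<^sup>+N. relabel_law (Suc d) y (tree_of_counts N) \<partial>(\<Pi>\<^sub>M u\<in>UNIV. ?P))"
    unfolding GW_def by (subst nn_integral_distr[OF measurable_tree_of_counts]) simp_all
  also have "\<dots> = (\<integral>\<^sup>+x. \<integral>\<^sup>+W. relabel_law (Suc d) y (tree_of_counts (node_family x W)) \<partial>?Q \<partial>?P)"
    by (rule nn_integral_node_family[OF prob_space_measure_pmf meas])
  also have "\<dots> = (\<integral>\<^sup>+x. \<integral>\<^sup>+W. indicator {n} x *
      ((\<Sum>\<pi>\<in>?S. \<Prod>i<n. relabel_law d (ys ! \<pi> i) (tree_of_counts (W i))) / fact n) \<partial>?Q \<partial>?P)"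
    unfolding eq by simp
  also have "\<dots> = (\<integral>\<^sup>+x. indicator {n} x * ((\<Sum>\<pi>\<in>?S. \<Prod>i<n. ennreal (pmf (gw \<mu> d) (ys ! i))) / fact n) \<partial>?P)"
    by (intro nn_integral_cong, subst nn_integral_cmult)
       (use mprod in \<open>simp_all add: nn_integral_divide nn_integral_sum inner\<close>)
  also have "(\<Sum>\<pi>\<in>?S. \<Prod>i<n. ennreal (pmf (gw \<mu> d) (ys ! i))) / fact n = (\<Prod>i<n. ennreal (pmf (gw \<mu> d) (ys ! i)))"
    by (simp add: card_permutations ennreal_mult_divide_eq mult.commute[of "fact n"])
  also have "(\<integral>\<^sup>+x. indicator {n} x * (\<Prod>i<n. ennreal (pmf (gw \<mu> d) (ys ! i))) \<partial>?P) = ennreal (pmf (gw \<mu> (Suc d)) y)"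
    unfolding y pmf_gw_Suc
    by (simp add: nn_integral_multc emeasure_pmf_single n_def prod_ennreal ennreal_mult prod_nonneg)
  finally show ?case .
qed

section \<open>The conditional law of an observed tree given the common tree\<close>

definition noise_kernel :: "real \<Rightarrow> real \<Rightarrow> nat \<Rightarrow> rtree \<Rightarrow> ftree \<Rightarrow> ennreal" where
  "noise_kernel lam s d x y = (\<integral>\<^sup>+a. relabel_law d y (augment a x) \<partial>augment_noise lam s)"

lemma borel_measurable_relabel_augment:
  "(\<lambda>a. relabel_law d y (augment a x)) \<in> borel_measurable (augment_noise lam s)"
proof -
  have "(\<lambda>a. (a, x)) \<in> augment_noise lam s \<rightarrow>\<^sub>M augment_noise lam s \<Otimes>\<^sub>M rtree_algebra"
    by simp
  from measurable_compose[OF measurable_compose[OF this measurable_augment] borel_measurable_relabel_law]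
  show ?thesis by simp
qed

lemma noise_kernel_0: "noise_kernel lam s 0 x y = indicator {FNode []} y"
proof -
  interpret A: prob_space "augment_noise lam s" by (rule prob_space_augment_noise)
  interpret R: prob_space relabel_noise by (rule prob_space_relabel_noise)
  show ?thesis
    by (simp add: noise_kernel_def relabel_law_def A.emeasure_space_1 R.emeasure_space_1 indicator_def)
qed

text \<open>The root has \<open>c\<close> old children and a Poisson number of new ones, which must
  equal \<open>n - c\<close>. For a fixed permutation the old children carry independent
  augmentation noise and contribute kernels; the new ones are relabelled Galton-Watson trees and
  contribute \<open>gw\<close> weights by \<open>GW_relabel_law\<close>.\<close>

lemma noise_kernel_Suc:
  fixes lam s :: real
  defines "p \<equiv> poisson (lam * (1 - s))"
  assumes n: "length ys = n" and c: "length (children x) = c"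
  shows "noise_kernel lam s (Suc d) x (FNode ys) = (if c \<le> n then ennreal (pmf p (n - c)) *
     ((\<Sum>\<pi>|\<pi> permutes {..<n}. (\<Prod>i<c. noise_kernel lam s d (children x ! i) (ys ! \<pi> i)) *
        (\<Prod>i=c..<n. ennreal (pmf (gw lam d) (ys ! \<pi> i)))) / fact n) else 0)"
proof -
  let ?S = "{\<pi>. \<pi> permutes {..<n}}"
  let ?G = "\<Pi>\<^sub>M j\<in>(UNIV::nat set). GW lam"
  let ?N = "measure_pmf p \<Otimes>\<^sub>M ?G"
  let ?Q = "\<Pi>\<^sub>M i\<in>(UNIV::nat set). augment_noise lam s"
  define K where "K \<pi> = (\<Prod>i<c. noise_kernel lam s d (children x ! i) (ys ! \<pi> i))" for \<pi>
  \<comment> \<open>\<open>A\<close> collects the old children and \<open>B\<close> the new ones,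
    the \<open>j\<close>-th of which has index \<open>c + j\<close>; they use disjoint parts of the
    noise.\<close>
  define A where "A \<pi> W = (\<Prod>i<c. relabel_law d (ys ! \<pi> i) (augment (W i) (children x ! i)))" for \<pi> W
  define B where "B \<pi> g = (\<Prod>j<n-c. relabel_law d (ys ! \<pi> (c + j)) (g j))" for \<pi> g
  define q where "q \<pi> = (\<Prod>i=c..<n. ennreal (pmf (gw lam d) (ys ! \<pi> i)))" for \<pi>
  interpret G: prob_space ?G by (intro prob_space_PiM prob_space_GW)
  have Am: "A \<pi> \<in> borel_measurable ?Q" for \<pi>
    unfolding A_def
    by (rule borel_measurable_PiM_prod) (rule borel_measurable_relabel_augment)
  have Bm: "B \<pi> \<in> borel_measurable ?G" for \<pi>
    unfolding B_def
    by (rule borel_measurable_PiM_prod) simp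
  have A: "(\<integral>\<^sup>+W. A \<pi> W \<partial>?Q) = K \<pi>" for \<pi>
    unfolding A_def K_def noise_kernel_def
    by (rule nn_integral_PiM_prod[OF prob_space_augment_noise]) (auto intro: borel_measurable_relabel_augment)
  have B: "(\<integral>\<^sup>+g. B \<pi> g \<partial>?G) = q \<pi>" if "c \<le> n" for \<pi>
  proof -
    have "(\<integral>\<^sup>+g. B \<pi> g \<partial>?G) = (\<Prod>j<n-c. ennreal (pmf (gw lam d) (ys ! \<pi> (c + j))))"
      unfolding B_def GW_relabel_law[symmetric]
      by (rule nn_integral_PiM_prod[OF prob_space_GW]) auto
    also have "\<dots> = q \<pi>"
      unfolding q_def
      by (rule prod.reindex_bij_witness[where i = "\<lambda>i. i - c" and j = "\<lambda>j. c + j"]) (use that in auto)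
    finally show ?thesis .
  qed
  have split: "relabel_law (Suc d) (FNode ys) (augment a x) = indicator {n} (c + fst (a [])) *
      ((\<Sum>\<pi>\<in>?S. A \<pi> (\<lambda>i u. a (i # u)) * B \<pi> (snd (a []))) / fact n)" for a
  proof (cases "c + fst (a []) = n")
    case True
    have "(\<Prod>i<n. relabel_law d (ys ! \<pi> i) (children (augment a x) ! i)) =
        A \<pi> (\<lambda>i u. a (i # u)) * B \<pi> (snd (a []))" for \<pi>
    proof -
      have un: "{..<n} = {..<c} \<union> {c..<n}" using True by auto
      have "(\<Prod>i<n. relabel_law d (ys ! \<pi> i) (children (augment a x) ! i)) =
         (\<Prod>i<c. relabel_law d (ys ! \<pi> i) (children (augment a x) ! i)) *
         (\<Prod>i=c..<n. relabel_law d (ys ! \<pi> i) (children (augment a x) ! i))"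
        by (subst un, rule prod.union_disjoint) auto
      moreover have "(\<Prod>i<c. relabel_law d (ys ! \<pi> i) (children (augment a x) ! i)) = A \<pi> (\<lambda>i u. a (i # u))"
        unfolding A_def using c True by (intro prod.cong) auto
      moreover have "(\<Prod>i=c..<n. relabel_law d (ys ! \<pi> i) (children (augment a x) ! i)) = B \<pi> (snd (a []))"
        unfolding B_def
        by (rule prod.reindex_bij_witness[where j = "\<lambda>i. i - c" and i = "\<lambda>j. c + j"]) (use True c in auto)
      ultimately show ?thesis by simp
    qed
    with True c show ?thesis by (simp add: relabel_law_Suc[OF n])
  next
    case False
    with c show ?thesis by (simp add: relabel_law_Suc[OF n])
  qed
  have "noise_kernel lam s (Suc d) x (FNode ys) =
     (\<integral>\<^sup>+z. \<integral>\<^sup>+W. relabel_law (Suc d) (FNode ys) (augment (node_family z W) x) \<partial>?Q \<partial>?N)"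
    unfolding noise_kernel_def augment_noise_def p_def
    by (rule nn_integral_node_family[OF prob_space_root_noise])
       (rule borel_measurable_relabel_augment[unfolded augment_noise_def])
  also have "\<dots> = (\<integral>\<^sup>+z. \<integral>\<^sup>+W. indicator {n} (c + fst z) * ((\<Sum>\<pi>\<in>?S. A \<pi> W * B \<pi> (snd z)) / fact n) \<partial>?Q \<partial>?N)"
    unfolding split by simp
  also have "\<dots> = (\<integral>\<^sup>+z. indicator {n} (c + fst z) * ((\<Sum>\<pi>\<in>?S. K \<pi> * B \<pi> (snd z)) / fact n) \<partial>?N)"
    by (intro nn_integral_cong, subst nn_integral_cmult)
       (use Am in \<open>simp_all add: nn_integral_divide nn_integral_sum nn_integral_multc A\<close>)
  also have "\<dots> = (\<integral>\<^sup>+m. \<integral>\<^sup>+g. indicator {n} (c + m) * ((\<Sum>\<pi>\<in>?S. K \<pi> * B \<pi> g) / fact n) \<partial>?G \<partial>p)"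
  proof (subst G.nn_integral_fst[symmetric])
    have 1: "(\<lambda>z. indicator {n} (c + fst z) :: ennreal) \<in> borel_measurable ?N"
      by (rule measurable_compose[OF measurable_fst]) simp
    have 2: "(\<lambda>z. B \<pi> (snd z)) \<in> borel_measurable ?N" for \<pi>
      by (rule measurable_compose[OF measurable_snd Bm])
    show "(\<lambda>z. indicator {n} (c + fst z) * ((\<Sum>\<pi>\<in>?S. K \<pi> * B \<pi> (snd z)) / fact n)) \<in> borel_measurable ?N"
      using 1 2 by simp
  qed simp
  also have "\<dots> = (if c \<le> n then ennreal (pmf p (n - c)) * ((\<Sum>\<pi>\<in>?S. K \<pi> * q \<pi>) / fact n) else 0)"
  proof (cases "c \<le> n")
    case True
    have "(\<integral>\<^sup>+g. indicator {n} (c + m) * ((\<Sum>\<pi>\<in>?S. K \<pi> * B \<pi> g) / fact n) \<partial>?G) =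
        ((\<Sum>\<pi>\<in>?S. K \<pi> * q \<pi>) / fact n) * indicator {n - c} m" for m
    proof -
      have "(\<integral>\<^sup>+g. indicator {n} (c + m) * ((\<Sum>\<pi>\<in>?S. K \<pi> * B \<pi> g) / fact n) \<partial>?G) =
          indicator {n} (c + m) * ((\<Sum>\<pi>\<in>?S. K \<pi> * q \<pi>) / fact n)"
        by (subst nn_integral_cmult)
           (use Bm in \<open>simp_all add: nn_integral_divide nn_integral_sum nn_integral_cmult B[OF True]\<close>)
      also have "\<dots> = indicator {n - c} m * ((\<Sum>\<pi>\<in>?S. K \<pi> * q \<pi>) / fact n)"
        using True by (auto simp: indicator_def)
      finally show ?thesis by (simp add: mult.commute)
    qed
    then show ?thesis
      using True by (simp add: nn_integral_multc emeasure_pmf_single mult.commute[of _ "indicator _ _"])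
  next
    case False
    then show ?thesis by (simp add: indicator_def)
  qed
  finally show ?thesis unfolding K_def q_def .
qed

text \<open>
  The conditional law of the pruned left tree given the pruned common tree, in closed form.
\<close>

primrec tree_kernel :: "real \<Rightarrow> real \<Rightarrow> nat \<Rightarrow> ftree \<Rightarrow> ftree \<Rightarrow> real" where
  "tree_kernel lam s 0 x y = indicator {FNode []} y"
| "tree_kernel lam s (Suc d) x y =
     (let xs = fchildren x; ys = fchildren y; c = length xs; n = length ys in
      if c \<le> n then pmf (poisson (lam * (1 - s))) (n - c) *
        ((\<Sum>\<pi>|\<pi> permutes {..<n}. (\<Prod>i<c. tree_kernel lam s d (xs ! i) (ys ! \<pi> i)) *
            (\<Prod>i=c..<n. pmf (gw lam d) (ys ! \<pi> i))) / fact n)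
      else 0)"

lemma tree_kernel_nonneg: "0 \<le> tree_kernel lam s d x y"
  by (induction d arbitrary: x y)
     (auto simp: Let_def intro!: mult_nonneg_nonneg divide_nonneg_nonneg sum_nonneg prod_nonneg)

lemma ennreal_fact: "(fact n :: ennreal) = ennreal (fact n)"
  using ennreal_of_nat_eq_real_of_nat[of "fact n"] by simp

lemma ennreal_average:
  assumes "0 \<le> a" "\<And>x. x \<in> S \<Longrightarrow> 0 \<le> T x"
  shows "ennreal a * ((\<Sum>x\<in>S. ennreal (T x)) / fact n) = ennreal (a * ((\<Sum>x\<in>S. T x) / fact n))"
proof -
  have "(\<Sum>x\<in>S. ennreal (T x)) / fact n = ennreal ((\<Sum>x\<in>S. T x) / fact n)"
    using assms(2) by (simp add: ennreal_fact sum_ennreal divide_ennreal sum_nonneg)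
  with assms show ?thesis by (simp add: ennreal_mult sum_nonneg del: times_divide_eq_right)
qed

text \<open>Augmentation and relabelling act level by level, so the conditional law given the entire
  common tree depends only on its truncation. This is what makes \<open>tree_kernel\<close> a
  conditional law given the pruned common tree.\<close>

lemma noise_kernel_eq: "noise_kernel lam s d x y = ennreal (tree_kernel lam s d (trunc d x) y)"
proof (induction d arbitrary: x y)
  case 0
  then show ?case by (simp add: noise_kernel_0 indicator_def)
next
  case (Suc d)
  obtain ys where y: "y = FNode ys" by (cases y)
  let ?n = "length ys" and ?c = "length (children x)"
  let ?S = "{\<pi>. \<pi> permutes {..<?n}}"
  have term_eq: "(\<Prod>i<?c. noise_kernel lam s d (children x ! i) (ys ! \<pi> i)) * (\<Prod>i=?c..<?n. ennreal (pmf (gw lam d) (ys ! \<pi> i)))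
     = ennreal ((\<Prod>i<?c. tree_kernel lam s d (map (trunc d) (children x) ! i) (ys ! \<pi> i)) * (\<Prod>i=?c..<?n. pmf (gw lam d) (ys ! \<pi> i)))" for \<pi>
    by (simp add: Suc prod_ennreal tree_kernel_nonneg ennreal_mult prod_nonneg)
  show ?case
    unfolding y noise_kernel_Suc[OF refl refl] term_eq
    by (subst ennreal_average) (simp_all add: Let_def tree_kernel_nonneg prod_nonneg)
qed

lemma measurable_trunc_relabel_augment:
  "(\<lambda>(a, \<sigma>). trunc d (relabel \<sigma> (augment a t))) \<in> augment_noise lam s \<Otimes>\<^sub>M relabel_noise \<rightarrow>\<^sub>M count_space UNIV"
proof -
  have 1: "(\<lambda>z. (fst z, t)) \<in> augment_noise lam s \<Otimes>\<^sub>M relabel_noise \<rightarrow>\<^sub>M augment_noise lam s \<Otimes>\<^sub>M rtree_algebra"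
    by simp
  note 2 = measurable_Pair[OF measurable_snd measurable_compose[OF 1 measurable_augment]]
  from measurable_compose[OF measurable_compose[OF 2 measurable_relabel] measurable_trunc]
  show ?thesis by (simp add: case_prod_unfold)
qed

lemma nn_integral_count_space_indicator_singleton:
  "(\<integral>\<^sup>+v. F v * indicator {v} x \<partial>count_space UNIV) = F x"
proof -
  have "(\<integral>\<^sup>+v. F v * indicator {v} x \<partial>count_space UNIV) = (\<integral>\<^sup>+v. F x * indicator {x} v \<partial>count_space UNIV)"
    by (intro nn_integral_cong) (auto simp: indicator_def)
  then show ?thesis by (simp add: nn_integral_cmult_indicator)
qed

text \<open>Turns knowledge of the atoms of a law into a formula for all integrals.\<close>

lemma nn_integral_countable_valued:
  fixes X :: "'a \<Rightarrow> 'b::countable"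
  assumes X: "X \<in> M \<rightarrow>\<^sub>M count_space UNIV"
  shows "(\<integral>\<^sup>+\<omega>. F (X \<omega>) \<partial>M) = (\<integral>\<^sup>+v. F v * (\<integral>\<^sup>+\<omega>. indicator {v} (X \<omega>) \<partial>M) \<partial>count_space UNIV)"
proof -
  have ind: "(\<lambda>\<omega>. indicator {v} (X \<omega>) :: ennreal) \<in> borel_measurable M" for v
    by (rule measurable_compose[OF X]) simp
  have "(\<integral>\<^sup>+\<omega>. F (X \<omega>) \<partial>M) = (\<integral>\<^sup>+\<omega>. \<integral>\<^sup>+v. F v * indicator {v} (X \<omega>) \<partial>count_space UNIV \<partial>M)"
    by (simp add: nn_integral_count_space_indicator_singleton)
  also have "\<dots> = (\<integral>\<^sup>+v. \<integral>\<^sup>+\<omega>. F v * indicator {v} (X \<omega>) \<partial>M \<partial>count_space UNIV)"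
    by (rule nn_integral_count_space_nn_integral) (use ind in auto)
  also have "\<dots> = (\<integral>\<^sup>+v. F v * (\<integral>\<^sup>+\<omega>. indicator {v} (X \<omega>) \<partial>M) \<partial>count_space UNIV)"
    by (simp add: nn_integral_cmult ind)
  finally show ?thesis .
qed

lemma noise_kernel_pair:
  "noise_kernel lam s d t y = (\<integral>\<^sup>+z. indicator {y} (case z of (a, \<sigma>) \<Rightarrow> trunc d (relabel \<sigma> (augment a t)))
      \<partial>(augment_noise lam s \<Otimes>\<^sub>M relabel_noise))"
proof -
  interpret R: prob_space relabel_noise by (rule prob_space_relabel_noise)
  show ?thesis
    unfolding noise_kernel_def relabel_law_def
    by (subst R.nn_integral_fst[symmetric])
       (auto intro: measurable_compose[OF measurable_trunc_relabel_augment])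
qed

lemma nn_integral_noise_kernel: "(\<integral>\<^sup>+y. noise_kernel lam s d t y \<partial>count_space UNIV) = 1"
proof -
  interpret A: prob_space "augment_noise lam s" by (rule prob_space_augment_noise)
  interpret R: prob_space relabel_noise by (rule prob_space_relabel_noise)
  interpret AR: pair_prob_space "augment_noise lam s" relabel_noise ..
  show ?thesis
    unfolding noise_kernel_pair
    using nn_integral_countable_valued[OF measurable_trunc_relabel_augment[of d t lam s], of "\<lambda>_. 1"]
    by (simp add: AR.emeasure_space_1)
qed

text \<open>The total mass of the kernel is known at points of the form \<open>trunc d t\<close>. An
  \<open>ftree\<close> of positive \<open>gw\<close> mass has this form, because its event under
  \<open>GW \<mu>\<close> cannot be empty.\<close>

lemma set_pmf_gw_imp_trunc: "x \<in> set_pmf (gw \<mu> d) \<Longrightarrow> \<exists>t. trunc d t = x"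
proof (rule ccontr)
  assume x: "x \<in> set_pmf (gw \<mu> d)" and "\<nexists>t. trunc d t = x"
  then have "(\<integral>\<^sup>+t. indicator {x} (trunc d t) \<partial>GW \<mu>) = 0" by (simp add: indicator_def)
  with x show False
    by (simp add: GW_trunc_law set_pmf_iff ennreal_eq_0_iff order_antisym_conv)
qed

lemma nn_integral_tree_kernel:
  "x \<in> set_pmf (gw \<mu> d) \<Longrightarrow> (\<integral>\<^sup>+y. ennreal (tree_kernel lam s d x y) \<partial>count_space UNIV) = 1"
  using set_pmf_gw_imp_trunc[of x \<mu> d] nn_integral_noise_kernel[of lam s d] by (auto simp: noise_kernel_eq)

text \<open>Each observed tree has its own pair of noises, (a, r) or (b, s), but
  \<open>outcome\<close> stores the pairs interleaved. Iterated Fubini regroups them.\<close>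

lemma nn_integral_pair_product:
  fixes g h :: "_ \<Rightarrow> ennreal"
  assumes prob: "prob_space A" "prob_space B" "prob_space R" "prob_space S"
    and g: "g \<in> borel_measurable (A \<Otimes>\<^sub>M R)" and h: "h \<in> borel_measurable (B \<Otimes>\<^sub>M S)"
  shows "(\<integral>\<^sup>+(a, b, r, s). g (a, r) * h (b, s) \<partial>(A \<Otimes>\<^sub>M B \<Otimes>\<^sub>M R \<Otimes>\<^sub>M S)) =
     (\<integral>\<^sup>+z. g z \<partial>(A \<Otimes>\<^sub>M R)) * (\<integral>\<^sup>+z. h z \<partial>(B \<Otimes>\<^sub>M S))"
proof -
  interpret A: prob_space A by fact
  interpret B: prob_space B by fact
  interpret R: prob_space R by fact
  interpret S: prob_space S by fact
  interpret RS: pair_sigma_finite R S ..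
  interpret BRS: pair_sigma_finite B "R \<Otimes>\<^sub>M S" ..
  note [measurable] = g h
  have m1: "(\<lambda>r. g (a, r)) \<in> borel_measurable R" if "a \<in> space A" for a
    using that by measurable
  have m2: "(\<lambda>s. h (b, s)) \<in> borel_measurable S" if "b \<in> space B" for b
    using that by measurable
  have "(\<integral>\<^sup>+(a, b, r, s). g (a, r) * h (b, s) \<partial>(A \<Otimes>\<^sub>M B \<Otimes>\<^sub>M R \<Otimes>\<^sub>M S)) =
      (\<integral>\<^sup>+a. \<integral>\<^sup>+(b, r, s). g (a, r) * h (b, s) \<partial>(B \<Otimes>\<^sub>M R \<Otimes>\<^sub>M S) \<partial>A)"
    by (subst BRS.nn_integral_fst[symmetric]) (simp_all add: case_prod_unfold)
  also have "\<dots> = (\<integral>\<^sup>+a. \<integral>\<^sup>+b. \<integral>\<^sup>+(r, s). g (a, r) * h (b, s) \<partial>(R \<Otimes>\<^sub>M S) \<partial>B \<partial>A)"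
    by (intro nn_integral_cong, subst RS.nn_integral_fst[symmetric]) (simp_all add: case_prod_unfold)
  also have "\<dots> = (\<integral>\<^sup>+a. \<integral>\<^sup>+b. \<integral>\<^sup>+r. \<integral>\<^sup>+s. g (a, r) * h (b, s) \<partial>S \<partial>R \<partial>B \<partial>A)"
    by (intro nn_integral_cong, subst S.nn_integral_fst[symmetric]) (simp_all add: case_prod_unfold)
  also have "\<dots> = (\<integral>\<^sup>+a. \<integral>\<^sup>+b. (\<integral>\<^sup>+r. g (a, r) \<partial>R) * (\<integral>\<^sup>+s. h (b, s) \<partial>S) \<partial>B \<partial>A)"
    by (intro nn_integral_cong) (simp add: nn_integral_cmult nn_integral_multc m1 m2)
  also have "\<dots> = (\<integral>\<^sup>+a. \<integral>\<^sup>+r. g (a, r) \<partial>R \<partial>A) * (\<integral>\<^sup>+b. \<integral>\<^sup>+s. h (b, s) \<partial>S \<partial>B)"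
    by (simp add: nn_integral_cmult nn_integral_multc)
  finally show ?thesis
    by (simp add: R.nn_integral_fst S.nn_integral_fst)
qed

section \<open>The correlated model at finite depth\<close>

definition outcome_trunc :: "nat \<Rightarrow> outcome \<Rightarrow> ftree \<times> ftree \<times> ftree" where
  "outcome_trunc d \<omega> = (trunc d (common_tree \<omega>), trunc d (left_tree \<omega>), trunc d (right_tree \<omega>))"

lemma prob_space_P1: "prob_space (P1 lam s)"
  unfolding P1_def
  by (intro prob_space_pair prob_space_GW prob_space_augment_noise prob_space_relabel_noise)

lemma measurable_left_tree: "left_tree \<in> P1 lam s \<rightarrow>\<^sub>M rtree_algebra"
proof -
  have a: "(\<lambda>\<omega>. (fst (snd \<omega>), fst \<omega>)) \<in> P1 lam s \<rightarrow>\<^sub>M augment_noise lam s \<Otimes>\<^sub>M rtree_algebra"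
    and r: "(\<lambda>\<omega>. fst (snd (snd (snd \<omega>)))) \<in> P1 lam s \<rightarrow>\<^sub>M relabel_noise"
    unfolding P1_def by measurable
  from measurable_compose[OF measurable_Pair[OF r measurable_compose[OF a measurable_augment]] measurable_relabel]
  show ?thesis by (simp add: left_tree_def case_prod_unfold)
qed

lemma measurable_right_tree: "right_tree \<in> P1 lam s \<rightarrow>\<^sub>M rtree_algebra"
proof -
  have a: "(\<lambda>\<omega>. (fst (snd (snd \<omega>)), fst \<omega>)) \<in> P1 lam s \<rightarrow>\<^sub>M augment_noise lam s \<Otimes>\<^sub>M rtree_algebra"
    and r: "(\<lambda>\<omega>. snd (snd (snd (snd \<omega>)))) \<in> P1 lam s \<rightarrow>\<^sub>M relabel_noise"
    unfolding P1_def by measurable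
  from measurable_compose[OF measurable_Pair[OF r measurable_compose[OF a measurable_augment]] measurable_relabel]
  show ?thesis by (simp add: right_tree_def case_prod_unfold)
qed

lemma measurable_common_tree: "common_tree \<in> P1 lam s \<rightarrow>\<^sub>M rtree_algebra"
proof -
  have "fst \<in> P1 lam s \<rightarrow>\<^sub>M rtree_algebra"
    unfolding P1_def by measurable
  then show ?thesis by (simp add: common_tree_def case_prod_unfold)
qed

lemma measurable_outcome_trunc: "outcome_trunc d \<in> P1 lam s \<rightarrow>\<^sub>M count_space UNIV"
proof -
  have "outcome_trunc d \<in> P1 lam s \<rightarrow>\<^sub>M count_space UNIV \<Otimes>\<^sub>M count_space UNIV \<Otimes>\<^sub>M count_space UNIV"
    unfolding outcome_trunc_def
    by (intro measurable_Pair measurable_compose[OF measurable_common_tree measurable_trunc]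
          measurable_compose[OF measurable_left_tree measurable_trunc]
          measurable_compose[OF measurable_right_tree measurable_trunc])
  then show ?thesis by (simp add: pair_measure_countable)
qed

text \<open>Given the common tree, the two observed trees are built from independent noises of the
  same law, so the same kernel occurs once for each of them.\<close>

lemma P1_atom:
  "(\<integral>\<^sup>+\<omega>. indicator {(x, y, z)} (outcome_trunc d \<omega>) \<partial>P1 lam s) =
     ennreal (pmf (gw (lam * s) d) x) * ennreal (tree_kernel lam s d x y) * ennreal (tree_kernel lam s d x z)"
proof -
  let ?A = "augment_noise lam s" and ?R = relabel_noise
  let ?N = "?A \<Otimes>\<^sub>M ?A \<Otimes>\<^sub>M ?R \<Otimes>\<^sub>M ?R"
  interpret N: prob_space ?N
    by (intro prob_space_pair prob_space_augment_noise prob_space_relabel_noise)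
  define g where "g t y z = (indicator {y} (case z of (a, \<sigma>) \<Rightarrow> trunc d (relabel \<sigma> (augment a t))) :: ennreal)" for t y z
  have g: "g t y \<in> borel_measurable (?A \<Otimes>\<^sub>M ?R)" for t y
    unfolding g_def by (rule measurable_compose[OF measurable_trunc_relabel_augment]) simp
  have "(\<lambda>\<omega>. indicator {(x, y, z)} (outcome_trunc d \<omega>) :: ennreal) \<in> borel_measurable (P1 lam s)"
    by (rule measurable_compose[OF measurable_outcome_trunc]) simp
  then have "(\<integral>\<^sup>+\<omega>. indicator {(x, y, z)} (outcome_trunc d \<omega>) \<partial>P1 lam s) =
      (\<integral>\<^sup>+t. \<integral>\<^sup>+n. indicator {(x, y, z)} (outcome_trunc d (t, n)) \<partial>?N \<partial>GW (lam * s))"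
    unfolding P1_def by (subst N.nn_integral_fst[symmetric]) simp_all
  also have "\<dots> = (\<integral>\<^sup>+t. indicator {x} (trunc d t) * (ennreal (tree_kernel lam s d x y) * ennreal (tree_kernel lam s d x z)) \<partial>GW (lam * s))"
  proof (rule nn_integral_cong)
    fix t
    have "(\<integral>\<^sup>+n. indicator {(x, y, z)} (outcome_trunc d (t, n)) \<partial>?N) =
        (\<integral>\<^sup>+n. indicator {x} (trunc d t) * (case n of (a, b, r, s) \<Rightarrow> g t y (a, r) * g t z (b, s)) \<partial>?N)"
      by (intro nn_integral_cong)
         (auto simp: outcome_trunc_def common_tree_def left_tree_def right_tree_def g_def indicator_def)
    also have "\<dots> = indicator {x} (trunc d t) * (\<integral>\<^sup>+n. (case n of (a, b, r, s) \<Rightarrow> g t y (a, r) * g t z (b, s)) \<partial>?N)"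
    proof (rule nn_integral_cmult)
      have p1: "(\<lambda>n. (fst n, fst (snd (snd n)))) \<in> ?N \<rightarrow>\<^sub>M ?A \<Otimes>\<^sub>M ?R" by measurable
      have p2: "(\<lambda>n. (fst (snd n), snd (snd (snd n)))) \<in> ?N \<rightarrow>\<^sub>M ?A \<Otimes>\<^sub>M ?R" by measurable
      show "(\<lambda>n. case n of (a, b, r, s) \<Rightarrow> g t y (a, r) * g t z (b, s)) \<in> borel_measurable ?N"
        unfolding case_prod_unfold
        by (intro borel_measurable_times_ennreal measurable_compose[OF p1 g] measurable_compose[OF p2 g])
    qed
    also have "(\<integral>\<^sup>+n. (case n of (a, b, r, s) \<Rightarrow> g t y (a, r) * g t z (b, s)) \<partial>?N) = noise_kernel lam s d t y * noise_kernel lam s d t z"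
      unfolding noise_kernel_pair g_def[symmetric]
      by (rule nn_integral_pair_product) (intro prob_space_augment_noise prob_space_relabel_noise g)+
    finally show "(\<integral>\<^sup>+n. indicator {(x, y, z)} (outcome_trunc d (t, n)) \<partial>?N) =
       indicator {x} (trunc d t) * (ennreal (tree_kernel lam s d x y) * ennreal (tree_kernel lam s d x z))"
      by (auto simp: noise_kernel_eq indicator_def)
  qed
  also have "\<dots> = ennreal (pmf (gw (lam * s) d) x) * (ennreal (tree_kernel lam s d x y) * ennreal (tree_kernel lam s d x z))"
    by (subst nn_integral_multc)
       (simp_all add: GW_trunc_law measurable_compose[OF measurable_trunc])
  finally show ?thesis by (simp add: mult.assoc)
qed

lemma P1_law:
  "(\<integral>\<^sup>+\<omega>. F (outcome_trunc d \<omega>) \<partial>P1 lam s) =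
    (\<integral>\<^sup>+x. \<integral>\<^sup>+y. \<integral>\<^sup>+z. ennreal (tree_kernel lam s d x y) * ennreal (tree_kernel lam s d x z) * F (x, y, z)
       \<partial>count_space UNIV \<partial>count_space UNIV \<partial>gw (lam * s) d)"
proof -
  let ?I = "\<lambda>v. \<integral>\<^sup>+\<omega>. indicator {v} (outcome_trunc d \<omega>) \<partial>P1 lam s"
  have "(\<integral>\<^sup>+\<omega>. F (outcome_trunc d \<omega>) \<partial>P1 lam s) = (\<integral>\<^sup>+v. F v * ?I v \<partial>count_space UNIV)"
    by (rule nn_integral_countable_valued[OF measurable_outcome_trunc])
  also have "\<dots> = (\<integral>\<^sup>+x. \<integral>\<^sup>+w. F (x, w) * ?I (x, w) \<partial>count_space UNIV \<partial>count_space UNIV)"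
    by (rule nn_integral_fst_count_space[symmetric])
  also have "\<dots> = (\<integral>\<^sup>+x. \<integral>\<^sup>+y. \<integral>\<^sup>+z. F (x, y, z) * ?I (x, y, z) \<partial>count_space UNIV \<partial>count_space UNIV \<partial>count_space UNIV)"
    by (intro nn_integral_cong, rule nn_integral_fst_count_space[symmetric])
  also have "\<dots> = (\<integral>\<^sup>+x. \<integral>\<^sup>+y. \<integral>\<^sup>+z. ennreal (pmf (gw (lam * s) d) x) *
      (ennreal (tree_kernel lam s d x y) * ennreal (tree_kernel lam s d x z) * F (x, y, z))
      \<partial>count_space UNIV \<partial>count_space UNIV \<partial>count_space UNIV)"
    by (simp only: P1_atom ac_simps)
  finally show ?thesis
    by (simp add: nn_integral_measure_pmf nn_integral_cmult)
qed

section \<open>Children as product measures, and the marginal law of an observed tree\<close>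

lemma measurable_map_PiM:
  fixes p :: "'a::countable pmf"
  shows "(\<lambda>f. map f [0..<n]) \<in> (\<Pi>\<^sub>M i\<in>{..<n}. measure_pmf p) \<rightarrow>\<^sub>M count_space UNIV"
proof -
  let ?P = "\<Pi>\<^sub>M i\<in>{..<n}. measure_pmf p"
  \<comment> \<open>\<open>measurable_map_upt\<close> asks for measurability at every index, whereas
    only the coordinates below \<open>n\<close> belong to the product; the others are replaced by a
    constant.\<close>
  have "(\<lambda>f. map (\<lambda>i. if i < n then f i else undefined) [0..<n]) \<in> ?P \<rightarrow>\<^sub>M count_space UNIV"
  proof (rule measurable_map_upt)
    fix i
    show "(\<lambda>f. if i < n then f i else undefined) \<in> ?P \<rightarrow>\<^sub>M count_space UNIV"
      using measurable_component_singleton[of i "{..<n}" "\<lambda>_. measure_pmf p"] by (cases "i < n") auto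
  qed simp
  also have "(\<lambda>f. map (\<lambda>i. if i < n then f i else undefined) [0..<n]) = (\<lambda>f. map f [0..<n])"
    by (auto simp: fun_eq_iff)
  finally show ?thesis .
qed

text \<open>Trades the recursive law on lists for a product measure, so that single children can be
  integrated out by Fubini.\<close>

lemma measure_replicate_pmf:
  fixes p :: "'a::countable pmf"
  shows "measure_pmf (replicate_pmf n p) =
    distr (\<Pi>\<^sub>M i\<in>{..<n}. measure_pmf p) (count_space UNIV) (\<lambda>f. map f [0..<n])"
proof -
  interpret product_prob_space "\<lambda>_::nat. measure_pmf p" "{..<n}"
    by unfold_locales
  let ?P = "\<Pi>\<^sub>M i\<in>{..<n}. measure_pmf p"
  show ?thesis
  proof (rule measure_eqI_countable[where A = UNIV])
    fix ys :: "'a list"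
    show "emeasure (measure_pmf (replicate_pmf n p)) {ys} =
        emeasure (distr ?P (count_space UNIV) (\<lambda>f. map f [0..<n])) {ys}"
    proof (cases "length ys = n")
      case True
      have eq: "(\<lambda>f. map f [0..<n]) -` {ys} \<inter> space ?P = (\<Pi>\<^sub>E i\<in>{..<n}. {ys ! i})"
      proof (rule set_eqI)
        fix f
        have "map f [0..<n] = ys \<longleftrightarrow> (\<forall>i<n. f i = ys ! i)"
          using True by (auto simp: list_eq_iff_nth_eq)
        then show "f \<in> (\<lambda>f. map f [0..<n]) -` {ys} \<inter> space ?P \<longleftrightarrow> f \<in> (\<Pi>\<^sub>E i\<in>{..<n}. {ys ! i})"
          by (simp add: space_PiM PiE_iff) blast
      qed
      have "emeasure (distr ?P (count_space UNIV) (\<lambda>f. map f [0..<n])) {ys} = emeasure ?P (\<Pi>\<^sub>E i\<in>{..<n}. {ys ! i})"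
        unfolding eq[symmetric] by (rule emeasure_distr[OF measurable_map_PiM]) simp
      also have "\<dots> = (\<Prod>i<n. emeasure (measure_pmf p) {ys ! i})"
        by (rule emeasure_PiM) auto
      also have "\<dots> = (\<Prod>i<n. ennreal (pmf p (ys ! i)))"
        by (simp only: emeasure_pmf_single)
      finally have "emeasure (distr ?P (count_space UNIV) (\<lambda>f. map f [0..<n])) {ys} = (\<Prod>i<n. ennreal (pmf p (ys ! i)))" .
      with True show ?thesis
        by (simp add: emeasure_pmf_single pmf_replicate_pmf prod_ennreal)
    next
      case False
      then have "(\<lambda>f. map f [0..<n]) -` {ys} \<inter> space ?P = {}" by auto
      with False show ?thesis
        by (subst emeasure_distr[OF measurable_map_PiM]) (simp_all add: emeasure_pmf_single pmf_replicate_pmf)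
    qed
  qed auto
qed

lemma nn_integral_gw_Suc:
  "(\<integral>\<^sup>+x. F x \<partial>gw \<mu> (Suc d)) =
     (\<integral>\<^sup>+n. \<integral>\<^sup>+f. F (FNode (map f [0..<n])) \<partial>(\<Pi>\<^sub>M i\<in>{..<n}. measure_pmf (gw \<mu> d)) \<partial>poisson \<mu>)"
proof -
  have "(\<integral>\<^sup>+ys. F (FNode ys) \<partial>replicate_pmf n (gw \<mu> d)) =
     (\<integral>\<^sup>+f. F (FNode (map f [0..<n])) \<partial>(\<Pi>\<^sub>M i\<in>{..<n}. measure_pmf (gw \<mu> d)))" for n
    unfolding measure_replicate_pmf by (rule nn_integral_distr[OF measurable_map_PiM]) simp
  then show ?thesis by simp
qed

lemma poisson_convolution:
  assumes "0 \<le> a" "0 \<le> b"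
  shows "(\<Sum>c\<le>n. pmf (poisson b) (n - c) * pmf (poisson a) c) = pmf (poisson (a + b)) n"
proof -
  have "(\<Sum>c\<le>n. pmf (poisson b) (n - c) * pmf (poisson a) c) =
      (\<Sum>c\<le>n. of_nat (n choose c) * a ^ c * b ^ (n - c)) / fact n * exp (- (a + b))"
    unfolding sum_divide_distrib sum_distrib_right
  proof (rule sum.cong[OF refl])
    fix c assume "c \<in> {..n}"
    then have "real (n choose c) = fact n / (fact c * fact (n - c))"
      by (simp add: binomial_fact)
    moreover have "exp (- (a + b)) = exp (- a) * exp (- b)"
      by (simp add: exp_add[symmetric])
    ultimately show "pmf (poisson b) (n - c) * pmf (poisson a) c =
       real (n choose c) * a ^ c * b ^ (n - c) / fact n * exp (- (a + b))"
      using assms by (simp only: pmf_poisson_eq) (simp add: ac_simps)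
  qed
  then show ?thesis
    using assms by (simp add: pmf_poisson_eq binomial_ring[symmetric])
qed

text \<open>Augmenting and relabelling a tree of rate \<open>lam * s\<close> gives one of rate
  \<open>lam\<close>. Once the \<open>c\<close> old children are integrated out by the induction
  hypothesis, every permutation yields the same product \<open>q\<close>, and the root degrees
  combine by superposition of Poisson variables. After division by the pmf this becomes the centring
  in the common tree.\<close>

lemma tree_kernel_marginal:
  assumes s: "0 \<le> s" "s \<le> 1" and lam: "0 \<le> lam"
  shows "(\<integral>\<^sup>+x. ennreal (tree_kernel lam s d x y) \<partial>gw (lam * s) d) = ennreal (pmf (gw lam d) y)"
proof (induction d arbitrary: y)
  case 0
  then show ?case by (auto simp: pmf_return indicator_def)
next
  case (Suc d)
  obtain ys where y: "y = FNode ys" by (cases y)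
  define n where "n = length ys"
  let ?S = "{\<pi>. \<pi> permutes {..<n}}"
  let ?p = "measure_pmf (gw (lam * s) d)"
  define q where "q = (\<Prod>i<n. pmf (gw lam d) (ys ! i))"
  define r where "r m = pmf (poisson (lam * (1 - s))) m" for m
  have q: "0 \<le> q" by (simp add: q_def prod_nonneg)
  have inner: "(\<integral>\<^sup>+f. ennreal (tree_kernel lam s (Suc d) (FNode (map f [0..<c])) y) \<partial>(\<Pi>\<^sub>M i\<in>{..<c}. ?p)) =
      (if c \<le> n then ennreal (r (n - c) * q) else 0)" for c
  proof (cases "c \<le> n")
    case False
    then show ?thesis by (simp add: y n_def)
  next
    case True
    interpret P: product_prob_space "\<lambda>_::nat. ?p" "{..<c}"
      by unfold_locales
    let ?T = "\<lambda>\<pi> f. (\<Prod>i<c. ennreal (tree_kernel lam s d (f i) (ys ! \<pi> i))) * (\<Prod>i=c..<n. ennreal (pmf (gw lam d) (ys ! \<pi> i)))"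
    have meas: "(\<lambda>f. \<Prod>i<c. ennreal (tree_kernel lam s d (f i) (ys ! \<pi> i))) \<in> borel_measurable (\<Pi>\<^sub>M i\<in>{..<c}. ?p)" for \<pi>
    proof (rule borel_measurable_prod_ennreal)
      fix i assume "i \<in> {..<c}"
      from measurable_compose[OF measurable_component_singleton[OF this, of "\<lambda>_. ?p"], of "\<lambda>x. ennreal (tree_kernel lam s d x (ys ! \<pi> i))" borel]
      show "(\<lambda>f. ennreal (tree_kernel lam s d (f i) (ys ! \<pi> i))) \<in> borel_measurable (\<Pi>\<^sub>M i\<in>{..<c}. ?p)" by simp
    qed
    have T: "(\<integral>\<^sup>+f. ?T \<pi> f \<partial>(\<Pi>\<^sub>M i\<in>{..<c}. ?p)) = ennreal q" if "\<pi> \<in> ?S" for \<pi>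
    proof -
      have "(\<integral>\<^sup>+f. ?T \<pi> f \<partial>(\<Pi>\<^sub>M i\<in>{..<c}. ?p)) =
          (\<Prod>i<c. ennreal (pmf (gw lam d) (ys ! \<pi> i))) * (\<Prod>i=c..<n. ennreal (pmf (gw lam d) (ys ! \<pi> i)))"
      proof -
        have "(\<integral>\<^sup>+f. (\<Prod>i<c. ennreal (tree_kernel lam s d (f i) (ys ! \<pi> i))) \<partial>(\<Pi>\<^sub>M i\<in>{..<c}. ?p)) =
            (\<Prod>i<c. \<integral>\<^sup>+x. ennreal (tree_kernel lam s d x (ys ! \<pi> i)) \<partial>?p)"
          by (rule P.product_nn_integral_prod) simp_all
        then show ?thesis using meas by (simp add: nn_integral_multc Suc)
      qed
      also have "\<dots> = (\<Prod>i\<in>{..<c} \<union> {c..<n}. ennreal (pmf (gw lam d) (ys ! \<pi> i)))"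
        by (rule prod.union_disjoint[symmetric]) auto
      also have "{..<c} \<union> {c..<n} = {..<n}" using True by auto
      also have "(\<Prod>i<n. ennreal (pmf (gw lam d) (ys ! \<pi> i))) = ennreal q"
        using prod.permute[of \<pi> "{..<n}" "\<lambda>i. ennreal (pmf (gw lam d) (ys ! i))"] that
        by (simp add: comp_def q_def prod_ennreal)
      finally show ?thesis .
    qed
    have "ennreal (tree_kernel lam s (Suc d) (FNode (map f [0..<c])) y) = ennreal (r (n - c)) * ((\<Sum>\<pi>\<in>?S. ?T \<pi> f) / fact n)" for f
    proof -
      have "?T \<pi> f = ennreal ((\<Prod>i<c. tree_kernel lam s d (f i) (ys ! \<pi> i)) * (\<Prod>i=c..<n. pmf (gw lam d) (ys ! \<pi> i)))" for \<pi>
        by (simp add: prod_ennreal tree_kernel_nonneg ennreal_mult prod_nonneg)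
      then have "ennreal (r (n - c)) * ((\<Sum>\<pi>\<in>?S. ?T \<pi> f) / fact n) = ennreal (r (n - c) *
         ((\<Sum>\<pi>\<in>?S. (\<Prod>i<c. tree_kernel lam s d (f i) (ys ! \<pi> i)) * (\<Prod>i=c..<n. pmf (gw lam d) (ys ! \<pi> i))) / fact n))"
        by (simp only:) (rule ennreal_average, auto simp: r_def intro!: mult_nonneg_nonneg prod_nonneg tree_kernel_nonneg)
      then show ?thesis using True by (simp add: y n_def r_def Let_def)
    qed
    then have "(\<integral>\<^sup>+f. ennreal (tree_kernel lam s (Suc d) (FNode (map f [0..<c])) y) \<partial>(\<Pi>\<^sub>M i\<in>{..<c}. ?p)) =
        ennreal (r (n - c)) * ((\<Sum>\<pi>\<in>?S. ennreal q) / fact n)"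
      using meas by (simp add: nn_integral_cmult nn_integral_divide nn_integral_sum T del: sum_constant)
    also have "\<dots> = ennreal (r (n - c) * q)"
      using q by (subst ennreal_average) (auto simp: r_def card_permutations)
    finally show ?thesis using True by simp
  qed
  have "(\<integral>\<^sup>+x. ennreal (tree_kernel lam s (Suc d) x y) \<partial>gw (lam * s) (Suc d)) =
      (\<integral>\<^sup>+c. (if c \<le> n then ennreal (r (n - c) * q) else 0) \<partial>poisson (lam * s))"
    unfolding nn_integral_gw_Suc inner ..
  also have "\<dots> = (\<Sum>c\<le>n. (if c \<le> n then ennreal (r (n - c) * q) else 0) * ennreal (pmf (poisson (lam * s)) c))"
    by (rule nn_integral_measure_pmf_support) auto
  also have "\<dots> = (\<Sum>c\<le>n. ennreal (r (n - c) * pmf (poisson (lam * s)) c * q))"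
    using q by (intro sum.cong) (auto simp: r_def ennreal_mult[symmetric] ac_simps)
  also have "\<dots> = ennreal ((\<Sum>c\<le>n. r (n - c) * pmf (poisson (lam * s)) c) * q)"
    using q by (subst sum_ennreal) (auto simp: r_def sum_distrib_right)
  also have "(\<Sum>c\<le>n. r (n - c) * pmf (poisson (lam * s)) c) = pmf (poisson lam) n"
    unfolding r_def using assms by (subst poisson_convolution) (auto simp: algebra_simps mult_left_le)
  also have "pmf (poisson lam) n * q = pmf (gw lam (Suc d)) y"
    unfolding y pmf_gw_Suc q_def n_def ..
  finally show ?case .
qed

text \<open>A vanishing integral of a nonnegative function forces the function to vanish on the
  support. So the likelihood ratio loses no mass at the points where its denominator is 0.\<close>

lemma tree_kernel_eq_0:
  assumes s: "0 \<le> s" "s \<le> 1" "0 \<le> lam"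
    and x: "x \<in> set_pmf (gw (lam * s) d)" and y: "pmf (gw lam d) y = 0"
  shows "tree_kernel lam s d x y = 0"
proof -
  have "(\<integral>\<^sup>+x. ennreal (tree_kernel lam s d x y) \<partial>gw (lam * s) d) = 0"
    using tree_kernel_marginal[OF s] y by simp
  then have "AE x in gw (lam * s) d. ennreal (tree_kernel lam s d x y) = 0"
    by (subst (asm) nn_integral_0_iff_AE) auto
  then show ?thesis
    using x tree_kernel_nonneg[of lam s d x y] by (auto simp: AE_measure_pmf_iff ennreal_eq_0_iff)
qed

section \<open>Joint laws of the pruned trees and the formula for \<open>Vd\<close>\<close>

lemma P1_event:
  "ennreal (measure (P1 lam s) {\<omega> \<in> space (P1 lam s). A (outcome_trunc d \<omega>)}) =
    (\<integral>\<^sup>+x. \<integral>\<^sup>+y. \<integral>\<^sup>+z. ennreal (tree_kernel lam s d x y) * ennreal (tree_kernel lam s d x z) * indicator {v. A v} (x, y, z)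
       \<partial>count_space UNIV \<partial>count_space UNIV \<partial>gw (lam * s) d)"
proof -
  interpret prob_space "P1 lam s" by (rule prob_space_P1)
  have m: "{\<omega> \<in> space (P1 lam s). A (outcome_trunc d \<omega>)} \<in> sets (P1 lam s)"
    using measurable_sets[OF measurable_outcome_trunc, of "{v. A v}" d lam s]
    by (simp add: vimage_def Int_def conj_commute)
  have "ennreal (measure (P1 lam s) {\<omega> \<in> space (P1 lam s). A (outcome_trunc d \<omega>)}) =
      (\<integral>\<^sup>+\<omega>. indicator {\<omega> \<in> space (P1 lam s). A (outcome_trunc d \<omega>)} \<omega> \<partial>P1 lam s)"
    using m by (simp add: emeasure_eq_measure)
  also have "\<dots> = (\<integral>\<^sup>+\<omega>. indicator {v. A v} (outcome_trunc d \<omega>) \<partial>P1 lam s)"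
    by (intro nn_integral_cong) (auto simp: indicator_def)
  finally show ?thesis unfolding P1_law .
qed

lemma P1_common_left:
  "measure (P1 lam s) {\<omega> \<in> space (P1 lam s). trunc d (common_tree \<omega>) = x \<and> trunc d (left_tree \<omega>) = y} =
     pmf (gw (lam * s) d) x * tree_kernel lam s d x y"
proof -
  let ?p = "measure_pmf (gw (lam * s) d)"
  have "ennreal (measure (P1 lam s) {\<omega> \<in> space (P1 lam s). trunc d (common_tree \<omega>) = x \<and> trunc d (left_tree \<omega>) = y}) =
    (\<integral>\<^sup>+x'. \<integral>\<^sup>+y'. \<integral>\<^sup>+z. ennreal (tree_kernel lam s d x' y') * ennreal (tree_kernel lam s d x' z) * (indicator {x} x' * indicator {y} y')
       \<partial>count_space UNIV \<partial>count_space UNIV \<partial>?p)"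
    using P1_event[of lam s "\<lambda>(a, b, c). a = x \<and> b = y" d]
    by (simp add: outcome_trunc_def indicator_def of_bool_conj)
  also have "\<dots> = (\<integral>\<^sup>+x'. ennreal (tree_kernel lam s d x y) * indicator {x} x' \<partial>?p)"
  proof (rule nn_integral_cong_AE, unfold AE_measure_pmf_iff, rule ballI)
    fix x' assume x': "x' \<in> set_pmf (gw (lam * s) d)"
    have "(\<integral>\<^sup>+y'. \<integral>\<^sup>+z. ennreal (tree_kernel lam s d x' y') * ennreal (tree_kernel lam s d x' z) * (indicator {x} x' * indicator {y} y')
       \<partial>count_space UNIV \<partial>count_space UNIV) =
       (\<integral>\<^sup>+y'. \<integral>\<^sup>+z. (ennreal (tree_kernel lam s d x' y') * indicator {x} x' * indicator {y} y') * ennreal (tree_kernel lam s d x' z)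
       \<partial>count_space UNIV \<partial>count_space UNIV)"
      by (simp only: ac_simps)
    also have "\<dots> = (\<integral>\<^sup>+y'. ennreal (tree_kernel lam s d x' y') * indicator {x} x' * indicator {y} y' \<partial>count_space UNIV)"
      by (simp add: nn_integral_cmult nn_integral_tree_kernel[OF x'])
    also have "\<dots> = (\<integral>\<^sup>+y'. (ennreal (tree_kernel lam s d x' y') * indicator {x} x') * indicator {y'} y \<partial>count_space UNIV)"
      by (intro nn_integral_cong) (auto simp: indicator_def)
    also have "\<dots> = ennreal (tree_kernel lam s d x' y) * indicator {x} x'"
      by (rule nn_integral_count_space_indicator_singleton)
    finally show "(\<integral>\<^sup>+y'. \<integral>\<^sup>+z. ennreal (tree_kernel lam s d x' y') * ennreal (tree_kernel lam s d x' z) * (indicator {x} x' * indicator {y} y')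
       \<partial>count_space UNIV \<partial>count_space UNIV) = ennreal (tree_kernel lam s d x y) * indicator {x} x'"
      by (simp add: indicator_def)
  qed
  also have "\<dots> = ennreal (pmf (gw (lam * s) d) x * tree_kernel lam s d x y)"
    by (subst nn_integral_cmult_indicator)
       (simp_all add: emeasure_pmf_single ennreal_mult tree_kernel_nonneg mult.commute)
  finally show ?thesis by (simp add: tree_kernel_nonneg)
qed

lemma P1_common:
  "measure (P1 lam s) {\<omega> \<in> space (P1 lam s). trunc d (common_tree \<omega>) = x} = pmf (gw (lam * s) d) x"
proof -
  let ?p = "measure_pmf (gw (lam * s) d)"
  have "ennreal (measure (P1 lam s) {\<omega> \<in> space (P1 lam s). trunc d (common_tree \<omega>) = x}) =
    (\<integral>\<^sup>+x'. \<integral>\<^sup>+y. \<integral>\<^sup>+z. ennreal (tree_kernel lam s d x' y) * ennreal (tree_kernel lam s d x' z) * indicator {x} x'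
       \<partial>count_space UNIV \<partial>count_space UNIV \<partial>?p)"
    using P1_event[of lam s "\<lambda>(a, b, c). a = x" d] by (simp add: outcome_trunc_def indicator_def)
  also have "\<dots> = (\<integral>\<^sup>+x'. indicator {x} x' \<partial>?p)"
    by (rule nn_integral_cong_AE, unfold AE_measure_pmf_iff, rule ballI)
       (simp add: nn_integral_cmult nn_integral_multc nn_integral_tree_kernel)
  also have "\<dots> = ennreal (pmf (gw (lam * s) d) x)"
    by (simp add: emeasure_pmf_single)
  finally show ?thesis by simp
qed

lemma P1_left:
  assumes "0 \<le> s" "s \<le> 1" "0 \<le> lam"
  shows "measure (P1 lam s) {\<omega> \<in> space (P1 lam s). trunc d (left_tree \<omega>) = y} = pmf (gw lam d) y"
proof -
  let ?p = "measure_pmf (gw (lam * s) d)"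
  have "ennreal (measure (P1 lam s) {\<omega> \<in> space (P1 lam s). trunc d (left_tree \<omega>) = y}) =
    (\<integral>\<^sup>+x. \<integral>\<^sup>+y'. \<integral>\<^sup>+z. (ennreal (tree_kernel lam s d x y') * indicator {y'} y) * ennreal (tree_kernel lam s d x z)
       \<partial>count_space UNIV \<partial>count_space UNIV \<partial>?p)"
    using P1_event[of lam s "\<lambda>(a, b, c). b = y" d]
    by (simp add: outcome_trunc_def indicator_def ac_simps eq_commute[of _ y])
  also have "\<dots> = (\<integral>\<^sup>+x. ennreal (tree_kernel lam s d x y) \<partial>?p)"
    by (rule nn_integral_cong_AE, unfold AE_measure_pmf_iff, rule ballI)
       (simp add: nn_integral_cmult nn_integral_tree_kernel nn_integral_count_space_indicator_singleton)
  also have "\<dots> = ennreal (pmf (gw lam d) y)"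
    by (rule tree_kernel_marginal[OF assms])
  finally show ?thesis by simp
qed

text \<open>By Bayes' rule the ratio in \<open>Vd\<close> equals the kernel divided by the law of
  the left tree. The joint law carries one further factor of the kernel; writing that factor as pmf
  times ratio produces the square, integrated against the product law.\<close>

lemma Vd_eq:
  assumes s: "0 \<le> s" "s \<le> 1" "0 \<le> lam"
  shows "Vd lam s d = (\<integral>\<^sup>+x. \<integral>\<^sup>+y. ennreal ((tree_kernel lam s d x y / pmf (gw lam d) y)\<^sup>2) \<partial>gw lam d \<partial>gw (lam * s) d)"
proof -
  let ?p = "pmf (gw (lam * s) d)" and ?q = "pmf (gw lam d)" and ?k = "tree_kernel lam s d"
  have "Vd lam s d = (\<integral>\<^sup>+\<omega>. (\<lambda>(x, y, z). ennreal (?p x * ?k x y / ?q y / ?p x)) (outcome_trunc d \<omega>) \<partial>P1 lam s)"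
    unfolding Vd_def cond_prob_def prune_eq_iff P1_common_left P1_common P1_left[OF s]
    by (simp add: outcome_trunc_def)
  also have "\<dots> = (\<integral>\<^sup>+x. \<integral>\<^sup>+y. \<integral>\<^sup>+z. ennreal (?k x y) * ennreal (?p x * ?k x y / ?q y / ?p x) * ennreal (?k x z)
       \<partial>count_space UNIV \<partial>count_space UNIV \<partial>gw (lam * s) d)"
    unfolding P1_law by (simp add: ac_simps)
  also have "\<dots> = (\<integral>\<^sup>+x. \<integral>\<^sup>+y. ennreal ((?k x y / ?q y)\<^sup>2) \<partial>gw lam d \<partial>gw (lam * s) d)"
  proof (rule nn_integral_cong_AE, unfold AE_measure_pmf_iff, rule ballI)
    fix x assume x: "x \<in> set_pmf (gw (lam * s) d)"
    have "(\<integral>\<^sup>+y. \<integral>\<^sup>+z. ennreal (?k x y) * ennreal (?p x * ?k x y / ?q y / ?p x) * ennreal (?k x z)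
       \<partial>count_space UNIV \<partial>count_space UNIV) =
       (\<integral>\<^sup>+y. ennreal (?k x y) * ennreal (?p x * ?k x y / ?q y / ?p x) \<partial>count_space UNIV)"
      by (simp add: nn_integral_cmult nn_integral_tree_kernel[OF x])
    also have "\<dots> = (\<integral>\<^sup>+y. ennreal (?q y) * ennreal ((?k x y / ?q y)\<^sup>2) \<partial>count_space UNIV)"
    proof (rule nn_integral_cong)
      fix y
      have "?p x \<noteq> 0" using x by (simp add: set_pmf_iff)
      then show "ennreal (?k x y) * ennreal (?p x * ?k x y / ?q y / ?p x) = ennreal (?q y) * ennreal ((?k x y / ?q y)\<^sup>2)"
        using tree_kernel_eq_0[OF s x, of y] tree_kernel_nonneg[of lam s d x y]
        by (cases "?q y = 0") (simp_all add: ennreal_mult[symmetric] power2_eq_square)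
    qed
    finally show "(\<integral>\<^sup>+y. \<integral>\<^sup>+z. ennreal (?k x y) * ennreal (?p x * ?k x y / ?q y / ?p x) * ennreal (?k x z)
       \<partial>count_space UNIV \<partial>count_space UNIV) = (\<integral>\<^sup>+y. ennreal ((?k x y / ?q y)\<^sup>2) \<partial>gw lam d)"
      by (simp add: nn_integral_measure_pmf)
  qed
  finally show ?thesis .
qed

section \<open>Second moment of a permutation average\<close>

text \<open>A permutation that maps \<open>S\<close> onto itself is determined by its restrictions
  to \<open>S\<close> and to \<open>A - S\<close>, which are permutations again; injectivity
  suffices for an upper bound.\<close>

lemma card_permutes_stabilizer_le:
  assumes "finite A" "S \<subseteq> A"
  shows "card {\<pi>. \<pi> permutes A \<and> \<pi> ` S = S} \<le> fact (card S) * fact (card A - card S)"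
proof -
  let ?f = "\<lambda>\<pi>. (\<lambda>x. if x \<in> S then \<pi> x else x, \<lambda>x. if x \<in> A - S then \<pi> x else (x :: 'a))"
  let ?B = "{\<pi>. \<pi> permutes S} \<times> {\<pi>. \<pi> permutes (A - S)}"
  have S: "finite S" using assms finite_subset by auto
  have "card {\<pi>. \<pi> permutes A \<and> \<pi> ` S = S} \<le> card ?B"
  proof (rule card_inj_on_le)
    show "inj_on ?f {\<pi>. \<pi> permutes A \<and> \<pi> ` S = S}"
    proof (rule inj_onI, rule ext)
      fix \<pi> \<rho> x
      assume a: "\<pi> \<in> {\<pi>. \<pi> permutes A \<and> \<pi> ` S = S}" "\<rho> \<in> {\<pi>. \<pi> permutes A \<and> \<pi> ` S = S}"
        and eq: "?f \<pi> = ?f \<rho>"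
      have "(if x \<in> S then \<pi> x else x) = (if x \<in> S then \<rho> x else x)"
        and "(if x \<in> A - S then \<pi> x else x) = (if x \<in> A - S then \<rho> x else x)"
        using fun_cong[OF arg_cong[where f = fst, OF eq], of x] fun_cong[OF arg_cong[where f = snd, OF eq], of x]
        by (simp_all only: fst_conv snd_conv)
      moreover have "x \<notin> A \<Longrightarrow> \<pi> x = \<rho> x" using a permutes_not_in[of \<pi> A x] permutes_not_in[of \<rho> A x] by simp
      ultimately show "\<pi> x = \<rho> x" by (auto split: if_splits)
    qed
    show "?f ` {\<pi>. \<pi> permutes A \<and> \<pi> ` S = S} \<subseteq> ?B"
    proof safe
      fix \<pi> assume p: "\<pi> permutes A" and S: "\<pi> ` S = S"
      have inj: "inj_on \<pi> X" for X using permutes_inj[OF p] by (rule inj_on_subset) simp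
      have bS: "bij_betw \<pi> S S" using inj S by (simp add: bij_betw_def)
      have "\<pi> ` (A - S) = A - S"
        using image_set_diff[OF permutes_inj[OF p], of A S] permutes_image[OF p] S by simp
      then have bA: "bij_betw \<pi> (A - S) (A - S)" using inj by (simp add: bij_betw_def)
      have "bij_betw (\<lambda>x. if x \<in> S then \<pi> x else x) S S"
        using bS by (rule bij_betw_cong[THEN iffD1, rotated]) auto
      then show "(\<lambda>x. if x \<in> S then \<pi> x else x) permutes S"
        by (rule bij_imp_permutes) simp
      have "bij_betw (\<lambda>x. if x \<in> A - S then \<pi> x else x) (A - S) (A - S)"
        using bA by (rule bij_betw_cong[THEN iffD1, rotated]) auto
      then show "(\<lambda>x. if x \<in> A - S then \<pi> x else x) permutes (A - S)"
        by (rule bij_imp_permutes) auto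
    qed
    show "finite ?B" using assms S by (simp add: finite_permutations)
  qed
  also have "card ?B = fact (card S) * fact (card A - card S)"
    using assms S by (simp add: card_cartesian_product card_permutations card_Diff_subset)
  finally show ?thesis .
qed

text \<open>Composition with \<open>inv \<pi>\<close> moves this coset of permutations into the
  stabiliser of \<open>S\<close>.\<close>

lemma card_permutes_same_image_le:
  assumes A: "finite A" "S \<subseteq> A" and \<pi>: "\<pi> permutes A"
  shows "card {\<rho>. \<rho> permutes A \<and> \<rho> ` S = \<pi> ` S} \<le> fact (card S) * fact (card A - card S)"
proof -
  have "card {\<rho>. \<rho> permutes A \<and> \<rho> ` S = \<pi> ` S} \<le> card {\<rho>. \<rho> permutes A \<and> \<rho> ` S = S}"
  proof (rule card_inj_on_le)
    show "inj_on (\<lambda>\<rho>. inv \<pi> \<circ> \<rho>) {\<rho>. \<rho> permutes A \<and> \<rho> ` S = \<pi> ` S}"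
      by (rule inj_onI) (metis comp_assoc permutes_inv_o(1)[OF \<pi>] id_o)
    show "(\<lambda>\<rho>. inv \<pi> \<circ> \<rho>) ` {\<rho>. \<rho> permutes A \<and> \<rho> ` S = \<pi> ` S} \<subseteq> {\<rho>. \<rho> permutes A \<and> \<rho> ` S = S}"
    proof safe
      fix \<rho> assume \<rho>: "\<rho> permutes A" "\<rho> ` S = \<pi> ` S"
      show "inv \<pi> \<circ> \<rho> permutes A"
        by (rule permutes_compose[OF \<rho>(1) permutes_inv[OF \<pi>]])
      have "(inv \<pi> \<circ> \<rho>) ` S = S"
        unfolding image_comp[symmetric] \<rho>(2) image_comp permutes_inv_o(2)[OF \<pi>] by simp
      then show "x \<in> S \<Longrightarrow> x \<in> (inv \<pi> \<circ> \<rho>) ` S" "y \<in> S \<Longrightarrow> (inv \<pi> \<circ> \<rho>) y \<in> S" for x y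
        by auto
    qed
    show "finite {\<rho>. \<rho> permutes A \<and> \<rho> ` S = S}"
      by (rule finite_subset[OF _ finite_permutations[OF A(1)]]) auto
  qed
  also have "\<dots> \<le> fact (card S) * fact (card A - card S)"
    by (rule card_permutes_stabilizer_le[OF A])
  finally show ?thesis .
qed

lemma sum_Pow_card:
  fixes h :: "nat \<Rightarrow> real"
  assumes "finite A"
  shows "(\<Sum>S\<in>Pow A. h (card S)) = (\<Sum>j\<le>card A. (card A choose j) * h j)"
proof -
  have "(\<Sum>S\<in>Pow A. h (card S)) = (\<Sum>j\<le>card A. \<Sum>S\<in>{S\<in>Pow A. card S = j}. h (card S))"
    by (rule sum.group[symmetric]) (use assms in \<open>auto intro: card_mono\<close>)
  also have "\<dots> = (\<Sum>j\<le>card A. (card A choose j) * h j)"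
    using n_subsets[OF assms] by (intro sum.cong) (auto simp: Pow_def)
  finally show ?thesis .
qed

text \<open>Stands in for Cauchy-Schwarz: it makes the cross terms integrable, and for two terms of
  equal norm it gives the same bound on their inner product.\<close>

lemma mult_le_half_squares: "\<bar>a * b\<bar> \<le> ((a::real)\<^sup>2 + b\<^sup>2) / 2"
proof -
  have "0 \<le> (\<bar>a\<bar> - \<bar>b\<bar>)\<^sup>2" by simp
  then show ?thesis by (simp add: power2_diff abs_mult)
qed

text \<open>Coordinate \<open>i\<close> is integrated innermost. A function that is not integrable
  has Bochner integral 0 by convention, which is convenient on fibres of a product, where
  integrability is known only almost everywhere.\<close>

lemma integral_PiM_coordinate_0:
  fixes r :: "'e pmf" and F :: "(nat \<Rightarrow> 'e) \<Rightarrow> real"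
  assumes i: "i < k" and F: "\<And>f. (\<integral>y. F (f(i := y)) \<partial>r) = 0"
  shows "(\<integral>f. F f \<partial>(\<Pi>\<^sub>M i\<in>{..<k}. measure_pmf r)) = 0"
proof (cases "integrable (\<Pi>\<^sub>M i\<in>{..<k}. measure_pmf r) F")
  case True
  interpret R: product_prob_space "\<lambda>_::nat. measure_pmf r" "{..<k}"
    by unfold_locales
  have ins: "{..<k} = insert i ({..<k} - {i})" using i by auto
  show ?thesis
    using R.product_integral_insert[of "{..<k} - {i}" i F, folded ins] True F by simp
qed (simp add: not_integrable_integral_eq)

text \<open>Abstract setting for the likelihood ratio minus 1. Centring is required at every point,
  so that coordinates can be integrated out on each fibre without exceptional null sets.\<close>

locale centered_kernel =
  fixes p :: "'a::countable pmf" and q :: "'b::countable pmf" and D :: "'a \<Rightarrow> 'b \<Rightarrow> real" and w :: real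
  assumes w_nonneg: "0 \<le> w"
    and square_norm: "(\<integral>\<^sup>+x. \<integral>\<^sup>+y. ennreal ((D x y)\<^sup>2) \<partial>q \<partial>p) = ennreal w"
    and centered_left: "\<And>y. (\<integral>x. D x y \<partial>p) = 0"
    and centered_right: "\<And>x. (\<integral>y. D x y \<partial>q) = 0"
begin

text \<open>The summand indexed by \<open>S\<close> when the product of the factors 1 + D, for the
  matching \<open>\<pi>\<close> of the two lists of children, is expanded.\<close>

definition term_prod :: "nat set \<Rightarrow> (nat \<Rightarrow> nat) \<Rightarrow> (nat \<Rightarrow> 'a) \<times> (nat \<Rightarrow> 'b) \<Rightarrow> real" where
  "term_prod S \<pi> z = (\<Prod>i\<in>S. D (fst z i) (snd z (\<pi> i)))"

context
  fixes c n :: nat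
begin

interpretation P: product_prob_space "\<lambda>_::nat. measure_pmf p" "{..<c}"
  by unfold_locales

interpretation Q: product_prob_space "\<lambda>_::nat. measure_pmf q" "{..<n}"
  by unfold_locales

abbreviation (input) "Mp \<equiv> \<Pi>\<^sub>M i\<in>{..<c}. measure_pmf p"
abbreviation (input) "Mq \<equiv> \<Pi>\<^sub>M i\<in>{..<n}. measure_pmf q"

interpretation PQ: pair_sigma_finite Mp Mq
  by (rule pair_sigma_finite.intro) unfold_locales

lemma measurable_D_coordinates:
  assumes i: "i < c" and j: "j < n"
  shows "(\<lambda>z. D (fst z i) (snd z j)) \<in> borel_measurable (Mp \<Otimes>\<^sub>M Mq)"
proof -
  have fi: "(\<lambda>z. fst z i) \<in> Mp \<Otimes>\<^sub>M Mq \<rightarrow>\<^sub>M count_space UNIV"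
    using measurable_compose[OF measurable_fst measurable_component_singleton[of i "{..<c}" "\<lambda>_. measure_pmf p"]] i
    by simp
  have sj: "(\<lambda>z. snd z j) \<in> Mp \<Otimes>\<^sub>M Mq \<rightarrow>\<^sub>M count_space UNIV"
    using measurable_compose[OF measurable_snd measurable_component_singleton[of j "{..<n}" "\<lambda>_. measure_pmf q"]] j
    by simp
  show ?thesis
    by (rule measurable_compose_countable[where g = "\<lambda>z. fst z i", OF _ fi])
       (rule measurable_compose[OF sj], simp)
qed

lemma borel_measurable_term_prod:
  assumes S: "S \<subseteq> {..<c}" and \<pi>: "\<pi> permutes {..<n}" and cn: "c \<le> n"
  shows "term_prod S \<pi> \<in> borel_measurable (Mp \<Otimes>\<^sub>M Mq)"
  unfolding term_prod_def
proof (rule borel_measurable_prod, rule measurable_D_coordinates)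
  fix i assume "i \<in> S"
  then show "i < c" using S by auto
  with cn have "i \<in> {..<n}" by auto
  then have "\<pi> i \<in> {..<n}" using permutes_in_image[OF \<pi>] by blast
  then show "\<pi> i < n" by simp
qed

text \<open>Since \<open>\<pi>\<close> is injective, different factors involve different coordinates
  on both sides. The square is a product of independent factors, each of mean
  \<open>w\<close>.\<close>

lemma nn_integral_term_prod:
  assumes S: "S \<subseteq> {..<c}" and \<pi>: "\<pi> permutes {..<n}" and cn: "c \<le> n"
  shows "(\<integral>\<^sup>+z. ennreal ((term_prod S \<pi> z)\<^sup>2) \<partial>(Mp \<Otimes>\<^sub>M Mq)) = ennreal (w ^ card S)"
proof -
  define H where "H x = (\<integral>\<^sup>+y. ennreal ((D x y)\<^sup>2) \<partial>q)" for x
  have inner: "(\<integral>\<^sup>+g. ennreal ((term_prod S \<pi> (f, g))\<^sup>2) \<partial>Mq) = (\<Prod>i<c. if i \<in> S then H (f i) else 1)" for f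
  proof -
    \<comment> \<open>Indexing by the right coordinate and padding with 1 off the image of
      \<open>S\<close> gives a product over all coordinates, as the factorisation over a product
      measure demands.\<close>
    define e where "e j y = (if j \<in> \<pi> ` S then ennreal ((D (f (inv \<pi> j)) y)\<^sup>2) else 1)" for j y
    have im: "\<pi> ` S \<subseteq> {..<n}"
      using S cn permutes_image[OF \<pi>] by (metis image_mono lessThan_subset_iff order_trans)
    have inj: "inj_on \<pi> S" using permutes_inj[OF \<pi>] by (rule inj_on_subset) simp
    have "ennreal ((term_prod S \<pi> (f, g))\<^sup>2) = (\<Prod>j<n. e j (g j))" for g
    proof -
      have "(\<Prod>j<n. e j (g j)) = (\<Prod>j\<in>\<pi> ` S. e j (g j))"
        by (rule prod.mono_neutral_right) (use im in \<open>auto simp: e_def\<close>)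
      also have "\<dots> = (\<Prod>i\<in>S. ennreal ((D (f i) (g (\<pi> i)))\<^sup>2))"
        by (subst prod.reindex[OF inj]) (simp add: e_def permutes_inverses[OF \<pi>])
      finally show ?thesis
        by (simp add: term_prod_def prod_power_distrib prod_ennreal)
    qed
    then have "(\<integral>\<^sup>+g. ennreal ((term_prod S \<pi> (f, g))\<^sup>2) \<partial>Mq) = (\<integral>\<^sup>+g. (\<Prod>j<n. e j (g j)) \<partial>Mq)"
      by simp
    also have "\<dots> = (\<Prod>j<n. \<integral>\<^sup>+y. e j y \<partial>q)"
      by (rule Q.product_nn_integral_prod) simp_all
    also have "\<dots> = (\<Prod>j\<in>\<pi> ` S. \<integral>\<^sup>+y. e j y \<partial>q)"
      by (rule prod.mono_neutral_right) (use im in \<open>auto simp: e_def\<close>)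
    also have "\<dots> = (\<Prod>i\<in>S. H (f i))"
      by (subst prod.reindex[OF inj]) (simp add: e_def[abs_def] permutes_inverses[OF \<pi>] H_def)
    also have "\<dots> = (\<Prod>i<c. if i \<in> S then H (f i) else 1)"
      by (rule prod.mono_neutral_cong_left) (use S in auto)
    finally show ?thesis .
  qed
  have meas: "(\<lambda>z. ennreal ((term_prod S \<pi> z)\<^sup>2)) \<in> borel_measurable (Mp \<Otimes>\<^sub>M Mq)"
    using borel_measurable_term_prod[OF assms] by simp
  have "(\<integral>\<^sup>+z. ennreal ((term_prod S \<pi> z)\<^sup>2) \<partial>(Mp \<Otimes>\<^sub>M Mq)) =
      (\<integral>\<^sup>+f. \<integral>\<^sup>+g. ennreal ((term_prod S \<pi> (f, g))\<^sup>2) \<partial>Mq \<partial>Mp)"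
    by (rule Q.nn_integral_fst[symmetric, OF meas])
  also have "\<dots> = (\<integral>\<^sup>+f. (\<Prod>i<c. if i \<in> S then H (f i) else 1) \<partial>Mp)"
    by (simp only: inner)
  also have "\<dots> = (\<Prod>i<c. \<integral>\<^sup>+x. (if i \<in> S then H x else 1) \<partial>p)"
    by (rule P.product_nn_integral_prod) simp_all
  also have "\<dots> = (\<Prod>i\<in>S. ennreal w)"
    by (rule prod.mono_neutral_cong_right) (use S square_norm in \<open>auto simp: H_def\<close>)
  also have "\<dots> = ennreal (w ^ card S)"
    by (simp add: ennreal_power w_nonneg)
  finally show ?thesis .
qed

lemma integrable_term_prod_square:
  assumes "S \<subseteq> {..<c}" "\<pi> permutes {..<n}" "c \<le> n"
  shows "integrable (Mp \<Otimes>\<^sub>M Mq) (\<lambda>z. (term_prod S \<pi> z)\<^sup>2)"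
  using borel_measurable_term_prod[OF assms] nn_integral_term_prod[OF assms]
  by (intro integrableI_nonneg) auto

lemma integral_term_prod_square:
  assumes "S \<subseteq> {..<c}" "\<pi> permutes {..<n}" "c \<le> n"
  shows "(\<integral>z. (term_prod S \<pi> z)\<^sup>2 \<partial>(Mp \<Otimes>\<^sub>M Mq)) = w ^ card S"
  using borel_measurable_term_prod[OF assms] nn_integral_term_prod[OF assms] w_nonneg
  by (subst integral_eq_nn_integral) auto

lemma integrable_term_prod_mult:
  assumes "S \<subseteq> {..<c}" "\<pi> permutes {..<n}" "S' \<subseteq> {..<c}" "\<pi>' permutes {..<n}" "c \<le> n"
  shows "integrable (Mp \<Otimes>\<^sub>M Mq) (\<lambda>z. term_prod S \<pi> z * term_prod S' \<pi>' z)"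
proof (rule Bochner_Integration.integrable_bound)
  show "integrable (Mp \<Otimes>\<^sub>M Mq) (\<lambda>z. ((term_prod S \<pi> z)\<^sup>2 + (term_prod S' \<pi>' z)\<^sup>2) / 2)"
    using assms by (simp add: integrable_term_prod_square)
  show "(\<lambda>z. term_prod S \<pi> z * term_prod S' \<pi>' z) \<in> borel_measurable (Mp \<Otimes>\<^sub>M Mq)"
    using assms by (intro borel_measurable_times borel_measurable_term_prod)
qed (use mult_le_half_squares in \<open>auto intro!: AE_I2\<close>)

lemma integral_term_prod_mult_le:
  assumes "S \<subseteq> {..<c}" "\<pi> permutes {..<n}" "\<pi>' permutes {..<n}" "c \<le> n"
  shows "(\<integral>z. term_prod S \<pi> z * term_prod S \<pi>' z \<partial>(Mp \<Otimes>\<^sub>M Mq)) \<le> w ^ card S"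
proof -
  have "(\<integral>z. term_prod S \<pi> z * term_prod S \<pi>' z \<partial>(Mp \<Otimes>\<^sub>M Mq)) \<le>
      (\<integral>z. ((term_prod S \<pi> z)\<^sup>2 + (term_prod S \<pi>' z)\<^sup>2) / 2 \<partial>(Mp \<Otimes>\<^sub>M Mq))"
    using assms by (intro integral_mono integrable_term_prod_mult)
      (auto simp: integrable_term_prod_square simp del: le_divide_eq_numeral1
        intro!: order_trans[OF abs_ge_self mult_le_half_squares])
  also have "\<dots> = w ^ card S"
    using assms by (simp add: integrable_term_prod_square integral_term_prod_square)
  finally show ?thesis .
qed

text \<open>The left coordinate \<open>i\<close> occurs only in the one factor
  \<open>D (f i) (g (\<pi> i))\<close>, whose mean in \<open>f i\<close> is 0.\<close>

lemma integral_term_prod_orthogonal_left: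
  assumes *: "S \<subseteq> {..<c}" "\<pi> permutes {..<n}" "S' \<subseteq> {..<c}" "\<pi>' permutes {..<n}" "c \<le> n"
    and i: "i \<in> S" "i \<notin> S'"
  shows "(\<integral>z. term_prod S \<pi> z * term_prod S' \<pi>' z \<partial>(Mp \<Otimes>\<^sub>M Mq)) = 0"
proof -
  have "(\<integral>f. term_prod S \<pi> (f, g) * term_prod S' \<pi>' (f, g) \<partial>Mp) = 0" for g
  proof (rule integral_PiM_coordinate_0)
    show "i < c" using i * by auto
    fix f
    have finS: "finite S" using * finite_subset by auto
    have "term_prod S \<pi> (f(i := y), g) * term_prod S' \<pi>' (f(i := y), g) =
        D y (g (\<pi> i)) * ((\<Prod>k\<in>S - {i}. D (f k) (g (\<pi> k))) * (\<Prod>k\<in>S'. D (f k) (g (\<pi>' k))))" for y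
    proof -
      have "term_prod S \<pi> (f(i := y), g) = D y (g (\<pi> i)) * (\<Prod>k\<in>S - {i}. D (f k) (g (\<pi> k)))"
        unfolding term_prod_def by (subst prod.remove[OF finS i(1)]) (auto intro!: prod.cong)
      moreover have "term_prod S' \<pi>' (f(i := y), g) = (\<Prod>k\<in>S'. D (f k) (g (\<pi>' k)))"
        unfolding term_prod_def using i by (intro prod.cong) auto
      ultimately show ?thesis by simp
    qed
    then show "(\<integral>y. term_prod S \<pi> (f(i := y), g) * term_prod S' \<pi>' (f(i := y), g) \<partial>p) = 0"
      by (simp add: centered_left)
  qed
  then show ?thesis
    using PQ.integral_snd[of "\<lambda>f g. term_prod S \<pi> (f, g) * term_prod S' \<pi>' (f, g)"]
      integrable_term_prod_mult[OF *] by (simp add: case_prod_unfold)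
qed

text \<open>Mirror image for a right coordinate \<open>j = \<pi> i\<close>: injectivity of
  \<open>\<pi>\<close> keeps it out of the other factors of the first term, and \<open>j\<close>
  outside the image of \<open>S'\<close> keeps it out of the second term.\<close>

lemma integral_term_prod_orthogonal_right:
  assumes *: "S \<subseteq> {..<c}" "\<pi> permutes {..<n}" "S' \<subseteq> {..<c}" "\<pi>' permutes {..<n}" "c \<le> n"
    and j: "j \<in> \<pi> ` S" "j \<notin> \<pi>' ` S'"
  shows "(\<integral>z. term_prod S \<pi> z * term_prod S' \<pi>' z \<partial>(Mp \<Otimes>\<^sub>M Mq)) = 0"
proof -
  from j obtain i where i: "i \<in> S" "j = \<pi> i" by auto
  have "(\<integral>g. term_prod S \<pi> (f, g) * term_prod S' \<pi>' (f, g) \<partial>Mq) = 0" for f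
  proof (rule integral_PiM_coordinate_0)
    have "i \<in> {..<n}" using i * by auto
    then show "j < n" using permutes_in_image[OF *(2)] i by blast
    fix g
    have finS: "finite S" using * finite_subset by auto
    have "term_prod S \<pi> (f, g(j := y)) * term_prod S' \<pi>' (f, g(j := y)) =
        D (f i) y * ((\<Prod>k\<in>S - {i}. D (f k) (g (\<pi> k))) * (\<Prod>k\<in>S'. D (f k) (g (\<pi>' k))))" for y
    proof -
      have "term_prod S \<pi> (f, g(j := y)) = D (f i) y * (\<Prod>k\<in>S - {i}. D (f k) (g (\<pi> k)))"
        unfolding term_prod_def using i(2) inj_eq[OF permutes_inj[OF *(2)]]
        by (subst prod.remove[OF finS i(1)]) (auto intro!: prod.cong)
      moreover have "\<pi>' k \<noteq> j" if "k \<in> S'" for k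
        using j(2) that by blast
      then have "term_prod S' \<pi>' (f, g(j := y)) = (\<Prod>k\<in>S'. D (f k) (g (\<pi>' k)))"
        unfolding term_prod_def by (intro prod.cong) auto
      ultimately show ?thesis by simp
    qed
    then show "(\<integral>y. term_prod S \<pi> (f, g(j := y)) * term_prod S' \<pi>' (f, g(j := y)) \<partial>q) = 0"
      by (simp add: centered_right)
  qed
  then show ?thesis
    using PQ.integral_fst[of "\<lambda>f g. term_prod S \<pi> (f, g) * term_prod S' \<pi>' (f, g)"]
      integrable_term_prod_mult[OF *] by (simp add: case_prod_unfold)
qed

lemma integral_term_prod_mult:
  assumes *: "S \<subseteq> {..<c}" "\<pi> permutes {..<n}" "S' \<subseteq> {..<c}" "\<pi>' permutes {..<n}" "c \<le> n"
  shows "(\<integral>z. term_prod S \<pi> z * term_prod S' \<pi>' z \<partial>(Mp \<Otimes>\<^sub>M Mq)) \<le>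
     (if S' = S \<and> \<pi>' ` S = \<pi> ` S then w ^ card S else 0)"
proof -
  consider "S' = S \<and> \<pi>' ` S = \<pi> ` S" | "\<exists>i. i \<in> S \<and> i \<notin> S'" | "\<exists>i. i \<in> S' \<and> i \<notin> S"
    | "S' = S" "\<pi>' ` S \<noteq> \<pi> ` S" by auto
  then show ?thesis
  proof cases
    case 1
    then show ?thesis using integral_term_prod_mult_le[OF *(1,2,4,5)] by simp
  next
    case 2
    then obtain i where "i \<in> S" "i \<notin> S'" by auto
    with integral_term_prod_orthogonal_left[OF * this] show ?thesis by auto
  next
    case 3
    then obtain i where "i \<in> S'" "i \<notin> S" by auto
    with integral_term_prod_orthogonal_left[OF *(3,4,1,2,5) this] show ?thesis by (auto simp: mult.commute)
  next
    case 4
    have "finite S" using * finite_subset by auto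
    moreover have "inj_on \<pi> S" "inj_on \<pi>' S"
      using permutes_inj[OF *(2)] permutes_inj[OF *(4)] by (auto intro: inj_on_subset)
    \<comment> \<open>Both images have the cardinality of \<open>S\<close>, so if they differ,
      neither contains the other.\<close>
    ultimately have "\<not> \<pi> ` S \<subseteq> \<pi>' ` S"
      using 4 by (metis card_image card_subset_eq finite_imageI)
    then obtain j where "j \<in> \<pi> ` S" "j \<notin> \<pi>' ` S'" using 4 by auto
    with integral_term_prod_orthogonal_right[OF * this] show ?thesis using 4 by simp
  qed
qed

text \<open>A pair \<open>(\<pi>, S)\<close> with \<open>card S = j\<close> meets at most
  \<open>j! (n - j)!\<close> pairs with a positive bound. Summing over the \<open>n!\<close>
  permutations and dividing by the square of \<open>n!\<close> leaves
  \<open>j! (n - j)! / n!\<close> for each set, which is 1 / (n choose j), and there are (c choose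
  j) sets of size \<open>j\<close>.\<close>

lemma nn_integral_permutation_average_le:
  assumes cn: "c \<le> n"
  shows "(\<integral>\<^sup>+f. \<integral>\<^sup>+g. ennreal (((\<Sum>\<pi>|\<pi> permutes {..<n}. \<Prod>i<c. 1 + D (f i) (g (\<pi> i))) / fact n)\<^sup>2) \<partial>Mq \<partial>Mp)
     \<le> ennreal (\<Sum>j\<le>c. w ^ j * (real (c choose j) / real (n choose j)))"
proof -
  let ?S = "{\<pi>. \<pi> permutes {..<n}}" and ?M = "Mp \<Otimes>\<^sub>M Mq"
  let ?I = "?S \<times> Pow {..<c}"
  define t where "t v z = term_prod (snd v) (fst v) z" for v z
  define G where "G z = (\<Sum>v\<in>?I. t v z) / fact n" for z
  have finS: "finite ?S" by (simp add: finite_permutations)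
  have G_eq: "(\<Sum>\<pi>\<in>?S. \<Prod>i<c. 1 + D (f i) (g (\<pi> i))) / fact n = G (f, g)" for f g
  proof -
    have "(\<Prod>i<c. 1 + D (f i) (g (\<pi> i))) = (\<Sum>S\<in>Pow {..<c}. term_prod S \<pi> (f, g))" for \<pi>
      using prod_add[of "{..<c}" "\<lambda>i. D (f i) (g (\<pi> i))" "\<lambda>_. 1"]
      by (simp add: term_prod_def add.commute)
    then show ?thesis unfolding G_def t_def
      by (simp add: sum.cartesian_product case_prod_unfold)
  qed
  have int: "integrable ?M (\<lambda>z. t v z * t v' z)" if "v \<in> ?I" "v' \<in> ?I" for v v'
    unfolding t_def using that cn by (intro integrable_term_prod_mult) auto
  have G2: "(G z)\<^sup>2 = (\<Sum>v\<in>?I. \<Sum>v'\<in>?I. t v z * t v' z) / (fact n)\<^sup>2" for z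
    unfolding G_def power_divide by (simp add: power2_eq_square sum_product)
  have intG: "integrable ?M (\<lambda>z. (G z)\<^sup>2)"
    unfolding G2 using int by (intro Bochner_Integration.integrable_divide Bochner_Integration.integrable_sum) auto
  \<comment> \<open>Row sums of the Gram matrix of the terms; the bound depends on the row only
    through the cardinality of its set.\<close>
  have stab: "(\<Sum>v'\<in>?I. \<integral>z. t v z * t v' z \<partial>?M) \<le> w ^ card (snd v) * (fact (card (snd v)) * fact (n - card (snd v)))"
    if v: "v \<in> ?I" for v
  proof -
    obtain \<pi> S where v': "v = (\<pi>, S)" "\<pi> permutes {..<n}" "S \<subseteq> {..<c}" using v by auto
    then have Sn: "S \<subseteq> {..<n}" using cn by auto
    have "(\<Sum>v'\<in>?I. \<integral>z. t v z * t v' z \<partial>?M) \<le>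
        (\<Sum>v'\<in>?I. if snd v' = S \<and> fst v' ` S = \<pi> ` S then w ^ card S else 0)"
      unfolding t_def using v' cn by (intro sum_mono order_trans[OF integral_term_prod_mult]) auto
    also have "\<dots> = (\<Sum>v'\<in>{\<rho>. \<rho> permutes {..<n} \<and> \<rho> ` S = \<pi> ` S} \<times> {S}. w ^ card S)"
      by (rule sum.mono_neutral_cong_right) (use v' finS in auto)
    also have "\<dots> = w ^ card S * card {\<rho>. \<rho> permutes {..<n} \<and> \<rho> ` S = \<pi> ` S}"
      by (simp add: card_cartesian_product)
    also have "\<dots> \<le> w ^ card S * real (fact (card S) * fact (card {..<n} - card S))"
      using card_permutes_same_image_le[OF finite_lessThan Sn v'(2)] w_nonneg
      by (intro mult_left_mono) (simp_all only: of_nat_le_iff zero_le_power)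
    finally show ?thesis using v' by simp
  qed
  have "(\<integral>z. (G z)\<^sup>2 \<partial>?M) = (\<Sum>v\<in>?I. \<Sum>v'\<in>?I. \<integral>z. t v z * t v' z \<partial>?M) / (fact n)\<^sup>2"
    unfolding G2 using int by (simp add: Bochner_Integration.integral_sum Bochner_Integration.integrable_sum)
  also have "\<dots> \<le> (\<Sum>v\<in>?I. w ^ card (snd v) * (fact (card (snd v)) * fact (n - card (snd v)))) / (fact n)\<^sup>2"
    by (intro divide_right_mono sum_mono stab) auto
  also have "\<dots> = (\<Sum>\<pi>\<in>?S. \<Sum>S\<in>Pow {..<c}. w ^ card S * (fact (card S) * fact (n - card S))) / (fact n)\<^sup>2"
    by (simp only: sum.cartesian_product case_prod_unfold)
  also have "\<dots> = (\<Sum>S\<in>Pow {..<c}. w ^ card S * (fact (card S) * fact (n - card S) / fact n))"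
    by (simp add: card_permutations power2_eq_square sum_divide_distrib)
  also have "\<dots> = (\<Sum>j\<le>c. (c choose j) * (w ^ j * (fact j * fact (n - j) / fact n)))"
    using sum_Pow_card[of "{..<c}" "\<lambda>j. w ^ j * (fact j * fact (n - j) / fact n)"] by simp
  also have "\<dots> = (\<Sum>j\<le>c. w ^ j * (real (c choose j) / real (n choose j)))"
    using cn by (intro sum.cong) (auto simp: binomial_fact[of _ n])
  finally have le: "(\<integral>z. (G z)\<^sup>2 \<partial>?M) \<le> (\<Sum>j\<le>c. w ^ j * (real (c choose j) / real (n choose j)))" .
  have "(\<integral>\<^sup>+f. \<integral>\<^sup>+g. ennreal ((G (f, g))\<^sup>2) \<partial>Mq \<partial>Mp) = (\<integral>\<^sup>+z. ennreal ((G z)\<^sup>2) \<partial>?M)"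
    using Q.nn_integral_fst[of "\<lambda>z. ennreal ((G z)\<^sup>2)" Mp] intG by auto
  also have "\<dots> = ennreal (\<integral>z. (G z)\<^sup>2 \<partial>?M)"
    by (rule nn_integral_eq_integral[OF intG]) simp
  finally show ?thesis unfolding G_eq using le by (simp add: ennreal_leI)
qed

end

end

section \<open>The recursion for the second moment\<close>

text \<open>The negative binomial series. Multiplication by one more geometric series raises
  \<open>m\<close> by 1, because binomial coefficients along a diagonal sum to the next one
  (hockey-stick identity).\<close>

lemma sums_choose:
  fixes s :: real
  assumes "0 \<le> s" "s < 1"
  shows "(\<lambda>i. s ^ i * real (i + m choose m)) sums (1 / (1 - s) ^ Suc m)"
proof (induction m)
  case 0
  show ?case using geometric_sums[of s] assms by simp
next
  case (Suc m)
  have geo: "summable (\<lambda>i. norm (s ^ i))" using assms by (simp add: summable_geometric)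
  have IH: "summable (\<lambda>i. norm (s ^ i * real (i + m choose m)))"
    using sums_summable[OF Suc] assms by simp
  have "(\<lambda>k. \<Sum>i\<le>k. s ^ i * (s ^ (k - i) * real (k - i + m choose m))) sums
      ((\<Sum>i. s ^ i) * (\<Sum>i. s ^ i * real (i + m choose m)))"
    by (rule Cauchy_product_sums[OF geo IH])
  also have "(\<lambda>k. \<Sum>i\<le>k. s ^ i * (s ^ (k - i) * real (k - i + m choose m))) =
      (\<lambda>k. s ^ k * real (k + Suc m choose Suc m))"
  proof (rule ext)
    fix k
    have "(\<Sum>i\<le>k. s ^ i * (s ^ (k - i) * real (k - i + m choose m))) = (\<Sum>i\<le>k. s ^ k * real (k - i + m choose m))"
      by (intro sum.cong) (auto simp: power_add[symmetric] mult.assoc[symmetric])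
    also have "\<dots> = s ^ k * real (\<Sum>i\<le>k. k - i + m choose m)"
      by (simp add: sum_distrib_left)
    also have "(\<Sum>i\<le>k. k - i + m choose m) = (\<Sum>i\<le>k. m + i choose m)"
      by (rule sum.reindex_bij_witness[where i = "\<lambda>i. k - i" and j = "\<lambda>i. k - i"]) (auto simp: add.commute)
    also have "\<dots> = (k + Suc m choose Suc m)"
      using choose_rising_sum(1)[of m k] by (simp add: ac_simps)
    finally show "(\<Sum>i\<le>k. s ^ i * (s ^ (k - i) * real (k - i + m choose m))) = s ^ k * real (k + Suc m choose Suc m)" .
  qed
  also have "(\<Sum>i. s ^ i) * (\<Sum>i. s ^ i * real (i + m choose m)) = 1 / (1 - s) ^ Suc (Suc m)"
    using sums_unique[OF Suc, symmetric] suminf_geometric[of s] assms by simp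
  finally show ?case .
qed

text \<open>Thinning: the product of the first and the last pmf divided by the one at
  \<open>c + m\<close> is the binomial weight (c + m choose c) s^c (1 - s)^m. Combine this with (c +
  m choose c) (c choose j) / (c + m choose j) = (c - j + m choose m); one factor
  \<open>pmf (poisson (lam * (1 - s))) m\<close> survives from the square.\<close>

lemma poisson_ratio:
  assumes lam: "0 < lam" and s: "0 \<le> s" "s < 1" and j: "j \<le> c"
  shows "pmf (poisson (lam * s)) c * pmf (poisson lam) (c + m) *
      (pmf (poisson (lam * (1 - s))) m / pmf (poisson lam) (c + m))\<^sup>2 * (real (c choose j) / real (c + m choose j)) =
    pmf (poisson (lam * (1 - s))) m * (1 - s) ^ m * (s ^ c * real (c - j + m choose m))"
proof -
  define e where "e = exp (- lam)"
  have e: "exp (- (lam * s)) * exp (- (lam * (1 - s))) = e"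
    unfolding e_def exp_add[symmetric] by (simp add: algebra_simps)
  have ch: "real (c + m choose j) = fact (c + m) / (fact j * fact (c + m - j))"
      "real (c choose j) = fact c / (fact j * fact (c - j))"
      "real (c - j + m choose m) = fact (c - j + m) / (fact m * fact (c - j))"
    using j by (simp_all add: binomial_fact)
  have cj: "c + m - j = c - j + m" using j by simp
  define E where "E = exp (- (lam * (1 - s)))"
  define E' where "E' = exp (- (lam * s))"
  have EE: "E' * E = e" using e by (simp add: E_def E'_def)
  have P: "pmf (poisson (lam * s)) c = lam ^ c * s ^ c / fact c * E'"
       "pmf (poisson lam) (c + m) = lam ^ c * lam ^ m / fact (c + m) * (E' * E)"
       "pmf (poisson (lam * (1 - s))) m = lam ^ m * (1 - s) ^ m / fact m * E"
    using lam s by (simp_all add: pmf_poisson_eq power_mult_distrib power_add EE) (simp_all add: E_def E'_def e_def)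
  define a b u where "a = lam ^ c" and "b = lam ^ m" and "u = (1 - s) ^ m"
  have nz: "a \<noteq> 0" "b \<noteq> 0" "E \<noteq> 0" "E' \<noteq> 0"
    using lam by (auto simp: a_def b_def E_def E'_def)
  show ?thesis
    unfolding P ch cj unfolding a_def[symmetric] b_def[symmetric] u_def[symmetric]
    using nz by (simp add: field_simps power2_eq_square)
qed

text \<open>Puts the number \<open>m = n - c\<close> of new children in place of the total
  degree.\<close>

lemma nn_integral_count_space_shift:
  fixes F :: "nat \<Rightarrow> ennreal"
  assumes "\<And>n. n < c \<Longrightarrow> F n = 0"
  shows "(\<integral>\<^sup>+n. F n \<partial>count_space UNIV) = (\<integral>\<^sup>+m. F (c + m) \<partial>count_space UNIV)"
proof -
  have "(\<integral>\<^sup>+n. F n \<partial>count_space UNIV) = (\<integral>\<^sup>+n. F n \<partial>count_space {c..})"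
    by (subst nn_integral_count_space_indicator[of "{c..}" F])
       (use assms in \<open>auto intro!: nn_integral_cong simp: indicator_def not_le\<close>)
  also have "\<dots> = (\<integral>\<^sup>+m. F (c + m) \<partial>count_space UNIV)"
    by (rule nn_integral_bij_count_space[symmetric])
       (auto simp: bij_betw_def inj_on_def image_def le_iff_add)
  finally show ?thesis .
qed

text \<open>The order of summation is the point. With \<open>m = n - c\<close> fixed, the sum over
  \<open>c\<close> is the Cauchy product of the geometric series in \<open>s * w\<close> and the
  negative binomial series in \<open>s\<close>. The factor 1 / (1 - s)^(m + 1) of the latter absorbs
  (1 - s)^m, and the remaining Poisson weights in \<open>m\<close> sum to 1.\<close>

lemma poisson_double_sum:
  assumes lam: "0 < lam" and s: "0 \<le> s" "s < 1" and w: "0 \<le> w" "s * w < 1"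
  shows "(\<integral>\<^sup>+c. \<integral>\<^sup>+n. (if c \<le> n then ennreal ((pmf (poisson (lam * (1 - s))) (n - c) / pmf (poisson lam) n)\<^sup>2 *
       (\<Sum>j\<le>c. w ^ j * (real (c choose j) / real (n choose j)))) else 0) \<partial>poisson lam \<partial>poisson (lam * s))
     = ennreal (1 / ((1 - s) * (1 - s * w)))"
proof -
  let ?r = "pmf (poisson (lam * (1 - s)))"
  \<comment> \<open>The weight s^c is shared out as s^j and s^(c - j), which exhibits the
    convolution.\<close>
  define X where "X c m = ?r m * (1 - s) ^ m * (\<Sum>j\<le>c. (s * w) ^ j * (s ^ (c - j) * real (c - j + m choose m)))" for c m
  have X_nonneg: "0 \<le> X c m" for c m
    using s w by (auto simp: X_def intro!: mult_nonneg_nonneg sum_nonneg)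
  let ?F = "\<lambda>c n. (pmf (poisson (lam * (1 - s))) (n - c) / pmf (poisson lam) n)\<^sup>2 *
       (\<Sum>j\<le>c. w ^ j * (real (c choose j) / real (n choose j)))"
  have F_nonneg: "0 \<le> ?F c n" for c n
    using w by (auto intro!: mult_nonneg_nonneg sum_nonneg)
  have FX: "pmf (poisson (lam * s)) c * (pmf (poisson lam) (c + m) * ?F c (c + m)) = X c m" for c m
  proof -
    have "pmf (poisson (lam * s)) c * (pmf (poisson lam) (c + m) * ?F c (c + m)) =
        (\<Sum>j\<le>c. w ^ j * (pmf (poisson (lam * s)) c * pmf (poisson lam) (c + m) *
      (?r m / pmf (poisson lam) (c + m))\<^sup>2 * (real (c choose j) / real (c + m choose j))))"
      unfolding sum_distrib_left add_diff_cancel_left' by (intro sum.cong refl) (simp only: ac_simps)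
    also have "\<dots> = (\<Sum>j\<le>c. w ^ j * (?r m * (1 - s) ^ m * (s ^ c * real (c - j + m choose m))))"
      by (intro sum.cong refl arg_cong2[where f = "(*)"] poisson_ratio[OF lam s]) simp
    also have "\<dots> = X c m"
      unfolding X_def sum_distrib_left
    proof (intro sum.cong refl)
      fix j assume "j \<in> {..c}"
      then have "s ^ c = s ^ j * s ^ (c - j)" by (simp add: power_add[symmetric])
      then show "w ^ j * (?r m * (1 - s) ^ m * (s ^ c * real (c - j + m choose m))) =
          ?r m * (1 - s) ^ m * ((s * w) ^ j * (s ^ (c - j) * real (c - j + m choose m)))"
        by (simp add: power_mult_distrib)
    qed
    finally show ?thesis .
  qed
  have "(\<integral>\<^sup>+c. \<integral>\<^sup>+n. (if c \<le> n then ennreal (?F c n) else 0) \<partial>poisson lam \<partial>poisson (lam * s)) =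
      (\<integral>\<^sup>+c. ennreal (pmf (poisson (lam * s)) c) * (\<integral>\<^sup>+n. ennreal (pmf (poisson lam) n) * (if c \<le> n then ennreal (?F c n) else 0) \<partial>count_space UNIV) \<partial>count_space UNIV)"
    by (simp only: nn_integral_measure_pmf)
  also have "\<dots> = (\<integral>\<^sup>+c. ennreal (pmf (poisson (lam * s)) c) * (\<integral>\<^sup>+m. ennreal (pmf (poisson lam) (c + m)) * ennreal (?F c (c + m)) \<partial>count_space UNIV) \<partial>count_space UNIV)"
  proof (rule nn_integral_cong, rule arg_cong2[where f = "(*)", OF refl])
    fix c
    show "(\<integral>\<^sup>+n. ennreal (pmf (poisson lam) n) * (if c \<le> n then ennreal (?F c n) else 0) \<partial>count_space UNIV) =
        (\<integral>\<^sup>+m. ennreal (pmf (poisson lam) (c + m)) * ennreal (?F c (c + m)) \<partial>count_space UNIV)"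
      by (subst nn_integral_count_space_shift[where c = c]) auto
  qed
  also have "\<dots> = (\<integral>\<^sup>+c. \<integral>\<^sup>+m. ennreal (pmf (poisson (lam * s)) c) * (ennreal (pmf (poisson lam) (c + m)) * ennreal (?F c (c + m))) \<partial>count_space UNIV \<partial>count_space UNIV)"
    by (intro nn_integral_cong nn_integral_cmult[symmetric]) simp
  also have "\<dots> = (\<integral>\<^sup>+c. \<integral>\<^sup>+m. ennreal (X c m) \<partial>count_space UNIV \<partial>count_space UNIV)"
    using F_nonneg by (simp only: FX[symmetric] ennreal_mult mult_nonneg_nonneg pmf_nonneg)
  also have "\<dots> = (\<integral>\<^sup>+m. \<integral>\<^sup>+c. ennreal (X c m) \<partial>count_space UNIV \<partial>count_space UNIV)"
    by (rule nn_integral_count_space_nn_integral) auto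
  also have "\<dots> = (\<integral>\<^sup>+m. ennreal (?r m) * ennreal (1 / ((1 - s) * (1 - s * w))) \<partial>count_space UNIV)"
  proof (rule nn_integral_cong)
    fix m
    have g: "summable (\<lambda>j. norm ((s * w) ^ j))" using s w by (simp add: summable_geometric)
    have h: "summable (\<lambda>i. norm (s ^ i * real (i + m choose m)))"
      using sums_summable[OF sums_choose[OF s, of m]] s by simp
    have "(\<lambda>c. \<Sum>j\<le>c. (s * w) ^ j * (s ^ (c - j) * real (c - j + m choose m))) sums
        ((\<Sum>j. (s * w) ^ j) * (\<Sum>i. s ^ i * real (i + m choose m)))"
      by (rule Cauchy_product_sums[OF g h])
    also have "(\<Sum>j. (s * w) ^ j) * (\<Sum>i. s ^ i * real (i + m choose m)) = 1 / (1 - s * w) * (1 / (1 - s) ^ Suc m)"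
      using sums_unique[OF sums_choose[OF s, of m], symmetric] suminf_geometric[of "s * w"] s w by simp
    finally have "(\<lambda>c. X c m) sums (?r m * (1 - s) ^ m * (1 / (1 - s * w) * (1 / (1 - s) ^ Suc m)))"
      unfolding X_def by (rule sums_mult)
    also have "?r m * (1 - s) ^ m * (1 / (1 - s * w) * (1 / (1 - s) ^ Suc m)) = ?r m * (1 / ((1 - s) * (1 - s * w)))"
      using s w by simp
    finally have sums: "(\<lambda>c. X c m) sums (?r m * (1 / ((1 - s) * (1 - s * w))))" .
    have "(\<integral>\<^sup>+c. ennreal (X c m) \<partial>count_space UNIV) = (\<Sum>c. ennreal (X c m))"
      by (rule nn_integral_count_space_nat)
    also have "\<dots> = ennreal (?r m * (1 / ((1 - s) * (1 - s * w))))"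
      by (rule suminf_ennreal_eq[OF X_nonneg sums])
    also have "\<dots> = ennreal (?r m) * ennreal (1 / ((1 - s) * (1 - s * w)))"
      by (rule ennreal_mult) (use s w in auto)
    finally show "(\<integral>\<^sup>+c. ennreal (X c m) \<partial>count_space UNIV) = ennreal (?r m) * ennreal (1 / ((1 - s) * (1 - s * w)))" .
  qed
  also have "\<dots> = (\<integral>\<^sup>+m. ennreal (1 / ((1 - s) * (1 - s * w))) \<partial>poisson (lam * (1 - s)))"
    by (simp only: nn_integral_measure_pmf)
  also have "\<dots> = ennreal (1 / ((1 - s) * (1 - s * w)))"
    by (simp add: measure_pmf.emeasure_space_1[simplified])
  finally show ?thesis .
qed

text \<open>
  Setting the value to 0 off the supports makes it centred at every point, not only almost surely.
\<close>

definition centered_lr :: "real \<Rightarrow> real \<Rightarrow> nat \<Rightarrow> ftree \<Rightarrow> ftree \<Rightarrow> real" where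
  "centered_lr lam s d x y = (if pmf (gw (lam * s) d) x = 0 \<or> pmf (gw lam d) y = 0 then 0
     else tree_kernel lam s d x y / pmf (gw lam d) y - 1)"

section \<open>Centring and norm of the likelihood ratio\<close>

lemma nn_integral_lr_right:
  assumes s: "0 \<le> s" "s \<le> 1" "0 \<le> lam" and x: "x \<in> set_pmf (gw (lam * s) d)"
  shows "(\<integral>\<^sup>+y. ennreal (tree_kernel lam s d x y / pmf (gw lam d) y) \<partial>gw lam d) = 1"
proof -
  have "(\<integral>\<^sup>+y. ennreal (tree_kernel lam s d x y / pmf (gw lam d) y) \<partial>gw lam d) = (\<integral>\<^sup>+y. ennreal (tree_kernel lam s d x y) \<partial>count_space UNIV)"
    unfolding nn_integral_measure_pmf
    by (intro nn_integral_cong) (auto simp: ennreal_mult[symmetric] tree_kernel_nonneg tree_kernel_eq_0[OF s x])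
  then show ?thesis by (simp add: nn_integral_tree_kernel[OF x])
qed

lemma nn_integral_lr_left:
  assumes s: "0 \<le> s" "s \<le> 1" "0 \<le> lam" and y: "pmf (gw lam d) y \<noteq> 0"
  shows "(\<integral>\<^sup>+x. ennreal (tree_kernel lam s d x y / pmf (gw lam d) y) \<partial>gw (lam * s) d) = 1"
proof -
  have pos: "0 < pmf (gw lam d) y" using y pmf_nonneg[of "gw lam d" y] by linarith
  have "(\<integral>\<^sup>+x. ennreal (tree_kernel lam s d x y / pmf (gw lam d) y) \<partial>gw (lam * s) d) =
      (\<integral>\<^sup>+x. ennreal (tree_kernel lam s d x y) \<partial>gw (lam * s) d) / ennreal (pmf (gw lam d) y)"
    using pos by (simp add: divide_ennreal[symmetric] tree_kernel_nonneg nn_integral_divide)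
  also have "\<dots> = 1"
    using pos by (simp add: tree_kernel_marginal[OF s] divide_ennreal)
  finally show ?thesis .
qed

lemma integral_minus_one_eq_0:
  fixes r :: "'a pmf"
  assumes "\<And>x. 0 \<le> F x" "(\<integral>\<^sup>+x. ennreal (F x) \<partial>r) = 1"
  shows "(\<integral>x. F x - 1 \<partial>r) = 0"
proof -
  have "integrable r F" using assms by (intro integrableI_nonneg) auto
  moreover have "(\<integral>x. F x \<partial>r) = 1" using assms by (subst integral_eq_nn_integral) auto
  ultimately show ?thesis by simp
qed

text \<open>Supplies the locale instance for the recursion; \<open>1 \<le> V\<close> comes along
  because the squared norm of the centred part is nonnegative.\<close>

lemma centered_kernel_lr:
  assumes s: "0 \<le> s" "s \<le> 1" "0 \<le> lam" and V: "Vd lam s d = ennreal V"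
  shows "centered_kernel (gw (lam * s) d) (gw lam d) (centered_lr lam s d) (V - 1) \<and> 1 \<le> V"
proof -
  let ?p = "gw (lam * s) d" and ?q = "gw lam d"
  let ?K = "\<lambda>x y. tree_kernel lam s d x y / pmf ?q y" and ?D = "centered_lr lam s d"
  have D: "?D x y = ?K x y - 1" if "x \<in> set_pmf ?p" "y \<in> set_pmf ?q" for x y
    using that by (simp add: centered_lr_def set_pmf_iff)
  \<comment> \<open>The expansion of (K - 1)^2 is rearranged into sums of nonnegative terms, since
    the integrals may still be infinite here and cannot be subtracted.\<close>
  have inner: "(\<integral>\<^sup>+y. ennreal ((?K x y)\<^sup>2) \<partial>?q) + 1 = (\<integral>\<^sup>+y. ennreal ((?D x y)\<^sup>2) \<partial>?q) + 2"
    if x: "x \<in> set_pmf ?p" for x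
  proof -
    have "(\<integral>\<^sup>+y. ennreal ((?K x y)\<^sup>2) \<partial>?q) + 1 = (\<integral>\<^sup>+y. ennreal ((?K x y)\<^sup>2) + 1 \<partial>?q)"
      by (simp add: nn_integral_add measure_pmf.emeasure_space_1[simplified])
    also have "\<dots> = (\<integral>\<^sup>+y. ennreal ((?D x y)\<^sup>2) + 2 * ennreal (?K x y) \<partial>?q)"
    proof (rule nn_integral_cong_AE, unfold AE_measure_pmf_iff, rule ballI)
      fix y assume y: "y \<in> set_pmf ?q"
      define k where "k = ?K x y"
      have k: "0 \<le> k" by (simp add: k_def tree_kernel_nonneg)
      have "k\<^sup>2 + 1 = (k - 1)\<^sup>2 + 2 * k"
        by (simp add: power2_diff)
      then have "ennreal (k\<^sup>2 + 1) = ennreal ((k - 1)\<^sup>2 + 2 * k)" by simp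
      then show "ennreal ((?K x y)\<^sup>2) + 1 = ennreal ((?D x y)\<^sup>2) + 2 * ennreal (?K x y)"
        unfolding D[OF x y] k_def[symmetric] using k by (simp add: ennreal_plus ennreal_mult)
    qed
    also have "\<dots> = (\<integral>\<^sup>+y. ennreal ((?D x y)\<^sup>2) \<partial>?q) + 2"
      by (simp add: nn_integral_add nn_integral_cmult nn_integral_lr_right[OF s x])
    finally show ?thesis .
  qed
  define X where "X = (\<integral>\<^sup>+x. \<integral>\<^sup>+y. ennreal ((?D x y)\<^sup>2) \<partial>?q \<partial>?p)"
  have "ennreal V + 1 = (\<integral>\<^sup>+x. (\<integral>\<^sup>+y. ennreal ((?K x y)\<^sup>2) \<partial>?q) + 1 \<partial>?p)"
    unfolding V[symmetric] Vd_eq[OF s] by (simp add: nn_integral_add measure_pmf.emeasure_space_1[simplified])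
  also have "\<dots> = (\<integral>\<^sup>+x. (\<integral>\<^sup>+y. ennreal ((?D x y)\<^sup>2) \<partial>?q) + 2 \<partial>?p)"
    by (intro nn_integral_cong_AE) (simp add: AE_measure_pmf_iff inner)
  also have "\<dots> = X + 2"
    unfolding X_def by (simp add: nn_integral_add measure_pmf.emeasure_space_1[simplified])
  finally have VX: "ennreal V + 1 = X + 2" .
  then have "X \<noteq> \<top>" by (metis ennreal_add_eq_top ennreal_neq_top ennreal_one_neq_top)
  then obtain r where r: "X = ennreal r" "0 \<le> r" by (cases X) auto
  \<comment> \<open>\<open>V\<close> is so far an arbitrary real and \<open>ennreal\<close> sends
    negative reals to 0. Passing to \<open>max V 0\<close> allows a comparison of reals, whose
    outcome excludes the negative case.\<close>
  have "ennreal (max V 0) = ennreal V" by (auto simp: max_def ennreal_neg)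
  then have "ennreal (max V 0 + 1) = ennreal (r + 2)"
    using VX r by (simp add: ennreal_plus)
  then have "max V 0 + 1 = r + 2" using r by (subst (asm) ennreal_inj) auto
  then have Vr: "V = r + 1" using r by (auto simp: max_def split: if_splits)
  have "centered_kernel ?p ?q ?D (V - 1)"
  proof
    show "0 \<le> V - 1" using Vr r by simp
    show "(\<integral>\<^sup>+x. \<integral>\<^sup>+y. ennreal ((?D x y)\<^sup>2) \<partial>?q \<partial>?p) = ennreal (V - 1)"
      using r Vr by (simp add: X_def)
    show "(\<integral>x. ?D x y \<partial>?p) = 0" for y
    proof (cases "pmf ?q y = 0")
      case True
      then show ?thesis by (simp add: centered_lr_def)
    next
      case False
      then have "(\<integral>x. ?D x y \<partial>?p) = (\<integral>x. ?K x y - 1 \<partial>?p)"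
        by (intro integral_cong_AE) (auto simp: AE_measure_pmf_iff D set_pmf_iff)
      then show ?thesis
        using integral_minus_one_eq_0[of "\<lambda>x. ?K x y" ?p] nn_integral_lr_left[OF s False] tree_kernel_nonneg by simp
    qed
    show "(\<integral>y. ?D x y \<partial>?q) = 0" for x
    proof (cases "pmf ?p x = 0")
      case True
      then show ?thesis by (simp add: centered_lr_def)
    next
      case False
      then have x: "x \<in> set_pmf ?p" by (simp add: set_pmf_iff)
      then have "(\<integral>y. ?D x y \<partial>?q) = (\<integral>y. ?K x y - 1 \<partial>?q)"
        by (intro integral_cong_AE) (auto simp: AE_measure_pmf_iff D)
      then show ?thesis
        using integral_minus_one_eq_0[of "\<lambda>y. ?K x y" ?q] nn_integral_lr_right[OF s x] tree_kernel_nonneg by simp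
    qed
  qed
  with Vr r show ?thesis by simp
qed

section \<open>One step of the recursion in the depth\<close>

lemma AE_PiM_set_pmf:
  "AE f in (\<Pi>\<^sub>M i\<in>{..<k::nat}. measure_pmf r). \<forall>i<k. f i \<in> set_pmf r"
proof -
  have "AE f in (\<Pi>\<^sub>M i\<in>{..<k}. measure_pmf r). \<forall>i\<in>{..<k}. f i \<in> set_pmf r"
  proof (rule AE_finite_allI)
    fix i assume "i \<in> {..<k}"
    then show "AE f in (\<Pi>\<^sub>M i\<in>{..<k}. measure_pmf r). f i \<in> set_pmf r"
      by (intro AE_PiM_component[where P = "\<lambda>x. x \<in> set_pmf r"])
         (auto simp: AE_measure_pmf_iff prob_space_measure_pmf)
  qed simp
  then show ?thesis by (rule AE_mp[OF _ AE_I2]) auto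
qed

text \<open>The product \<open>Q\<close> of the weights of all \<open>n\<close> subtrees is
  invariant under permutations, so it leaves the average and cancels. Each new child contributes
  exactly its weight, hence 1 after division, and each old child its own likelihood ratio; the
  latter is 1 plus \<open>centered_lr\<close> only on the supports, whence the conditions on
  \<open>f\<close> and \<open>g\<close>.\<close>

lemma lr_Suc:
  assumes f: "\<forall>i<c. f i \<in> set_pmf (gw (lam * s) d)" and g: "\<forall>i<n. g i \<in> set_pmf (gw lam d)" and cn: "c \<le> n"
  shows "tree_kernel lam s (Suc d) (FNode (map f [0..<c])) (FNode (map g [0..<n])) / pmf (gw lam (Suc d)) (FNode (map g [0..<n])) =
    pmf (poisson (lam * (1 - s))) (n - c) / pmf (poisson lam) n *
      ((\<Sum>\<pi>|\<pi> permutes {..<n}. \<Prod>i<c. 1 + centered_lr lam s d (f i) (g (\<pi> i))) / fact n)"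
proof -
  let ?S = "{\<pi>. \<pi> permutes {..<n}}"
  let ?q = "pmf (gw lam d)" and ?r = "pmf (poisson (lam * (1 - s)))"
  define Q where "Q = (\<Prod>i<n. ?q (g i))"
  have qpos: "?q (g i) \<noteq> 0" if "i < n" for i using g that by (simp add: set_pmf_iff)
  have Q: "Q \<noteq> 0" unfolding Q_def using qpos by simp
  have perm: "\<pi> i < n" if "\<pi> \<in> ?S" "i < n" for \<pi> i
    using permutes_in_image[of \<pi> "{..<n}" i] that by simp
  have tm: "(\<Prod>i<c. tree_kernel lam s d (f i) (g (\<pi> i))) * (\<Prod>i=c..<n. ?q (g (\<pi> i))) =
      Q * (\<Prod>i<c. 1 + centered_lr lam s d (f i) (g (\<pi> i)))" if \<pi>: "\<pi> \<in> ?S" for \<pi>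
  proof -
    have un: "{..<n} = {..<c} \<union> {c..<n}" using cn by auto
    have "Q = (\<Prod>i<n. ?q (g (\<pi> i)))"
      unfolding Q_def using prod.permute[of \<pi> "{..<n}" "\<lambda>i. ?q (g i)"] \<pi> by (simp add: comp_def)
    also have "\<dots> = (\<Prod>i<c. ?q (g (\<pi> i))) * (\<Prod>i=c..<n. ?q (g (\<pi> i)))"
      by (subst un, rule prod.union_disjoint) auto
    finally have Qs: "Q = (\<Prod>i<c. ?q (g (\<pi> i))) * (\<Prod>i=c..<n. ?q (g (\<pi> i)))" .
    have "(\<Prod>i<c. tree_kernel lam s d (f i) (g (\<pi> i))) = (\<Prod>i<c. ?q (g (\<pi> i)) * (1 + centered_lr lam s d (f i) (g (\<pi> i))))"
    proof (rule prod.cong[OF refl])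
      fix i assume i: "i \<in> {..<c}"
      then have "?q (g (\<pi> i)) \<noteq> 0" "pmf (gw (lam * s) d) (f i) \<noteq> 0"
        using qpos[OF perm[OF \<pi>]] f cn by (auto simp: set_pmf_iff)
      then show "tree_kernel lam s d (f i) (g (\<pi> i)) = ?q (g (\<pi> i)) * (1 + centered_lr lam s d (f i) (g (\<pi> i)))"
        by (simp add: centered_lr_def)
    qed
    then show ?thesis unfolding Qs by (simp add: prod.distrib)
  qed
  have "(\<Prod>i<c. tree_kernel lam s d (map f [0..<c] ! i) (map g [0..<n] ! \<pi> i)) * (\<Prod>i=c..<n. ?q (map g [0..<n] ! \<pi> i)) =
      Q * (\<Prod>i<c. 1 + centered_lr lam s d (f i) (g (\<pi> i)))" if \<pi>: "\<pi> \<in> ?S" for \<pi>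
    unfolding tm[OF \<pi>, symmetric] using perm[OF \<pi>] cn by (intro arg_cong2[where f = "(*)"] prod.cong) auto
  then have "tree_kernel lam s (Suc d) (FNode (map f [0..<c])) (FNode (map g [0..<n])) =
      ?r (n - c) * ((\<Sum>\<pi>\<in>?S. Q * (\<Prod>i<c. 1 + centered_lr lam s d (f i) (g (\<pi> i)))) / fact n)"
    using cn by (simp add: Let_def)
  moreover have "pmf (gw lam (Suc d)) (FNode (map g [0..<n])) = pmf (poisson lam) n * Q"
    unfolding pmf_gw_Suc Q_def by simp
  ultimately show ?thesis
    using Q by (simp add: sum_distrib_left[symmetric])
qed

lemma Vd_Suc_le:
  assumes s: "0 \<le> s" "s < 1" and lam: "0 < lam" and V: "Vd lam s d = ennreal V" and sV: "s * (V - 1) < 1"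
  shows "Vd lam s (Suc d) \<le> ennreal (1 / ((1 - s) * (1 - s * (V - 1))))"
proof -
  let ?p = "gw (lam * s) d" and ?q = "gw lam d"
  let ?r = "pmf (poisson (lam * (1 - s)))"
  have s': "0 \<le> s" "s \<le> 1" "0 \<le> lam" using s lam by auto
  have ck: "centered_kernel ?p ?q (centered_lr lam s d) (V - 1)" and V1: "1 \<le> V"
    using centered_kernel_lr[OF s' V] by auto
  define h where "h xs ys = ennreal ((tree_kernel lam s (Suc d) (FNode xs) (FNode ys) / pmf (gw lam (Suc d)) (FNode ys))\<^sup>2)" for xs ys
  define H where "H c n = (\<integral>\<^sup>+f. \<integral>\<^sup>+g. h (map f [0..<c]) (map g [0..<n]) \<partial>(\<Pi>\<^sub>M i\<in>{..<n}. measure_pmf ?q) \<partial>(\<Pi>\<^sub>M i\<in>{..<c}. measure_pmf ?p))" for c n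
  have meas: "(\<lambda>f. \<integral>\<^sup>+g. h (map f [0..<c]) (map g [0..<n]) \<partial>(\<Pi>\<^sub>M i\<in>{..<n}. measure_pmf ?q))
      \<in> borel_measurable (\<Pi>\<^sub>M i\<in>{..<c}. measure_pmf ?p)" for c n
    using measurable_compose[OF measurable_map_PiM[where n = c and p = ?p], of "\<lambda>xs. \<integral>\<^sup>+g. h xs (map g [0..<n]) \<partial>(\<Pi>\<^sub>M i\<in>{..<n}. measure_pmf ?q)" borel]
    by simp
  have "Vd lam s (Suc d) = (\<integral>\<^sup>+c. \<integral>\<^sup>+f. \<integral>\<^sup>+n. \<integral>\<^sup>+g. h (map f [0..<c]) (map g [0..<n]) \<partial>(\<Pi>\<^sub>M i\<in>{..<n}. measure_pmf ?q) \<partial>poisson lam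
      \<partial>(\<Pi>\<^sub>M i\<in>{..<c}. measure_pmf ?p) \<partial>poisson (lam * s))"
    unfolding Vd_eq[OF s'] nn_integral_gw_Suc h_def ..
  \<comment> \<open>In \<open>Vd_eq\<close> the observed degree \<open>n\<close> is averaged inside
    the integral over the common subtrees. The exchange fixes both degrees before the permutation
    average is estimated.\<close>
  also have "\<dots> = (\<integral>\<^sup>+c. \<integral>\<^sup>+n. H c n \<partial>poisson lam \<partial>poisson (lam * s))"
  proof (rule nn_integral_cong)
    fix c
    have "(\<integral>\<^sup>+f. \<integral>\<^sup>+n. \<integral>\<^sup>+g. h (map f [0..<c]) (map g [0..<n]) \<partial>(\<Pi>\<^sub>M i\<in>{..<n}. measure_pmf ?q) \<partial>poisson lam
      \<partial>(\<Pi>\<^sub>M i\<in>{..<c}. measure_pmf ?p)) = (\<integral>\<^sup>+n. \<integral>\<^sup>+f. ennreal (pmf (poisson lam) n) * (\<integral>\<^sup>+g. h (map f [0..<c]) (map g [0..<n]) \<partial>(\<Pi>\<^sub>M i\<in>{..<n}. measure_pmf ?q))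
      \<partial>(\<Pi>\<^sub>M i\<in>{..<c}. measure_pmf ?p) \<partial>count_space UNIV)"
      unfolding nn_integral_measure_pmf[of "poisson lam"]
      by (rule nn_integral_count_space_nn_integral) (use meas in auto)
    also have "\<dots> = (\<integral>\<^sup>+n. ennreal (pmf (poisson lam) n) * H c n \<partial>count_space UNIV)"
      unfolding H_def by (intro nn_integral_cong nn_integral_cmult meas)
    finally show "(\<integral>\<^sup>+f. \<integral>\<^sup>+n. \<integral>\<^sup>+g. h (map f [0..<c]) (map g [0..<n]) \<partial>(\<Pi>\<^sub>M i\<in>{..<n}. measure_pmf ?q) \<partial>poisson lam
      \<partial>(\<Pi>\<^sub>M i\<in>{..<c}. measure_pmf ?p)) = (\<integral>\<^sup>+n. H c n \<partial>poisson lam)"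
      by (simp only: nn_integral_measure_pmf)
  qed
  also have "\<dots> \<le> (\<integral>\<^sup>+c. \<integral>\<^sup>+n. (if c \<le> n then ennreal ((?r (n - c) / pmf (poisson lam) n)\<^sup>2 *
       (\<Sum>j\<le>c. (V - 1) ^ j * (real (c choose j) / real (n choose j)))) else 0) \<partial>poisson lam \<partial>poisson (lam * s))"
  proof (intro nn_integral_mono)
    fix c n
    show "H c n \<le> (if c \<le> n then ennreal ((?r (n - c) / pmf (poisson lam) n)\<^sup>2 *
       (\<Sum>j\<le>c. (V - 1) ^ j * (real (c choose j) / real (n choose j)))) else 0)"
    proof (cases "c \<le> n")
      \<comment> \<open>The kernel vanishes when the observed root has fewer children than the
        common one.\<close>
      case False
      then show ?thesis by (simp add: H_def h_def)
    next
      case True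
      define R where "R = ?r (n - c) / pmf (poisson lam) n"
      define A where "A f g = ((\<Sum>\<pi>|\<pi> permutes {..<n}. \<Prod>i<c. 1 + centered_lr lam s d (f i) (g (\<pi> i))) / fact n)\<^sup>2" for f g
      have "H c n = (\<integral>\<^sup>+f. \<integral>\<^sup>+g. ennreal (R\<^sup>2) * ennreal (A f g) \<partial>(\<Pi>\<^sub>M i\<in>{..<n}. measure_pmf ?q) \<partial>(\<Pi>\<^sub>M i\<in>{..<c}. measure_pmf ?p))"
        unfolding H_def
      proof (rule nn_integral_cong_AE, rule AE_mp[OF AE_PiM_set_pmf], rule AE_I2, rule impI,
            rule nn_integral_cong_AE, rule AE_mp[OF AE_PiM_set_pmf], rule AE_I2, rule impI)
        fix f :: "nat \<Rightarrow> ftree" and g :: "nat \<Rightarrow> ftree"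
        assume f: "\<forall>i<c. f i \<in> set_pmf ?p" and g: "\<forall>i<n. g i \<in> set_pmf ?q"
        show "h (map f [0..<c]) (map g [0..<n]) = ennreal (R\<^sup>2) * ennreal (A f g)"
          unfolding h_def lr_Suc[OF f g True] R_def[symmetric] A_def power_mult_distrib
          by (simp add: ennreal_mult)
      qed
      also have "\<dots> = ennreal (R\<^sup>2) * (\<integral>\<^sup>+f. \<integral>\<^sup>+g. ennreal (A f g) \<partial>(\<Pi>\<^sub>M i\<in>{..<n}. measure_pmf ?q) \<partial>(\<Pi>\<^sub>M i\<in>{..<c}. measure_pmf ?p))"
      proof -
        \<comment> \<open>Expressed through lists over a countable type, the integrand is measurable
          without further work.\<close>
        let ?B = "\<lambda>xs ys. ((\<Sum>\<pi>|\<pi> permutes {..<n}. \<Prod>i<c. 1 + centered_lr lam s d (xs ! i) (ys ! \<pi> i)) / fact n)\<^sup>2"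
        have AB: "A f g = ?B (map f [0..<c]) (map g [0..<n])" for f g
        proof -
          have "\<pi> i < n" if "\<pi> permutes {..<n}" "i < c" for \<pi> i
            using permutes_in_image[OF that(1), of i] that(2) True by simp
          then show ?thesis
            unfolding A_def by (intro arg_cong[where f = "\<lambda>x. (x / fact n)\<^sup>2"] sum.cong prod.cong) auto
        qed
        have m1: "(\<lambda>g. ennreal (A f g)) \<in> borel_measurable (\<Pi>\<^sub>M i\<in>{..<n}. measure_pmf ?q)" for f
          unfolding AB by (rule measurable_compose[OF measurable_map_PiM]) simp
        have m2: "(\<lambda>f. \<integral>\<^sup>+g. ennreal (A f g) \<partial>(\<Pi>\<^sub>M i\<in>{..<n}. measure_pmf ?q)) \<in> borel_measurable (\<Pi>\<^sub>M i\<in>{..<c}. measure_pmf ?p)"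
          unfolding AB
          using measurable_compose[OF measurable_map_PiM[where n = c and p = ?p],
            of "\<lambda>xs. \<integral>\<^sup>+g. ennreal (?B xs (map g [0..<n])) \<partial>(\<Pi>\<^sub>M i\<in>{..<n}. measure_pmf ?q)" borel]
          by simp
        show ?thesis by (simp only: nn_integral_cmult[OF m1] nn_integral_cmult[OF m2])
      qed
      also have "\<dots> \<le> ennreal (R\<^sup>2) * ennreal (\<Sum>j\<le>c. (V - 1) ^ j * (real (c choose j) / real (n choose j)))"
        unfolding A_def by (intro mult_left_mono centered_kernel.nn_integral_permutation_average_le[OF ck True]) simp
      also have "\<dots> = ennreal (R\<^sup>2 * (\<Sum>j\<le>c. (V - 1) ^ j * (real (c choose j) / real (n choose j))))"
        using V1 by (intro ennreal_mult[symmetric] sum_nonneg) auto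
      finally show ?thesis using True by (simp add: R_def)
    qed
  qed
  also have "\<dots> = ennreal (1 / ((1 - s) * (1 - s * (V - 1))))"
    by (rule poisson_double_sum[OF lam s]) (use V1 sV in auto)
  finally show ?thesis .
qed

lemma Vd_0: "0 \<le> s \<Longrightarrow> s \<le> 1 \<Longrightarrow> 0 \<le> lam \<Longrightarrow> Vd lam s 0 = 1"
  by (simp add: Vd_eq)

text \<open>With \<open>V \<le> 2\<close> and \<open>s \<le> 1 / 4\<close> both factors of the
  denominator are at least 3/4, so the next value is at most 16/9. The induction carries finiteness
  too, which is what allows \<open>Vd\<close> to be written as \<open>ennreal V\<close>.\<close>

lemma Vd_le_2:
  assumes s: "0 \<le> s" "s \<le> 1 / 4" and lam: "0 < lam"
  shows "Vd lam s d \<le> 2"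
proof (induction d)
  case 0
  then show ?case using assms by (simp add: Vd_0)
next
  case (Suc d)
  then have "Vd lam s d \<noteq> \<top>" using neq_top_trans[of 2] by simp
  then obtain V where V: "Vd lam s d = ennreal V" "0 \<le> V" by (cases "Vd lam s d") auto
  then have V2: "V \<le> 2" using Suc by (simp add: ennreal_le_iff2[of V 2, simplified])
  have sV: "s * (V - 1) \<le> 1 / 4"
  proof (cases "V \<le> 1")
    case True
    then have "s * (V - 1) \<le> 0" using s by (simp add: mult_nonneg_nonpos)
    then show ?thesis by simp
  next
    case False
    then have "s * (V - 1) \<le> 1 / 4 * 1" using s V2 by (intro mult_mono) auto
    then show ?thesis by simp
  qed
  have "Vd lam s (Suc d) \<le> ennreal (1 / ((1 - s) * (1 - s * (V - 1))))"
    using s sV by (intro Vd_Suc_le[OF _ _ lam V(1)]) auto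
  also have "\<dots> \<le> ennreal 2"
  proof (rule ennreal_leI)
    have "3 / 4 * (3 / 4) \<le> (1 - s) * (1 - s * (V - 1))" using s sV by (intro mult_mono) auto
    then show "1 / ((1 - s) * (1 - s * (V - 1))) \<le> 2" by (simp add: divide_le_eq)
  qed
  finally show ?case by simp
qed

section \<open>Impossibility of one-sided tests\<close>

text \<open>Only the likelihood ratio of the left tree is truncated; the right tree keeps its
  kernel. In the part weighted by 1 / M the indicator is dropped and the right tree integrates to 1,
  leaving \<open>Vd\<close>. In the other part the left tree has become independent of the common
  tree, so averaging over the latter turns the right kernel into \<open>gw lam d\<close>: this is
  the null model.\<close>

lemma likelihood_truncation_bound:
  fixes A :: "(ftree \<times> ftree) set"
  assumes s: "0 \<le> s" "s \<le> 1" "0 \<le> lam" and M: "0 < M"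
  shows "(\<integral>\<^sup>+x. \<integral>\<^sup>+y. \<integral>\<^sup>+z. ennreal (tree_kernel lam s d x y) * ennreal (tree_kernel lam s d x z) * indicator A (y, z)
       \<partial>count_space UNIV \<partial>count_space UNIV \<partial>gw (lam * s) d) \<le>
     ennreal (1 / M) * Vd lam s d + ennreal M * (\<integral>\<^sup>+y. \<integral>\<^sup>+z. indicator A (y, z) \<partial>gw lam d \<partial>gw lam d)"
    (is "?L \<le> _")
proof -
  let ?p = "gw (lam * s) d" and ?q = "pmf (gw lam d)" and ?k = "tree_kernel lam s d"
  let ?C = "count_space (UNIV :: ftree set)"
  have pw: "ennreal (?k x y) \<le> ennreal (1 / M) * (ennreal (?q y) * ennreal ((?k x y / ?q y)\<^sup>2)) + ennreal M * ennreal (?q y)"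
    if x: "x \<in> set_pmf ?p" for x y
  proof (cases "?q y = 0")
    case True
    then show ?thesis using tree_kernel_eq_0[OF s x] by simp
  next
    case False
    define a where "a = ?k x y / ?q y"
    have a: "0 \<le> a" and k: "?k x y = ?q y * a" using False by (simp_all add: a_def tree_kernel_nonneg)
    \<comment> \<open>Either a \<le> M, or a > M and then a \<le> a^2 / M; the sum of the two bounds
      needs no case distinction under the integral.\<close>
    have "a \<le> 1 / M * a\<^sup>2 + M"
    proof (cases "a \<le> M")
      case True
      then show ?thesis using M by (simp add: add_increasing)
    next
      case False
      then have "a * M \<le> a\<^sup>2" using a by (simp add: power2_eq_square mult_left_mono)
      then have "a \<le> 1 / M * a\<^sup>2" using M by (simp add: field_simps)
      then show ?thesis using M by linarith
    qed
    then have "?q y * a \<le> ?q y * (1 / M * a\<^sup>2 + M)" by (intro mult_left_mono) auto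
    then have "ennreal (?k x y) \<le> ennreal (1 / M * (?q y * a\<^sup>2) + M * ?q y)"
      unfolding k by (intro ennreal_leI) (simp add: algebra_simps)
    also have "\<dots> = ennreal (1 / M) * (ennreal (?q y) * ennreal (a\<^sup>2)) + ennreal M * ennreal (?q y)"
      using M by (subst ennreal_plus) (simp_all only: ennreal_mult zero_le_power2 pmf_nonneg mult_nonneg_nonneg
          divide_nonneg_pos zero_le_one less_imp_le)
    finally show ?thesis unfolding a_def .
  qed
  have "?L \<le> (\<integral>\<^sup>+x. \<integral>\<^sup>+y. \<integral>\<^sup>+z. ennreal (1 / M) * (ennreal (?q y) * ennreal ((?k x y / ?q y)\<^sup>2)) * ennreal (?k x z) +
       ennreal M * (ennreal (?q y) * (ennreal (?k x z) * indicator A (y, z))) \<partial>?C \<partial>?C \<partial>?p)"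
  proof (rule nn_integral_mono_AE, unfold AE_measure_pmf_iff, rule ballI, intro nn_integral_mono)
    fix x y z assume x: "x \<in> set_pmf ?p"
    have "ennreal (?k x y) * ennreal (?k x z) * indicator A (y, z) \<le>
      (ennreal (1 / M) * (ennreal (?q y) * ennreal ((?k x y / ?q y)\<^sup>2)) + ennreal M * ennreal (?q y)) * ennreal (?k x z) * indicator A (y, z)"
      using pw[OF x] by (intro mult_right_mono) auto
    also have "\<dots> \<le> ennreal (1 / M) * (ennreal (?q y) * ennreal ((?k x y / ?q y)\<^sup>2)) * ennreal (?k x z) +
       ennreal M * (ennreal (?q y) * (ennreal (?k x z) * indicator A (y, z)))"
      by (cases "(y, z) \<in> A") (simp_all add: distrib_right mult.assoc)
    finally show "ennreal (?k x y) * ennreal (?k x z) * indicator A (y, z) \<le> \<dots>" .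
  qed
  also have "\<dots> = (\<integral>\<^sup>+x. ennreal (1 / M) * (\<integral>\<^sup>+y. ennreal ((?k x y / ?q y)\<^sup>2) \<partial>gw lam d) +
       ennreal M * (\<integral>\<^sup>+y. ennreal (?q y) * (\<integral>\<^sup>+z. ennreal (?k x z) * indicator A (y, z) \<partial>?C) \<partial>?C) \<partial>?p)"
    by (rule nn_integral_cong_AE)
       (auto simp: AE_measure_pmf_iff nn_integral_add nn_integral_cmult nn_integral_tree_kernel nn_integral_measure_pmf[of "gw lam d"])
  also have "\<dots> = ennreal (1 / M) * Vd lam s d +
       ennreal M * (\<integral>\<^sup>+x. \<integral>\<^sup>+y. ennreal (?q y) * (\<integral>\<^sup>+z. ennreal (?k x z) * indicator A (y, z) \<partial>?C) \<partial>?C \<partial>?p)"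
    unfolding Vd_eq[OF s] by (simp add: nn_integral_add nn_integral_cmult)
  also have "(\<integral>\<^sup>+x. \<integral>\<^sup>+y. ennreal (?q y) * (\<integral>\<^sup>+z. ennreal (?k x z) * indicator A (y, z) \<partial>?C) \<partial>?C \<partial>?p) =
      (\<integral>\<^sup>+y. \<integral>\<^sup>+x. ennreal (?q y) * (\<integral>\<^sup>+z. ennreal (?k x z) * indicator A (y, z) \<partial>?C) \<partial>?p \<partial>?C)"
    by (rule nn_integral_count_space_nn_integral) auto
  also have "\<dots> = (\<integral>\<^sup>+y. ennreal (?q y) * (\<integral>\<^sup>+x. \<integral>\<^sup>+z. ennreal (?k x z) * indicator A (y, z) \<partial>?C \<partial>?p) \<partial>?C)"
    by (simp add: nn_integral_cmult)
  also have "\<dots> = (\<integral>\<^sup>+y. \<integral>\<^sup>+z. indicator A (y, z) \<partial>gw lam d \<partial>gw lam d)"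
    unfolding nn_integral_measure_pmf[of "gw lam d"]
  proof (intro nn_integral_cong arg_cong2[where f = "(*)"] refl)
    fix y
    have "(\<integral>\<^sup>+x. \<integral>\<^sup>+z. ennreal (?k x z) * indicator A (y, z) \<partial>?C \<partial>?p) =
        (\<integral>\<^sup>+z. \<integral>\<^sup>+x. ennreal (?k x z) * indicator A (y, z) \<partial>?p \<partial>?C)"
      by (rule nn_integral_count_space_nn_integral) auto
    then show "(\<integral>\<^sup>+x. \<integral>\<^sup>+z. ennreal (?k x z) * indicator A (y, z) \<partial>?C \<partial>?p) =
        (\<integral>\<^sup>+z. ennreal (?q z) * indicator A (y, z) \<partial>?C)"
      by (simp add: nn_integral_multc tree_kernel_marginal[OF s])
  qed
  finally show ?thesis .
qed

section \<open>Tests as events on pruned trees\<close>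

lemma GW_law: "(\<integral>\<^sup>+t. F (trunc d t) \<partial>GW \<mu>) = (\<integral>\<^sup>+y. F y \<partial>gw \<mu> d)"
proof -
  have "trunc d \<in> GW \<mu> \<rightarrow>\<^sub>M count_space UNIV" by measurable
  from nn_integral_countable_valued[OF this, of F] show ?thesis
    by (simp add: GW_trunc_law nn_integral_measure_pmf mult.commute)
qed

definition accept :: "nat \<Rightarrow> (nat \<Rightarrow> rtree \<times> rtree \<Rightarrow> nat) \<Rightarrow> (ftree \<times> ftree) set" where
  "accept n T = {(y, z). T n (rtree_of y, rtree_of z) = 1}"

lemma P0_upto_event:
  "ennreal (\<P>(x in P0_upto lam n. T n x = 1)) = (\<integral>\<^sup>+y. \<integral>\<^sup>+z. indicator (accept n T) (y, z) \<partial>gw lam n \<partial>gw lam n)"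
proof -
  interpret G: prob_space "GW lam" by (rule prob_space_GW)
  interpret P: prob_space "P0 lam" unfolding P0_def by (intro prob_space_pair prob_space_GW)
  let ?f = "\<lambda>(t, t'). (prune n t, prune n t')"
  let ?N = "count_space (trees_upto n \<times> trees_upto n)"
  have tr: "(\<lambda>(t, t'). (trunc n t, trunc n t')) \<in> P0 lam \<rightarrow>\<^sub>M count_space UNIV"
  proof -
    have "(\<lambda>(t, t'). (trunc n t, trunc n t')) \<in> P0 lam \<rightarrow>\<^sub>M count_space UNIV \<Otimes>\<^sub>M count_space UNIV"
      unfolding P0_def by measurable
    then show ?thesis by (simp add: pair_measure_countable)
  qed
  have f: "?f \<in> P0 lam \<rightarrow>\<^sub>M ?N"
  proof (rule measurableI)
    fix B assume "B \<in> sets ?N"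
    have "?f -` B \<inter> space (P0 lam) = (\<lambda>(t, t'). (trunc n t, trunc n t')) -` {(y, z). (rtree_of y, rtree_of z) \<in> B} \<inter> space (P0 lam)"
      by (auto simp: prune_eq_rtree_of)
    then show "?f -` B \<inter> space (P0 lam) \<in> sets (P0 lam)"
      by (simp only:) (rule measurable_sets[OF tr], simp)
  qed (auto simp: prune_in_trees_upto)
  have "{x \<in> space (P0_upto lam n). T n x = 1} \<in> sets ?N" by (auto simp: P0_upto_def)
  then have "ennreal (\<P>(x in P0_upto lam n. T n x = 1)) = emeasure (P0 lam) (?f -` {x \<in> space (P0_upto lam n). T n x = 1} \<inter> space (P0 lam))"
    unfolding P0_upto_def by (subst measure_distr[OF f]) (simp_all add: P.emeasure_eq_measure)
  also have "\<dots> = (\<integral>\<^sup>+z. indicator (accept n T) (case z of (t, t') \<Rightarrow> (trunc n t, trunc n t')) \<partial>P0 lam)"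
  proof -
    have eq: "?f -` {x \<in> space (P0_upto lam n). T n x = 1} \<inter> space (P0 lam) =
        (\<lambda>(t, t'). (trunc n t, trunc n t')) -` accept n T \<inter> space (P0 lam)"
      using prune_in_trees_upto by (auto simp: P0_upto_def accept_def prune_eq_rtree_of)
    have "(\<lambda>(t, t'). (trunc n t, trunc n t')) -` accept n T \<inter> space (P0 lam) \<in> sets (P0 lam)"
      by (rule measurable_sets[OF tr]) simp
    from nn_integral_indicator[OF this, symmetric] show ?thesis
      unfolding eq
    proof (rule trans)
      show "(\<integral>\<^sup>+z. indicator ((\<lambda>(t, t'). (trunc n t, trunc n t')) -` accept n T \<inter> space (P0 lam)) z \<partial>P0 lam) =
          (\<integral>\<^sup>+z. indicator (accept n T) (case z of (t, t') \<Rightarrow> (trunc n t, trunc n t')) \<partial>P0 lam)"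
        by (rule nn_integral_cong) (auto simp: indicator_def)
    qed
  qed
  also have "\<dots> = (\<integral>\<^sup>+t. \<integral>\<^sup>+t'. indicator (accept n T) (trunc n t, trunc n t') \<partial>GW lam \<partial>GW lam)"
    using measurable_compose[OF tr, of "indicator (accept n T)" borel]
    unfolding P0_def by (subst G.nn_integral_fst[symmetric]) simp_all
  also have "\<dots> = (\<integral>\<^sup>+y. \<integral>\<^sup>+z. indicator (accept n T) (y, z) \<partial>gw lam n \<partial>gw lam n)"
  proof -
    have "(\<integral>\<^sup>+t'. indicator (accept n T) (y, trunc n t') \<partial>GW lam) = (\<integral>\<^sup>+z. indicator (accept n T) (y, z) \<partial>gw lam n)" for y
      by (rule GW_law[where F = "\<lambda>z. indicator (accept n T) (y, z)"])
    then show ?thesis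
      by (simp only: GW_law[where F = "\<lambda>y. \<integral>\<^sup>+z. indicator (accept n T) (y, z) \<partial>gw lam n"])
  qed
  finally show ?thesis .
qed

lemma P1_upto_event:
  "ennreal (\<P>(x in P1_upto lam s n. T n x = 1)) =
    (\<integral>\<^sup>+x. \<integral>\<^sup>+y. \<integral>\<^sup>+z. ennreal (tree_kernel lam s n x y) * ennreal (tree_kernel lam s n x z) * indicator (accept n T) (y, z)
       \<partial>count_space UNIV \<partial>count_space UNIV \<partial>gw (lam * s) n)"
proof -
  let ?f = "\<lambda>\<omega>. (prune n (left_tree \<omega>), prune n (right_tree \<omega>))"
  let ?N = "count_space (trees_upto n \<times> trees_upto n)"
  have f: "?f \<in> P1 lam s \<rightarrow>\<^sub>M ?N"
  proof (rule measurableI)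
    fix B assume "B \<in> sets ?N"
    have "?f -` B \<inter> space (P1 lam s) = outcome_trunc n -` {(x, y, z). (rtree_of y, rtree_of z) \<in> B} \<inter> space (P1 lam s)"
      by (auto simp: prune_eq_rtree_of outcome_trunc_def)
    then show "?f -` B \<inter> space (P1 lam s) \<in> sets (P1 lam s)"
      by (simp only:) (rule measurable_sets[OF measurable_outcome_trunc], simp)
  qed (auto simp: prune_in_trees_upto)
  have "{x \<in> space (P1_upto lam s n). T n x = 1} \<in> sets ?N" by (auto simp: P1_upto_def)
  then have "\<P>(x in P1_upto lam s n. T n x = 1) = measure (P1 lam s) (?f -` {x \<in> space (P1_upto lam s n). T n x = 1} \<inter> space (P1 lam s))"
    unfolding P1_upto_def by (subst measure_distr[OF f]) simp_all
  also have "?f -` {x \<in> space (P1_upto lam s n). T n x = 1} \<inter> space (P1 lam s) =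
      {\<omega> \<in> space (P1 lam s). (\<lambda>(x, y, z). (y, z) \<in> accept n T) (outcome_trunc n \<omega>)}"
    using prune_in_trees_upto by (auto simp: P1_upto_def accept_def prune_eq_rtree_of outcome_trunc_def)
  finally show ?thesis
    using P1_event[of lam s "\<lambda>(x, y, z). (y, z) \<in> accept n T" n] by (simp add: indicator_def)
qed

lemma P1_upto_le:
  assumes s: "0 \<le> s" "s \<le> 1" "0 \<le> lam" and M: "0 < M" and V: "Vd lam s n \<le> ennreal B" "0 \<le> B"
  shows "\<P>(x in P1_upto lam s n. T n x = (1::nat)) \<le> B / M + M * \<P>(x in P0_upto lam n. T n x = 1)"
proof -
  have "ennreal (\<P>(x in P1_upto lam s n. T n x = 1)) \<le>
      ennreal (1 / M) * Vd lam s n + ennreal M * ennreal (\<P>(x in P0_upto lam n. T n x = 1))"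
    unfolding P1_upto_event[of lam s n T] P0_upto_event[of lam n T] by (rule likelihood_truncation_bound[OF s M])
  also have "\<dots> \<le> ennreal (1 / M) * ennreal B + ennreal M * ennreal (\<P>(x in P0_upto lam n. T n x = 1))"
    by (intro add_right_mono mult_left_mono V) simp
  also have "\<dots> = ennreal (1 / M * B + M * \<P>(x in P0_upto lam n. T n x = 1))"
    using M V by (subst ennreal_plus) (simp_all only: ennreal_mult measure_nonneg mult_nonneg_nonneg
          divide_nonneg_pos zero_le_one less_imp_le)
  finally show ?thesis
    using M V by (subst (asm) ennreal_le_iff) auto
qed

lemma no_one_sided_test:
  assumes s: "0 \<le> s" "s \<le> 1" "0 \<le> lam" and V: "\<And>n. Vd lam s n \<le> ennreal B" and B: "0 < B"
  shows "\<not> one_sided_test lam s T"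
proof
  assume "one_sided_test lam s T"
  then have P0: "(\<lambda>n. \<P>(x in P0_upto lam n. T n x = 1)) \<longlonglongrightarrow> 0"
    and P1: "liminf (\<lambda>n. ereal (\<P>(x in P1_upto lam s n. T n x = 1))) > 0"
    by (auto simp: one_sided_test_def)
  from P1 obtain e where e: "0 < ereal e" "ereal e < liminf (\<lambda>n. ereal (\<P>(x in P1_upto lam s n. T n x = 1)))"
    using ereal_dense2 by blast
  then have ev1: "\<forall>\<^sub>F n in sequentially. e < \<P>(x in P1_upto lam s n. T n x = 1)"
    using less_LiminfD[OF e(2)] by simp
  \<comment> \<open>This choice makes the error term B / M equal to e / 2; the threshold e / (2 M)
    for the null probability bounds the other term by e / 2.\<close>
  define M where "M = 2 * B / e"
  have e0: "0 < e" using e by simp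
  have M: "0 < M" using e0 B by (simp add: M_def)
  have "\<forall>\<^sub>F n in sequentially. \<P>(x in P0_upto lam n. T n x = 1) < e / (2 * M)"
    using order_tendstoD(2)[OF P0, of "e / (2 * M)"] e0 M by simp
  with ev1 have "\<forall>\<^sub>F n in sequentially. False"
  proof eventually_elim
    case (elim n)
    have "\<P>(x in P1_upto lam s n. T n x = 1) \<le> B / M + M * \<P>(x in P0_upto lam n. T n x = 1)"
      using B by (intro P1_upto_le[OF s M V]) simp
    also have "\<dots> \<le> B / M + M * (e / (2 * M))"
      using elim M by (intro add_left_mono mult_left_mono) auto
    also have "\<dots> = e" using M B e0 by (simp add: M_def field_simps)
    finally show False using elim by simp
  qed
  then show False by simp
qed

theorem theorem6:
  fixes \<kappa> :: real
  assumes "\<kappa> < 1"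
  shows "\<exists>\<Lambda>::real. \<forall>lam s. lam \<ge> \<Lambda> \<and> lam > 0 \<and> s \<in> {0..1} \<and> lam * s\<^sup>2 = \<kappa> \<longrightarrow>
           limsup (\<lambda>d. Vd lam s d) < \<infinity> \<and>
           \<not> (\<exists>T. one_sided_test lam s T)"
proof (intro exI[of _ 16] allI impI)
  fix lam s :: real
  assume "lam \<ge> 16 \<and> lam > 0 \<and> s \<in> {0..1} \<and> lam * s\<^sup>2 = \<kappa>"
  then have lam: "16 \<le> lam" "0 < lam" and s: "0 \<le> s" "s \<le> 1" and k: "lam * s\<^sup>2 = \<kappa>" by auto
  \<comment> \<open>From 16 s^2 \<le> \<kappa> < 1: the constant 16 is the square of the 4 in s
    \<le> 1/4, and it serves every \<kappa> < 1.\<close>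
  have "16 * s\<^sup>2 \<le> lam * s\<^sup>2" using lam by (intro mult_right_mono) auto
  then have "s\<^sup>2 \<le> (1 / 4)\<^sup>2" using k assms by (simp add: power_divide)
  then have "s \<le> 1 / 4" by (rule power2_le_imp_le) simp
  then have V: "Vd lam s d \<le> ennreal 2" for d
    using Vd_le_2[of s lam d] s lam by simp
  have "limsup (\<lambda>d. Vd lam s d) \<le> ennreal 2"
    by (rule Limsup_bounded) (simp add: V[simplified])
  then have "limsup (\<lambda>d. Vd lam s d) < \<infinity>"
    by (rule order.strict_trans1) simp
  moreover have "\<not> one_sided_test lam s T" for T
    by (rule no_one_sided_test[OF s _ V]) (use lam in auto)
  ultimately show "limsup (\<lambda>d. Vd lam s d) < \<infinity> \<and> \<not> (\<exists>T. one_sided_test lam s T)" by blast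
qed

end
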